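(* Let $\nu\in\mathbb{C}$ and $x\in[0,1]$. Then the following Fourier–Legendre expansion holds: \[ {}_{2}F_{1}\left(-\nu,\nu+1;1;x\right)\,{}_{2}F_{1}\left(-\nu,\nu+1;1;1-x\right) =-\frac{\sin\left(\pi\nu\right)}{2}\sum_{m\geq0}\left[\frac{1}{4^{m}}\binom{2m}{m}\right]^{2}\frac{\Gamma\left(m-\nu\right)\Gamma\left(m+\nu+1\right)\left(4m+1\right)}{\Gamma\left(m-\nu+\frac{1}{2}\right)\Gamma\left(m+\nu+\frac{3}{2}\right)}P_{2m}\left(2x-1\right), \] where any indeterminate form appearing in the coefficients is to be interpreted as the corresponding limit.
   Context: ${}_{2}F_{1}(a,b;c;z)$ denotes the Gauss hypergeometric function, $\Gamma$ is Euler's Gamma function, and $P_{n}$ denotes the Legendre polynomial of degree $n$. A Fourier–Legendre expansion of a function $f$ on $[0,1]$ is its expansion as a series $\sum_{n\ge0} c_n P_n(2x-1)$ with $c_n=(2n+1)\int_0^1 f(x)P_n(2x-1)\,dx$.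
   Formalization: At x = 0 or 1 with ν not an integer, both the hypergeometric series at 1 and the right-hand series diverge, so there the equality is replaced by the statement that the partial sums of both sides tend to infinity; equality is proved for 0<x<1, and on all of [0,1] for integer ν. *)

theory Defs
  imports "HOL-Analysis.Analysis" "HOL-Analysis.FPS_Convergence"
    "HOL-Computational_Algebra.Computational_Algebra"
begin

definition hyp2F1_fps :: "complex \<Rightarrow> complex \<Rightarrow> complex \<Rightarrow> complex fps" where
  "hyp2F1_fps a b c = fps_hypergeo [a, b] [c] 1"

(* The sum of the Gauss series itself, not its analytic continuation; it is a meaningful value
   for norm z < 1, and also at z = 1 if the series terminates. *)
definition hyp2F1 :: "complex \<Rightarrow> complex \<Rightarrow> complex \<Rightarrow> complex \<Rightarrow> complex" where
  "hyp2F1 a b c z = eval_fps (hyp2F1_fps a b c) z"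

definition hyp2F1_partial :: "complex \<Rightarrow> complex \<Rightarrow> complex \<Rightarrow> nat \<Rightarrow> complex \<Rightarrow> complex" where
  "hyp2F1_partial a b c N z = (\<Sum>k<N. fps_nth (hyp2F1_fps a b c) k * z ^ k)"

(* Rodrigues' formula *)
definition legendre_poly :: "nat \<Rightarrow> real poly" where
  "legendre_poly n = smult (1 / (2 ^ n * fact n)) ((pderiv ^^ n) ([:-1, 0, 1:] ^ n))"

definition legendre_P :: "nat \<Rightarrow> real \<Rightarrow> real" where
  "legendre_P n t = poly (legendre_poly n) t"

definition fourier_legendre_coeff :: "(real \<Rightarrow> complex) \<Rightarrow> nat \<Rightarrow> complex" where
  "fourier_legendre_coeff f n =
     of_nat (2 * n + 1) * integral {0..1} (\<lambda>t. f t * of_real (legendre_P n (2 * t - 1)))"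

(* At a pole of a Gamma factor in the denominator the library value Gamma z = 0 together with
   division by zero yields 0, which is the value of the entire function 1 / Gamma there. *)
definition expansion_coeff_formula :: "complex \<Rightarrow> nat \<Rightarrow> complex" where
  "expansion_coeff_formula \<nu> m =
     - (sin (of_real pi * \<nu>) / 2) *
     ((1 / 4 ^ m * of_nat ((2 * m) choose m))\<^sup>2 *
      (Gamma (of_nat m - \<nu>) * Gamma (of_nat m + \<nu> + 1) * of_nat (4 * m + 1) /
       (Gamma (of_nat m - \<nu> + 1 / 2) * Gamma (of_nat m + \<nu> + 3 / 2))))"

(* The indeterminate coefficients are those with a Gamma pole in the numerator: \<nu> is then an
   integer, so that sin (pi * \<nu>) = 0. *)
definition expansion_coeff :: "complex \<Rightarrow> nat \<Rightarrow> complex" where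
  "expansion_coeff \<nu> m =
     (if of_nat m - \<nu> \<in> \<int>\<^sub>\<le>\<^sub>0 \<or> of_nat m + \<nu> + 1 \<in> \<int>\<^sub>\<le>\<^sub>0
      then Lim (at \<nu>) (\<lambda>\<mu>. expansion_coeff_formula \<mu> m)
      else expansion_coeff_formula \<nu> m)"

definition hyp2F1_product :: "complex \<Rightarrow> real \<Rightarrow> complex" where
  "hyp2F1_product \<nu> x =
     hyp2F1 (- \<nu>) (\<nu> + 1) 1 (of_real x) * hyp2F1 (- \<nu>) (\<nu> + 1) 1 (of_real (1 - x))"

end

theory Submission
  imports Defs
begin

text \<open>
Write \<open>F\<close> for the hypergeometric function, \<open>w(x) = F(x) F(1 - x)\<close>, \<open>t = 2 x - 1\<close> and
\<open>I\<^sub>n\<close> for the integral of \<open>w(x) P\<^sub>n(t)\<close> over the unit interval. Both factors of \<open>w\<close> solve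
Legendre's equation with eigenvalue \<open>\<nu> (\<nu> + 1)\<close>, so \<open>w\<close> solves its symmetric square, a
third-order equation; integrating that equation against \<open>P\<^sub>n\<close> gives a two-term recurrence between
\<open>I\<^sub>n\<close> and \<open>I\<^sub>n\<^sub>+\<^sub>2\<close>. The initial value \<open>I\<^sub>0 = cos (\<pi> \<nu>) / (2 \<nu> + 1)\<close> comes from integrating
the series of \<open>F(x)\<close> against \<open>F(1 - x)\<close>: the moments of \<open>F(1 - x)\<close> again satisfy a two-term
recurrence, and the resulting partial fraction series is a difference of Digamma values. This settles
all \<open>\<nu>\<close> with \<open>2 \<nu>\<close> not an integer, and continuity of \<open>I\<^sub>n\<close> in \<open>\<nu>\<close> the others.

For the pointwise statement, the coefficients are \<open>O(1 / m)\<close>, and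
\<open>P\<^sub>2\<^sub>m(t) = O(m\<^sup>-\<^sup>1\<^sup>/\<^sup>2 (1 - t\<^sup>2)\<^sup>-\<^sup>1\<^sup>/\<^sup>2)\<close>. The series therefore converges
absolutely and locally uniformly to a continuous function which has the same Legendre coefficients as
\<open>w\<close>, hence equals \<open>w\<close> by the Weierstrass approximation theorem.
\<close>

section \<open>Legendre polynomials\<close>

text \<open>For \<nu> not an integer the product has logarithmic singularities at both ends, so
  estimates on the closed interval cannot be uniform. One integrable weight,
  \<open>1 / sqrt (x * (1 - x))\<close>, replaces uniformity: it dominates the integrands, bounds
  the partial sums of the expansion and is still good enough for the uniqueness argument. It is
  wasteful by design. The hypergeometric coefficients are at most of order 1/k, but they are
  compared with \<open>cbin k\<close>, of order k^(-1/2), because the latter are the Taylor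
  coefficients of \<open>1 / sqrt (1 - x)\<close> and have a ratio that is easily compared. The
  estimate for P_(2m) brings in the same weight, and \<open>cbin\<close> again. All bounds for F
  depend on \<nu> only through an upper bound for the norm of \<nu> (\<nu> + 1), which turns the
  passage from generic to exceptional \<nu> into dominated convergence. At the end points both sides
  diverge like the harmonic series unless \<nu> is an integer, so the statement there is about
  partial sums.\<close>

lemma pderiv_funpow_smult:
  fixes p :: "'a::{comm_semiring_1,semiring_no_zero_divisors} poly"
  shows "(pderiv ^^ n) (smult c p) = smult c ((pderiv ^^ n) p)"
  by (induction n) (auto simp: pderiv_smult)

lemma pderiv_funpow_diff:
  fixes p q :: "real poly"
  shows "(pderiv ^^ n) (p - q) = (pderiv ^^ n) p - (pderiv ^^ n) q"
  by (induction n) (auto simp: pderiv_diff)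

text \<open>Leibniz's rule with a linear factor, where only two terms survive. Together with W' = 2
  X for W = X^2 - 1 it is all that Rodrigues' formula needs.\<close>

lemma pderiv_funpow_X_mult:
  fixes p :: "real poly"
  shows "(pderiv ^^ Suc n) ([:0, 1:] * p) =
           [:0, 1:] * (pderiv ^^ Suc n) p + smult (of_nat (Suc n)) ((pderiv ^^ n) p)"
proof (induction n)
  case 0
  show ?case by (simp add: pderiv_mult pderiv_pCons)
next
  case (Suc n)
  have "(pderiv ^^ Suc (Suc n)) ([:0, 1:] * p) = pderiv ((pderiv ^^ Suc n) ([:0, 1:] * p))"
    by simp
  also have "\<dots> = [:0, 1:] * (pderiv ^^ Suc (Suc n)) p + (pderiv ^^ Suc n) p
                  + smult (of_nat (Suc n)) ((pderiv ^^ Suc n) p)"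
    unfolding Suc.IH by (simp add: pderiv_add pderiv_mult pderiv_smult pderiv_pCons del: mult_pCons_left)
  also have "\<dots> = [:0, 1:] * (pderiv ^^ Suc (Suc n)) p
                  + smult (of_nat (Suc (Suc n))) ((pderiv ^^ Suc n) p)"
  proof -
    have "smult (of_nat (Suc (Suc n))) r = r + smult (of_nat (Suc n)) r" for r :: "real poly"
      using smult_add_left[of 1 "of_nat (Suc n)" r] by simp
    then show ?thesis by (simp only: add.assoc)
  qed
  finally show ?case .
qed

lemma pderiv_legendre_base:
  "pderiv ([:-1, 0, 1:] ^ Suc n) = smult (2 * real (Suc n)) ([:0, 1:] * [:-1, 0, 1:] ^ n)"
proof -
  have "pderiv [:-1, 0, 1:: real:] = smult 2 [:0, 1:]" by (simp add: pderiv_pCons)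
  then have "pderiv ([:-1, 0, 1:] ^ Suc n) = smult (real (Suc n)) ([:-1, 0, 1:] ^ n) * smult 2 [:0, 1:]"
    using pderiv_power_Suc[of "[:-1, 0, 1:: real:]" n] by simp
  then show ?thesis
    by (simp only: mult_smult_left mult_smult_right smult_smult mult.commute[of "[:-1, 0, 1:] ^ n"] mult.commute[of 2])
qed

lemma pderiv_legendre_poly_Suc:
  "pderiv (legendre_poly (Suc n)) =
     [:0, 1:] * pderiv (legendre_poly n) + smult (real (Suc n)) (legendre_poly n)"
proof -
  let ?W = "[:-1, 0, 1:] :: real poly"
  have "pderiv ((pderiv ^^ Suc n) (?W ^ Suc n)) = (pderiv ^^ Suc n) (pderiv (?W ^ Suc n))"
    by (metis funpow.simps(2) funpow_swap1 o_apply)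
  also have "\<dots> = smult (2 * real (Suc n)) ((pderiv ^^ Suc n) ([:0, 1:] * ?W ^ n))"
    unfolding pderiv_legendre_base pderiv_funpow_smult ..
  finally have *: "pderiv ((pderiv ^^ Suc n) (?W ^ Suc n)) = smult (2 * real (Suc n))
      ([:0, 1:] * (pderiv ^^ Suc n) (?W ^ n) + smult (of_nat (Suc n)) ((pderiv ^^ n) (?W ^ n)))"
    unfolding pderiv_funpow_X_mult .
  have c: "1 / (2 ^ Suc n * fact (Suc n)) * (2 * real (Suc n)) = 1 / (2 ^ n * fact n)"
    by (simp add: divide_simps)
  show ?thesis
    unfolding legendre_poly_def pderiv_smult * smult_smult c
    by (simp add: smult_add_right mult_ac del: mult_pCons_left mult_pCons_right)
qed

text \<open>The derivative \<open>R\<close> of W^(n+1) is computed twice: \<open>R1\<close> uses the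
  derivative of W^(n+1), \<open>R2\<close> splits W^(n+1) as X (X W^n) - W^n. Both contain the lower
  derivative \<open>E\<close>, and R = 2 R2 - R1 is free of it.\<close>

lemma legendre_poly_Suc:
  "smult (real (Suc n)) (legendre_poly (Suc n)) =
     [:-1, 0, 1:] * pderiv (legendre_poly n) + smult (real (Suc n)) ([:0, 1:] * legendre_poly n)"
proof -
  let ?W = "[:-1, 0, 1:] :: real poly" and ?X = "[:0, 1:] :: real poly"
  define A where "A = (pderiv ^^ Suc n) (?W ^ n)"
  define B where "B = (pderiv ^^ n) (?W ^ n)"
  \<comment> \<open>There is no derivative of order -1; the value chosen for n = 0 is harmless,
    since \<open>E\<close> enters only with the factor n.\<close>
  define E where "E = (if n = 0 then 0 else (pderiv ^^ (n - 1)) (?W ^ n))"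
  define R where "R = (pderiv ^^ Suc n) (?W ^ Suc n)"
  have XB: "(pderiv ^^ n) (?X * ?W ^ n) = ?X * B + smult (real n) E"
  proof (cases n)
    case (Suc k)
    then show ?thesis using pderiv_funpow_X_mult[of k "?W ^ n"] by (simp add: B_def E_def del: mult_pCons_left)
  qed (simp add: B_def E_def)
  have XA: "(pderiv ^^ Suc n) (?X * ?W ^ n) = ?X * A + smult (real (Suc n)) B"
    unfolding A_def B_def by (rule pderiv_funpow_X_mult)
  have "R = (pderiv ^^ n) (pderiv (?W ^ Suc n))"
    unfolding R_def by (simp only: funpow.simps funpow_swap1 o_apply)
  then have R1: "R = smult (2 * real (Suc n)) (?X * B + smult (real n) E)"
    unfolding pderiv_legendre_base pderiv_funpow_smult XB .
  have W: "?W ^ Suc n = ?X * (?X * ?W ^ n) - ?W ^ n"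
  proof -
    have "?W = ?X * ?X - 1" by (simp add: one_pCons)
    then show ?thesis by (simp only: power_Suc left_diff_distrib mult_1 mult.assoc)
  qed
  have R2: "R = ?X * (?X * A + smult (real (Suc n)) B)
              + smult (real (Suc n)) (?X * B + smult (real n) E) - A"
    unfolding R_def W pderiv_funpow_diff pderiv_funpow_X_mult[of n "?X * ?W ^ n"] XA XB A_def ..
  have R3: "R = smult 2 (?W * A + smult (real (Suc n)) (?X * B))"
  proof -
    have "poly R t = 2 * ((t\<^sup>2 - 1) * poly A t + real (Suc n) * (t * poly B t))" for t
      using arg_cong[OF R1, of "\<lambda>p. poly p t"] arg_cong[OF R2, of "\<lambda>p. poly p t"]
      by (simp add: algebra_simps power2_eq_square)
    then show ?thesis
      by (simp add: poly_eq_poly_eq_iff[symmetric] fun_eq_iff algebra_simps power2_eq_square)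
  qed
  have "smult (real (Suc n)) (legendre_poly (Suc n)) = smult (real (Suc n) / (2 ^ Suc n * fact (Suc n))) R"
    unfolding legendre_poly_def R_def by simp
  also have "\<dots> = smult (1 / (2 ^ n * fact n)) (?W * A + smult (real (Suc n)) (?X * B))"
  proof -
    have "real (Suc n) / (2 ^ Suc n * fact (Suc n)) * 2 = 1 / (2 ^ n * fact n)"
      by (simp add: divide_simps)
    then show ?thesis unfolding R3 smult_smult by (simp only:)
  qed
  also have "\<dots> = ?W * pderiv (legendre_poly n) + smult (real (Suc n)) (?X * legendre_poly n)"
    unfolding legendre_poly_def A_def B_def
    by (simp add: smult_add_right pderiv_smult mult_ac del: mult_pCons_left)
  finally show ?thesis .
qed

section \<open>Legendre polynomials as functions: recurrences and differential equation\<close>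

definition legendre_P' :: "nat \<Rightarrow> real \<Rightarrow> real" where
  "legendre_P' n t = poly (pderiv (legendre_poly n)) t"

lemma legendre_P_has_field_derivative [derivative_intros]:
  assumes "(g has_field_derivative g') (at t within S)"
  shows "((\<lambda>x. legendre_P n (g x)) has_field_derivative legendre_P' n (g t) * g') (at t within S)"
  unfolding legendre_P_def legendre_P'_def
  by (rule DERIV_chain2[OF poly_DERIV assms])

lemma continuous_on_legendre_P [continuous_intros]:
  "continuous_on S g \<Longrightarrow> continuous_on S (\<lambda>x. legendre_P n (g x))"
  "continuous_on S g \<Longrightarrow> continuous_on S (\<lambda>x. legendre_P' n (g x))"
  unfolding legendre_P_def legendre_P'_def by (intro continuous_intros; simp)+

lemma legendre_P_0 [simp]: "legendre_P 0 t = 1" "legendre_P' 0 t = 0"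
  by (simp_all add: legendre_P_def legendre_P'_def legendre_poly_def)

lemma legendre_P'_Suc:
  "legendre_P' (Suc n) t = t * legendre_P' n t + (real n + 1) * legendre_P n t"
  using arg_cong[OF pderiv_legendre_poly_Suc[of n], of "\<lambda>p. poly p t"]
  by (simp add: legendre_P_def legendre_P'_def algebra_simps)

lemma legendre_P_Suc:
  "(real n + 1) * legendre_P (Suc n) t =
     (t\<^sup>2 - 1) * legendre_P' n t + (real n + 1) * t * legendre_P n t"
  using arg_cong[OF legendre_poly_Suc[of n], of "\<lambda>p. poly p t"]
  by (simp add: legendre_P_def legendre_P'_def algebra_simps power2_eq_square)

lemma one_minus_sq_legendre_P':
  "(1 - t\<^sup>2) * legendre_P' (Suc n) t = (real n + 1) * (legendre_P n t - t * legendre_P (Suc n) t)"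
  using legendre_P_Suc[of n t] legendre_P'_Suc[of n t] by algebra

lemma legendre_P_recurrence:
  "(real n + 2) * legendre_P (Suc (Suc n)) t =
     (2 * real n + 3) * t * legendre_P (Suc n) t - (real n + 1) * legendre_P n t"
  using legendre_P_Suc[of "Suc n" t] one_minus_sq_legendre_P'[of t n] by (simp add: algebra_simps)

lemma legendre_P_1: "legendre_P (Suc 0) t = t"
  using legendre_P_Suc[of 0 t] by simp

text \<open>By \<open>legendre_P_Suc\<close>, (t^2 - 1) P_n' is a combination of P_(n+1) and t P_n,
  so it can be differentiated without any second derivative.\<close>

lemma legendre_ode:
  "((\<lambda>t. (1 - t\<^sup>2) * legendre_P' n t) has_field_derivative
      - (real n * (real n + 1)) * legendre_P n t) (at t within S)"
proof -
  have d: "((\<lambda>t. (t\<^sup>2 - 1) * legendre_P' n t) has_field_derivative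
       (real n + 1) * legendre_P' (Suc n) t
        - (real n + 1) * (legendre_P n t + t * legendre_P' n t)) (at t within S)"
  proof -
    have "(\<lambda>t. (t\<^sup>2 - 1) * legendre_P' n t) =
          (\<lambda>t. (real n + 1) * legendre_P (Suc n) t - (real n + 1) * (t * legendre_P n t))"
      using legendre_P_Suc[of n] by (auto simp: fun_eq_iff algebra_simps)
    then show ?thesis
      by (auto intro!: derivative_eq_intros)
  qed
  have "((\<lambda>t. - ((t\<^sup>2 - 1) * legendre_P' n t)) has_field_derivative
       - ((real n + 1) * legendre_P' (Suc n) t
        - (real n + 1) * (legendre_P n t + t * legendre_P' n t))) (at t within S)"
    by (rule DERIV_minus[OF d])
  then show ?thesis
    by (simp add: legendre_P'_Suc algebra_simps)
qed

lemma legendre_ode_unit: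
  "((\<lambda>x. (1 - (2 * x - 1)\<^sup>2) * legendre_P' n (2 * x - 1)) has_real_derivative
      - (real n * (real n + 1)) * legendre_P n (2 * x - 1) * 2) (at x within S)"
  by (rule DERIV_chain2[OF legendre_ode]) (auto intro!: derivative_eq_intros)

lemma induct_two_step [case_names 0 1 Step]:
  assumes "P 0" "P (Suc 0)" "\<And>n. P n \<Longrightarrow> P (Suc n) \<Longrightarrow> P (Suc (Suc n))"
  shows "P (n::nat)"
proof -
  have "P n \<and> P (Suc n)" by (induction n) (use assms in auto)
  then show ?thesis ..
qed

lemma legendre_P_minus: "legendre_P n (- t) = (-1) ^ n * legendre_P n t"
proof (induction n rule: induct_two_step)
  case (Step n)
  have "(real n + 2) * legendre_P (Suc (Suc n)) (- t) =
        (real n + 2) * ((-1) ^ Suc (Suc n) * legendre_P (Suc (Suc n)) t)"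
    unfolding legendre_P_recurrence[of n "- t"] mult.left_commute[of "real n + 2"]
      legendre_P_recurrence[of n t] Step
    by (simp add: algebra_simps)
  then show ?case by (simp add: add_nonneg_eq_0_iff)
qed (auto simp: legendre_P_1)

lemma legendre_P_at_1: "legendre_P n 1 = 1"
proof (induction n rule: induct_two_step)
  case (Step n)
  have "(real n + 2) * legendre_P (Suc (Suc n)) 1 = (real n + 2) * 1"
    using legendre_P_recurrence[of n 1] Step by (simp add: algebra_simps)
  then show ?case by (simp add: add_nonneg_eq_0_iff)
qed (auto simp: legendre_P_1)

text \<open>The normalised central binomial coefficient occurs in three roles: as the absolute value
  of P_(2k) at 0, as the Taylor coefficient of \<open>1 / sqrt (1 - x)\<close> that majorises the
  hypergeometric coefficients, and, squared, as a factor of the expansion coefficients.\<close>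

definition cbin :: "nat \<Rightarrow> real" where
  "cbin k = real ((2 * k) choose k) / 4 ^ k"

lemma cbin_0 [simp]: "cbin 0 = 1" by (simp add: cbin_def)

lemma cbin_pos: "cbin k > 0" by (simp add: cbin_def)

lemma cbin_Suc: "cbin (Suc k) = cbin k * (2 * real k + 1) / (2 * real k + 2)"
proof -
  have "Suc k * ((2 * Suc k) choose Suc k) = (2 * Suc k) * ((2 * k + 1) choose k)"
    using Suc_times_binomial_eq[of "2 * k + 1" k] by (simp add: mult_ac)
  then have 1: "real (Suc k) * real ((2 * Suc k) choose Suc k) = real (2 * Suc k) * real ((2 * k + 1) choose k)"
    by (metis of_nat_mult)
  have "Suc k * ((2 * k + 1) choose Suc k) = (2 * k + 1) * ((2 * k) choose k)"
    using Suc_times_binomial_eq[of "2 * k" k] by (simp add: mult_ac)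
  moreover have "(2 * k + 1) choose Suc k = (2 * k + 1) choose k"
    using binomial_symmetric[of k "2 * k + 1"] by simp
  ultimately have 2: "real (Suc k) * real ((2 * k + 1) choose k) = (2 * real k + 1) * real ((2 * k) choose k)"
    by (metis of_nat_mult of_nat_Suc Suc_eq_plus1 of_nat_numeral add.commute)
  have 3: "real ((2 * Suc k) choose Suc k) = 2 * real ((2 * k + 1) choose k)"
  proof -
    have "real (Suc k) * real ((2 * Suc k) choose Suc k) = real (Suc k) * (2 * real ((2 * k + 1) choose k))"
      unfolding 1 by (simp only: of_nat_mult of_nat_numeral mult_ac)
    then show ?thesis by (simp only: mult_cancel_left of_nat_eq_0_iff) simp
  qed
  have "real ((2 * k + 1) choose k) = (2 * real k + 1) * real ((2 * k) choose k) / real (Suc k)"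
    using 2 by (simp only: eq_divide_eq of_nat_eq_0_iff) (simp add: mult.commute)
  then show ?thesis unfolding cbin_def 3 by (simp add: divide_simps) (simp add: algebra_simps)
qed

lemma legendre_P_even_at_0: "legendre_P (2 * m) 0 = (-1) ^ m * cbin m"
proof (induction m)
  case (Suc m)
  have "(2 * real m + 2) * legendre_P (2 * Suc m) 0 = - (2 * real m + 1) * legendre_P (2 * m) 0"
    using legendre_P_recurrence[of "2 * m" 0] by (simp add: algebra_simps)
  also have "\<dots> = (2 * real m + 2) * ((-1) ^ Suc m * cbin (Suc m))"
    unfolding Suc.IH cbin_Suc by (simp add: divide_simps) (simp add: algebra_simps)
  finally show ?case unfolding mult_cancel_left by linarith
qed simp

lemma legendre_P'_even_at_0: "legendre_P' (2 * m) 0 = 0"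
proof (cases m)
  case (Suc k)
  have odd0: "legendre_P (Suc (2 * k)) 0 = 0"
    using legendre_P_minus[of "Suc (2 * k)" 0] by simp
  show ?thesis using legendre_P'_Suc[of "Suc (2 * k)" 0] odd0 Suc by simp
qed simp

text \<open>With \<open>p = 1 - t\<^sup>2\<close>, \<open>n = 2 m\<close> and \<open>y = P\<^sub>n\<close>, the energy \<open>(p y')\<^sup>2 + n (n + 1) p y\<^sup>2\<close>
  has derivative \<open>- 2 n (n + 1) t y\<^sup>2\<close> and hence is maximal at \<open>t = 0\<close>.\<close>

lemma legendre_P_even_bound_aux:
  assumes "0 \<le> t" "t < 1"
  shows "(1 - t\<^sup>2) * (legendre_P (2 * m) t)\<^sup>2 \<le> (cbin m)\<^sup>2"
proof (cases "m = 0")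
  case False
  define \<kappa> where "\<kappa> = real (2 * m) * (real (2 * m) + 1)"
  have \<kappa>: "\<kappa> > 0" using False by (simp add: \<kappa>_def)
  define E where "E = (\<lambda>t. ((1 - t\<^sup>2) * legendre_P' (2 * m) t)\<^sup>2 + \<kappa> * (1 - t\<^sup>2) * (legendre_P (2 * m) t)\<^sup>2)"
  have D: "(E has_field_derivative - 2 * t * \<kappa> * (legendre_P (2 * m) t)\<^sup>2) (at t)" for t
    unfolding E_def
    by (rule derivative_eq_intros legendre_ode refl)+ (simp add: \<kappa>_def algebra_simps power2_eq_square)
  have "E t \<le> E 0"
    by (rule DERIV_nonpos_imp_nonincreasing[OF assms(1)])
       (use D \<kappa> in \<open>auto intro!: exI mult_nonneg_nonneg simp: mult_le_0_iff\<close>)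
  also have "E 0 = \<kappa> * (cbin m)\<^sup>2"
    by (simp add: E_def legendre_P_even_at_0 legendre_P'_even_at_0 power_mult_distrib
          flip: power_mult power2_eq_square power_even_eq)
  finally have "\<kappa> * ((1 - t\<^sup>2) * (legendre_P (2 * m) t)\<^sup>2) \<le> \<kappa> * (cbin m)\<^sup>2"
    unfolding E_def by (smt (verit) zero_le_power2 mult.assoc)
  then show ?thesis using \<kappa> by simp
qed (use assms in \<open>simp add: power_le_one\<close>)

lemma legendre_P_even_bound:
  assumes "\<bar>t\<bar> < 1"
  shows "\<bar>legendre_P (2 * m) t\<bar> \<le> cbin m / sqrt (1 - t\<^sup>2)"
proof -
  have "legendre_P (2 * m) \<bar>t\<bar> = legendre_P (2 * m) t"
    using legendre_P_minus[of "2 * m" t] by (auto simp: abs_if)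
  then have "(1 - t\<^sup>2) * (legendre_P (2 * m) t)\<^sup>2 \<le> (cbin m)\<^sup>2"
    using legendre_P_even_bound_aux[of "\<bar>t\<bar>" m] assms by simp
  then have "sqrt ((1 - t\<^sup>2) * (legendre_P (2 * m) t)\<^sup>2) \<le> cbin m"
    using cbin_pos[of m] by (intro real_le_lsqrt) auto
  moreover have "0 < 1 - t\<^sup>2" using assms abs_square_less_1[of t] by simp
  ultimately show ?thesis by (simp add: real_sqrt_mult pos_le_divide_eq mult.commute)
qed

section \<open>The hypergeometric series\<close>

lemma cbin_diff: "cbin k - cbin (Suc k) = cbin k / (2 * (real k + 1))"
  unfolding cbin_Suc by (simp add: divide_simps) (simp add: algebra_simps)

lemma cbin_nonneg [simp]: "0 \<le> cbin k"
  using cbin_pos[of k] by simp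

lemma cbin_antimono: "decseq cbin"
proof (rule decseq_SucI)
  fix k
  have "0 \<le> cbin k / (2 * (real k + 1))" using cbin_pos[of k] by simp
  then show "cbin (Suc k) \<le> cbin k" using cbin_diff[of k] by linarith
qed

text \<open>The terms are twice the differences of a decreasing sequence bounded below, so no
  asymptotics of \<open>cbin\<close> are needed. This series is the majorant behind the absolute
  convergence of the expansion.\<close>

lemma summable_cbin_over_Suc: "summable (\<lambda>k. cbin k / (real k + 1))"
proof -
  obtain L where "cbin \<longlonglongrightarrow> L"
    using decseq_convergent[OF cbin_antimono, of 0] cbin_pos less_imp_le by metis
  then have "summable (\<lambda>k. 2 * (cbin k - cbin (Suc k)))"
    by (intro summable_mult sums_summable[OF telescope_sums'])
  moreover have "2 * (cbin k - cbin (Suc k)) = cbin k / (real k + 1)" for k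
    unfolding cbin_diff by (simp add: divide_simps)
  ultimately show ?thesis by simp
qed

lemma cbin_conv_gbinomial: "cbin k = (-1) ^ k * ((-1/2) gchoose k)"
proof (induction k)
  case (Suc k)
  have "((-1/2 :: real) gchoose Suc k) = ((-1/2) gchoose k) * (-1/2 - real k) / (real k + 1)"
    using gbinomial_mult_1[of "-1/2::real" k] by (simp add: field_simps)
  then have "(-1) ^ Suc k * ((-1/2 :: real) gchoose Suc k)
      = (-1) ^ k * ((-1/2) gchoose k) * ((1/2 + real k) / (real k + 1))"
    by (simp only: power_Suc) (simp add: divide_simps, simp add: algebra_simps)
  moreover have "(1/2 + real k) / (real k + 1) = (2 * real k + 1) / (2 * real k + 2)"
    by (simp add: divide_simps)
  ultimately show ?case unfolding cbin_Suc Suc by simp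
qed simp

lemma cbin_power_series:
  assumes "\<bar>x\<bar> < 1"
  shows "(\<lambda>k. cbin k * x ^ k) sums (1 / sqrt (1 - x))"
proof -
  have "(\<lambda>k. ((-1/2) gchoose k) * (- x) ^ k) sums (1 + - x) powr (-1/2)"
    by (rule gen_binomial_real) (use assms in simp)
  moreover have "(1 + - x) powr (-1/2) = 1 / sqrt (1 - x)"
    using assms by (simp add: powr_minus_divide powr_half_sqrt)
  moreover have "((-1/2) gchoose k) * (- x) ^ k = cbin k * x ^ k" for k
    unfolding cbin_conv_gbinomial by (subst power_minus) simp
  ultimately show ?thesis by simp
qed

definition hyp_coeff :: "complex \<Rightarrow> nat \<Rightarrow> complex" where
  "hyp_coeff \<nu> k = fps_nth (hyp2F1_fps (- \<nu>) (\<nu> + 1) 1) k"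

lemma hyp_coeff_pochhammer:
  "hyp_coeff \<nu> k = pochhammer (- \<nu>) k * pochhammer (\<nu> + 1) k / (fact k)\<^sup>2"
  by (simp add: hyp_coeff_def hyp2F1_fps_def power2_eq_square flip: pochhammer_fact)

lemma hyp_coeff_0 [simp]: "hyp_coeff \<nu> 0 = 1"
  by (simp add: hyp_coeff_pochhammer)

lemma hyp_coeff_Suc:
  "(of_nat k + 1)\<^sup>2 * hyp_coeff \<nu> (Suc k) = (of_nat k - \<nu>) * (of_nat k + \<nu> + 1) * hyp_coeff \<nu> k"
proof -
  have "(of_nat k + 1 :: complex) \<noteq> 0" by (metis of_nat_Suc of_nat_neq_0 add.commute)
  then show ?thesis
    by (simp add: hyp_coeff_pochhammer pochhammer_Suc power_mult_distrib divide_simps)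
       (simp add: algebra_simps)
qed

text \<open>Legendre's equation, integrated once, on the level of coefficients. It yields the
  differential equation of the series and also makes the integral of F a telescoping sum in
  \<open>legM_0\<close>.\<close>

lemma hyp_coeff_telescope:
  "of_nat (Suc k) * hyp_coeff \<nu> (Suc k) - of_nat k * hyp_coeff \<nu> k
     = - (\<nu> * (\<nu> + 1)) * hyp_coeff \<nu> k / (of_nat k + 1)"
proof -
  have nz: "(of_nat k + 1 :: complex) \<noteq> 0" by (metis of_nat_Suc of_nat_neq_0 add.commute)
  have "(of_nat k + 1) * (of_nat (Suc k) * hyp_coeff \<nu> (Suc k) - of_nat k * hyp_coeff \<nu> k)
       = - (\<nu> * (\<nu> + 1)) * hyp_coeff \<nu> k"
    using hyp_coeff_Suc[of k \<nu>] by (simp add: algebra_simps power2_eq_square)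
  then show ?thesis using nz by (simp add: field_simps)
qed

text \<open>Since (k - \<nu>) (k + \<nu> + 1) = k (k + 1) - \<nu> (\<nu> + 1), the parameter enters
  only through \<open>\<Lambda>\<close>; this is the source of all uniformity in \<nu>.\<close>

lemma norm_hyp_coeff_Suc:
  assumes "norm (\<nu> * (\<nu> + 1)) \<le> \<Lambda>"
  shows "norm (hyp_coeff \<nu> (Suc k))
           \<le> (real k * (real k + 1) + \<Lambda>) / (real k + 1)\<^sup>2 * norm (hyp_coeff \<nu> k)"
proof -
  have 1: "(of_nat k - \<nu>) * (of_nat k + \<nu> + 1) = of_real (real k * (real k + 1)) - \<nu> * (\<nu> + 1)"
    by (simp add: algebra_simps)
  have "norm ((of_nat k - \<nu>) * (of_nat k + \<nu> + 1)) \<le> real k * (real k + 1) + \<Lambda>"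
    unfolding 1 using assms norm_triangle_ineq4[of "of_real (real k * (real k + 1))" "\<nu> * (\<nu> + 1)"]
    by (simp only: norm_of_real) (simp add: abs_mult)
  then have "norm ((of_nat k - \<nu>) * (of_nat k + \<nu> + 1) * hyp_coeff \<nu> k)
      \<le> (real k * (real k + 1) + \<Lambda>) * norm (hyp_coeff \<nu> k)"
    unfolding norm_mult[of _ "hyp_coeff \<nu> k"] by (intro mult_right_mono) auto
  moreover have "norm ((of_nat k + 1 :: complex)\<^sup>2) = (real k + 1)\<^sup>2"
    by (metis norm_of_nat norm_power of_nat_1 of_nat_add)
  ultimately have "(real k + 1)\<^sup>2 * norm (hyp_coeff \<nu> (Suc k))
      \<le> (real k * (real k + 1) + \<Lambda>) * norm (hyp_coeff \<nu> k)"
    using arg_cong[OF hyp_coeff_Suc[of k \<nu>], of norm] by (simp add: norm_mult)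
  then show ?thesis by (simp add: pos_le_divide_eq mult.commute add_nonneg_eq_0_iff)
qed

text \<open>Once k is at least 2 \<Lambda>, the growth factor of \<open>norm_hyp_coeff_Suc\<close>
  is at most (2 k + 1) / (2 k + 2), the ratio of consecutive values of \<open>cbin\<close>. Up to
  the index \<open>K\<close> the crude bound (1 + \<Lambda>)^k is enough, and \<open>C\<close> is
  chosen so that the two regimes meet at \<open>K\<close>.\<close>

lemma hyp_coeff_bound:
  obtains C where "C > 0"
    "\<And>\<nu> k. norm (\<nu> * (\<nu> + 1)) \<le> \<Lambda> \<Longrightarrow> norm (hyp_coeff \<nu> k) \<le> C * cbin k"
proof (cases "\<Lambda> \<ge> 0")
  case True
  obtain K :: nat where K: "2 * \<Lambda> \<le> real K" using real_arch_simple by blast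
  define C where "C = (1 + \<Lambda>) ^ K / cbin K"
  have "norm (hyp_coeff \<nu> k) \<le> C * cbin k" if \<nu>: "norm (\<nu> * (\<nu> + 1)) \<le> \<Lambda>" for \<nu> k
  proof -
    have small: "norm (hyp_coeff \<nu> k) \<le> (1 + \<Lambda>) ^ k" for k
    proof (induction k)
      case (Suc k)
      have "\<Lambda> * 1 \<le> \<Lambda> * (real k + 1)\<^sup>2"
        using True by (intro mult_left_mono) (auto simp: power2_eq_square algebra_simps)
      then have "real k * (real k + 1) + \<Lambda> \<le> (1 + \<Lambda>) * (real k + 1)\<^sup>2"
        by (simp add: algebra_simps power2_eq_square)
      then have "(real k * (real k + 1) + \<Lambda>) / (real k + 1)\<^sup>2 \<le> 1 + \<Lambda>"
        by (simp add: pos_divide_le_eq)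
      then have "(real k * (real k + 1) + \<Lambda>) / (real k + 1)\<^sup>2 * norm (hyp_coeff \<nu> k) \<le> (1 + \<Lambda>) * (1 + \<Lambda>) ^ k"
        using Suc True by (intro mult_mono) auto
      then show ?case using norm_hyp_coeff_Suc[OF \<nu>, of k] by simp
    qed simp
    show ?thesis
    proof (induction k)
      case 0
      have "norm (hyp_coeff \<nu> 0) \<le> (1 + \<Lambda>) ^ K" using True by simp
      also have "\<dots> = C * cbin K" using cbin_pos[of K] by (simp add: C_def)
      also have "\<dots> \<le> C * cbin 0"
        using cbin_antimono cbin_pos[of K] True by (intro mult_left_mono) (auto simp: C_def decseq_def simp del: cbin_0)
      finally show ?case .
    next
      case (Suc k)
      show ?case
      proof (cases "Suc k \<le> K")
        case True': True
        have "norm (hyp_coeff \<nu> (Suc k)) \<le> (1 + \<Lambda>) ^ Suc k" by (rule small)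
        also have "\<dots> \<le> (1 + \<Lambda>) ^ K" using True True' by (intro power_increasing) auto
        also have "\<dots> = C * cbin K" using cbin_pos[of K] by (simp add: C_def)
        also have "\<dots> \<le> C * cbin (Suc k)"
          using cbin_antimono cbin_pos[of K] True True' by (intro mult_left_mono) (auto simp: C_def decseq_def)
        finally show ?thesis .
      next
        case False
        then have "2 * \<Lambda> \<le> real k" using K by linarith
        then have "(real k * (real k + 1) + \<Lambda>) \<le> (2 * real k + 1) * (real k + 1) / 2"
          by (simp add: algebra_simps)
        then have "(real k * (real k + 1) + \<Lambda>) / (real k + 1)\<^sup>2 \<le> (2 * real k + 1) / (2 * real k + 2)"
          by (rule order.trans[OF divide_right_mono])
             (simp, simp add: divide_simps power2_eq_square)
        then have "(real k * (real k + 1) + \<Lambda>) / (real k + 1)\<^sup>2 * norm (hyp_coeff \<nu> k)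
              \<le> (2 * real k + 1) / (2 * real k + 2) * (C * cbin k)"
          using Suc by (intro mult_mono) auto
        also have "\<dots> = C * cbin (Suc k)" by (simp add: cbin_Suc)
        finally show ?thesis using norm_hyp_coeff_Suc[OF \<nu>, of k] by simp
      qed
    qed
  qed
  moreover have "C > 0" using True cbin_pos by (simp add: C_def)
  ultimately show ?thesis using that by blast
next
  case False
  then show ?thesis using that[of 1] by (smt (verit) norm_ge_zero)
qed

section \<open>The function F on the unit interval, its primitive and their bounds\<close>

definition legF :: "complex \<Rightarrow> real \<Rightarrow> complex" where
  "legF \<nu> x = hyp2F1 (- \<nu>) (\<nu> + 1) 1 (of_real x)"

text \<open>The primitive of \<open>legF\<close> is needed because Legendre's equation turns it into
  \<open>- x (1 - x) F'(x) / (\<nu> (\<nu> + 1))\<close>, so no second derivative of the series is ever needed.\<close>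

definition legH :: "complex \<Rightarrow> real \<Rightarrow> complex" where
  "legH \<nu> x = eval_fps (fps_integral0 (hyp2F1_fps (- \<nu>) (\<nu> + 1) 1)) (of_real x)"

lemma hyp2F1_product_legF: "hyp2F1_product \<nu> x = legF \<nu> x * legF \<nu> (1 - x)"
  by (simp add: hyp2F1_product_def legF_def)

lemma legF_eq_suminf: "legF \<nu> x = (\<Sum>k. hyp_coeff \<nu> k * of_real x ^ k)"
  by (simp add: legF_def hyp2F1_def eval_fps_def hyp_coeff_def)

lemma fps_conv_radius_hyp: "fps_conv_radius (hyp2F1_fps (- \<nu>) (\<nu> + 1) 1) \<ge> 1"
  and fps_conv_radius_hyp_integral: "fps_conv_radius (fps_integral0 (hyp2F1_fps (- \<nu>) (\<nu> + 1) 1)) \<ge> 1"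
proof -
  obtain C where C: "C > 0" "\<And>k. norm (hyp_coeff \<nu> k) \<le> C * cbin k"
    by (rule hyp_coeff_bound[of "norm (\<nu> * (\<nu> + 1))"]) (rule that; blast intro: order.refl)
  have s: "summable (\<lambda>k. C * (cbin k * r ^ k))" if "0 < r" "r < 1" for r
    using cbin_power_series[of r] that by (intro summable_mult sums_summable) auto
  show "fps_conv_radius (hyp2F1_fps (- \<nu>) (\<nu> + 1) 1) \<ge> 1"
    unfolding fps_conv_radius_def hyp_coeff_def[symmetric]
  proof (rule conv_radius_geI_ex')
    fix r :: real assume r: "0 < r" "ereal r < 1"
    then have r1: "r < 1" by (simp flip: ereal_less(3) one_ereal_def)
    show "summable (\<lambda>n. hyp_coeff \<nu> n * of_real r ^ n)"
    proof (rule summable_comparison_test'[OF s[OF r(1) r1]])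
      show "norm (hyp_coeff \<nu> n * complex_of_real r ^ n) \<le> C * (cbin n * r ^ n)" for n
        using C(2)[of n] r(1) by (simp add: norm_mult norm_power mult.assoc[symmetric] mult_right_mono)
    qed
  qed
  show "fps_conv_radius (fps_integral0 (hyp2F1_fps (- \<nu>) (\<nu> + 1) 1)) \<ge> 1"
    unfolding fps_conv_radius_def
  proof (rule conv_radius_geI_ex')
    fix r :: real assume r: "0 < r" "ereal r < 1"
    then have r1: "r < 1" by (simp flip: ereal_less(3) one_ereal_def)
    have "summable (\<lambda>n. fps_integral0 (hyp2F1_fps (- \<nu>) (\<nu> + 1) 1) $ Suc n * of_real r ^ Suc n)"
    proof (rule summable_comparison_test'[OF s[OF r(1) r1]])
      show "norm (fps_integral0 (hyp2F1_fps (- \<nu>) (\<nu> + 1) 1) $ Suc n * complex_of_real r ^ Suc n) \<le> C * (cbin n * r ^ n)" for n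
      proof -
        have "norm (hyp_coeff \<nu> n) / (real n + 1) \<le> C * cbin n"
          using C(2)[of n] by (smt (verit) divide_le_eq_1 frac_le norm_ge_zero of_nat_0_le_iff div_by_1)
        moreover have "r ^ Suc n \<le> r ^ n" using r r1 by (simp add: mult_left_le_one_le)
        ultimately have "norm (hyp_coeff \<nu> n) / (real n + 1) * r ^ Suc n \<le> C * cbin n * r ^ n"
          using r(1) C(1) cbin_pos[of n] by (intro mult_mono) auto
        moreover have "norm (fps_integral0 (hyp2F1_fps (- \<nu>) (\<nu> + 1) 1) $ Suc n * complex_of_real r ^ Suc n)
           = norm (hyp_coeff \<nu> n) / (real n + 1) * r ^ Suc n"
          using r(1) by (simp add: norm_mult norm_power hyp_coeff_def[symmetric] norm_divide
               norm_inverse divide_inverse norm_of_nat[of "Suc n", simplified] del: power_Suc)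
        ultimately show ?thesis by (simp add: mult.assoc)
      qed
    qed
    then show "summable (\<lambda>n. fps_integral0 (hyp2F1_fps (- \<nu>) (\<nu> + 1) 1) $ n * of_real r ^ n)"
      by (subst (asm) summable_Suc_iff)
  qed
qed

lemma of_real_in_hyp_disc:
  assumes "\<bar>x\<bar> < 1"
  shows "ereal (norm (complex_of_real x)) < fps_conv_radius (hyp2F1_fps (- \<nu>) (\<nu> + 1) 1)"
    "ereal (norm (complex_of_real x)) < fps_conv_radius (fps_integral0 (hyp2F1_fps (- \<nu>) (\<nu> + 1) 1))"
proof -
  have "ereal (norm (complex_of_real x)) < 1" using assms by simp
  then show "ereal (norm (complex_of_real x)) < fps_conv_radius (hyp2F1_fps (- \<nu>) (\<nu> + 1) 1)"
    "ereal (norm (complex_of_real x)) < fps_conv_radius (fps_integral0 (hyp2F1_fps (- \<nu>) (\<nu> + 1) 1))"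
    using fps_conv_radius_hyp[of \<nu>] fps_conv_radius_hyp_integral[of \<nu>] by (meson less_le_trans)+
qed

lemma legF_sums:
  assumes "\<bar>x\<bar> < 1"
  shows "(\<lambda>k. hyp_coeff \<nu> k * of_real x ^ k) sums legF \<nu> x"
  using sums_eval_fps[OF of_real_in_hyp_disc(1)[OF assms]]
  by (simp add: legF_def hyp2F1_def hyp_coeff_def)

lemma legH_has_vector_derivative:
  assumes "\<bar>x\<bar> < 1"
  shows "(legH \<nu> has_vector_derivative legF \<nu> x) (at x)"
  unfolding legH_def[abs_def] legF_def hyp2F1_def
  by (rule has_vector_derivative_real_field)
     (use has_field_derivative_eval_fps[OF of_real_in_hyp_disc(2)[OF assms]] in \<open>simp add: fps_deriv_fps_integral\<close>)

text \<open>The once integrated Legendre equation as an identity of formal power series; its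
  coefficients are \<open>hyp_coeff_telescope\<close>, and evaluating it gives
  \<open>legF_has_vector_derivative\<close>.\<close>

lemma hyp2F1_fps_ode:
  "fps_X * (1 - fps_X) * fps_deriv (hyp2F1_fps (- \<nu>) (\<nu> + 1) 1)
     = fps_const (- (\<nu> * (\<nu> + 1))) * fps_integral0 (hyp2F1_fps (- \<nu>) (\<nu> + 1) 1)"
  (is "?L = ?R")
proof (rule fps_ext)
  fix n
  show "?L $ n = ?R $ n"
  proof (cases n)
    case (Suc k)
    have "?L $ n = of_nat (Suc k) * hyp_coeff \<nu> (Suc k) - of_nat k * hyp_coeff \<nu> k"
      using Suc by (cases k) (auto simp: mult.assoc left_diff_distrib hyp_coeff_def)
    also have "\<dots> = ?R $ n"
      unfolding hyp_coeff_telescope using Suc by (simp add: hyp_coeff_def divide_inverse add.commute)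
    finally show ?thesis .
  qed (simp add: mult.assoc)
qed

lemma legF_has_vector_derivative:
  assumes "0 < x" "x < 1"
  shows "(legF \<nu> has_vector_derivative
           - (\<nu> * (\<nu> + 1)) * legH \<nu> x / (of_real x * (1 - of_real x))) (at x)"
proof -
  let ?f = "hyp2F1_fps (- \<nu>) (\<nu> + 1) 1" and ?z = "complex_of_real x"
  have x: "\<bar>x\<bar> < 1" using assms by simp
  note r = of_real_in_hyp_disc[OF x, of \<nu>]
  have rd: "ereal (norm ?z) < fps_conv_radius (fps_deriv ?f)"
    using r(1) fps_conv_radius_deriv[of ?f] by (meson less_le_trans)
  have "eval_fps (fps_X * (1 - fps_X) * fps_deriv ?f) ?z
      = ?z * (1 - ?z) * eval_fps (fps_deriv ?f) ?z"
    using rd by (simp add: eval_fps_mult eval_fps_diff less_le_trans[OF _ fps_conv_radius_mult]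
       less_le_trans[OF _ fps_conv_radius_diff] )
  also have "eval_fps (fps_X * (1 - fps_X) * fps_deriv ?f) ?z = - (\<nu> * (\<nu> + 1)) * legH \<nu> x"
    unfolding hyp2F1_fps_ode legH_def using r by (simp add: eval_fps_mult)
  finally have "eval_fps (fps_deriv ?f) ?z = - (\<nu> * (\<nu> + 1)) * legH \<nu> x / (?z * (1 - ?z))"
    using assms by (simp add: field_simps)
  then show ?thesis
    unfolding legF_def[abs_def] hyp2F1_def
    using has_field_derivative_eval_fps[OF r(1), of UNIV]
    by (intro has_vector_derivative_real_field) simp
qed

text \<open>The partial sums are bounded along with their limit because dominated convergence is
  applied to them. The bound for \<open>legH\<close> keeps a factor x: this zero at 0 later cancels
  the singularity of the reflected factor.\<close>

lemma legFH_bounds: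
  obtains C where "C > 0"
    "\<forall>\<nu> k. norm (\<nu> * (\<nu> + 1)) \<le> \<Lambda> \<longrightarrow> norm (hyp_coeff \<nu> k) \<le> C * cbin k"
    "\<forall>\<nu> N x. norm (\<nu> * (\<nu> + 1)) \<le> \<Lambda> \<longrightarrow> 0 \<le> x \<longrightarrow> x < 1 \<longrightarrow>
        norm (\<Sum>k<N. hyp_coeff \<nu> k * of_real x ^ k) \<le> C / sqrt (1 - x)"
    "\<forall>\<nu> x. norm (\<nu> * (\<nu> + 1)) \<le> \<Lambda> \<longrightarrow> 0 \<le> x \<longrightarrow> x < 1 \<longrightarrow> norm (legF \<nu> x) \<le> C / sqrt (1 - x)"
    "\<forall>\<nu> x. norm (\<nu> * (\<nu> + 1)) \<le> \<Lambda> \<longrightarrow> 0 \<le> x \<longrightarrow> x < 1 \<longrightarrow> norm (legH \<nu> x) \<le> C * x"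
proof -
  obtain C where C: "C > 0" "\<And>\<nu> k. norm (\<nu> * (\<nu> + 1)) \<le> \<Lambda> \<Longrightarrow> norm (hyp_coeff \<nu> k) \<le> C * cbin k"
    using hyp_coeff_bound by blast
  \<comment> \<open>\<open>S\<close> controls the series of the primitive after one factor x is
    split off. As \<open>S\<close> is at least 1, \<open>C * S\<close> can serve as the common
    constant.\<close>
  define S where "S = (\<Sum>k. cbin k / (real k + 1))"
  have "(\<Sum>k<1. cbin k / (real k + 1)) \<le> S"
    unfolding S_def by (rule sum_le_suminf[OF summable_cbin_over_Suc]) simp_all
  then have S: "S \<ge> 1" by simp
  have part: "norm (\<Sum>k<N. hyp_coeff \<nu> k * of_real x ^ k) \<le> C / sqrt (1 - x)"
    if "norm (\<nu> * (\<nu> + 1)) \<le> \<Lambda>" "0 \<le> x" "x < 1" for \<nu> N x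
  proof -
    have "norm (\<Sum>k<N. hyp_coeff \<nu> k * of_real x ^ k) \<le> (\<Sum>k<N. C * (cbin k * x ^ k))"
      using C that by (intro order.trans[OF norm_sum] sum_mono)
        (auto simp: norm_mult norm_power mult.assoc[symmetric] intro!: mult_right_mono)
    also have "\<dots> = C * (\<Sum>k<N. cbin k * x ^ k)" by (simp add: sum_distrib_left)
    also have "(\<Sum>k<N. cbin k * x ^ k) \<le> 1 / sqrt (1 - x)"
    proof -
      have ps: "(\<lambda>k. cbin k * x ^ k) sums (1 / sqrt (1 - x))"
        using that by (intro cbin_power_series) simp
      show ?thesis
        unfolding sums_unique[OF ps] using that by (intro sum_le_suminf[OF sums_summable[OF ps]]) auto
    qed
    finally show ?thesis using C by simp
  qed
  have F: "norm (legF \<nu> x) \<le> C / sqrt (1 - x)"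
    if "norm (\<nu> * (\<nu> + 1)) \<le> \<Lambda>" "0 \<le> x" "x < 1" for \<nu> x
    using legF_sums[of x \<nu>] part[OF that] that unfolding sums_def
    by (intro tendsto_le[OF sequentially_bot tendsto_const tendsto_norm]) auto
  have Hb: "norm (legH \<nu> x) \<le> C * S * x"
    if "norm (\<nu> * (\<nu> + 1)) \<le> \<Lambda>" "0 \<le> x" "x < 1" for \<nu> x
  proof -
    let ?h = "fps_integral0 (hyp2F1_fps (- \<nu>) (\<nu> + 1) 1)"
    have "(\<lambda>n. ?h $ n * of_real x ^ n) sums legH \<nu> x"
      unfolding legH_def by (rule sums_eval_fps) (use that in \<open>intro of_real_in_hyp_disc, simp\<close>)
    then have sh: "(\<lambda>n. ?h $ Suc n * of_real x ^ Suc n) sums legH \<nu> x"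
      by (subst sums_Suc_iff) simp
    have "norm (\<Sum>n<N. ?h $ Suc n * of_real x ^ Suc n) \<le> C * S * x" for N
    proof -
      have "norm (\<Sum>n<N. ?h $ Suc n * of_real x ^ Suc n) \<le> (\<Sum>n<N. C * x * (cbin n / (real n + 1)))"
      proof (intro order.trans[OF norm_sum] sum_mono)
        fix n
        have "norm (?h $ Suc n * of_real x ^ Suc n) = norm (hyp_coeff \<nu> n) / (real n + 1) * x ^ Suc n"
          using that by (simp add: norm_mult norm_power hyp_coeff_def[symmetric] norm_divide
               norm_inverse divide_inverse norm_of_nat[of "Suc n", simplified] del: power_Suc)
        also have "\<dots> \<le> C * cbin n / (real n + 1) * x"
          using C that cbin_pos[of n]
          by (intro mult_mono divide_right_mono) (auto simp: power_le_one mult_left_le)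
        finally show "norm (?h $ Suc n * of_real x ^ Suc n) \<le> C * x * (cbin n / (real n + 1))" by (simp add: mult_ac)
      qed
      also have "\<dots> = C * x * (\<Sum>n<N. cbin n / (real n + 1))" by (simp add: sum_distrib_left)
      also have "\<dots> \<le> C * x * S" unfolding S_def
        using C that
        by (intro mult_left_mono sum_le_suminf[OF summable_cbin_over_Suc]) auto
      finally show ?thesis by (simp add: mult_ac)
    qed
    then show ?thesis
      by (intro tendsto_le[OF sequentially_bot tendsto_const tendsto_norm[OF sh[unfolded sums_def]]]) auto
  qed
  have CS: "C \<le> C * S" using C S by simp
  show ?thesis
  proof (rule that[of "C * S"]; (intro allI impI)?)
    show "C * S > 0" using C S by simp
    show "norm (hyp_coeff \<nu> k) \<le> C * S * cbin k" if "norm (\<nu> * (\<nu> + 1)) \<le> \<Lambda>" for \<nu> k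
      using C(2)[OF that, of k] CS cbin_pos[of k] by (smt (verit) mult_right_mono)
    show "norm (\<Sum>k<N. hyp_coeff \<nu> k * of_real x ^ k) \<le> C * S / sqrt (1 - x)"
      if "norm (\<nu> * (\<nu> + 1)) \<le> \<Lambda>" "0 \<le> x" "x < 1" for \<nu> N x
      using part[OF that, of N] divide_right_mono[OF CS, of "sqrt (1 - x)"] that by simp
    show "norm (legF \<nu> x) \<le> C * S / sqrt (1 - x)"
      if "norm (\<nu> * (\<nu> + 1)) \<le> \<Lambda>" "0 \<le> x" "x < 1" for \<nu> x
      using F[OF that] divide_right_mono[OF CS, of "sqrt (1 - x)"] that by simp
    show "norm (legH \<nu> x) \<le> C * S * x"
      if "norm (\<nu> * (\<nu> + 1)) \<le> \<Lambda>" "0 \<le> x" "x < 1" for \<nu> x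
      by (rule Hb[OF that])
  qed
qed

lemma legFH_bounds_at:
  obtains C where "C > 0"
    "\<forall>N x. 0 \<le> x \<longrightarrow> x < 1 \<longrightarrow> norm (\<Sum>k<N. hyp_coeff \<nu> k * of_real x ^ k) \<le> C / sqrt (1 - x)"
    "\<forall>x. 0 \<le> x \<longrightarrow> x < 1 \<longrightarrow> norm (legF \<nu> x) \<le> C / sqrt (1 - x)"
    "\<forall>x. 0 \<le> x \<longrightarrow> x < 1 \<longrightarrow> norm (legH \<nu> x) \<le> C * x"
proof (rule legFH_bounds[of "norm (\<nu> * (\<nu> + 1))"], rule that; (assumption | intro allI impI)?)
qed (drule spec[of _ \<nu>], simp)+

section \<open>Integrals of the product\<close>

text \<open>The primitive is arcsin (2 x - 1), continuous up to both ends. Multiples of this weight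
  are the dominating functions of all later integrals and limits.\<close>

lemma integrable_arcsine_weight: "(\<lambda>x::real. 1 / sqrt (x * (1 - x))) integrable_on {0<..<1}"
proof -
  have "((\<lambda>x::real. 1 / sqrt (x * (1 - x))) has_integral (arcsin (2 * 1 - 1) - arcsin (2 * 0 - 1))) {0..1}"
  proof (rule fundamental_theorem_of_calculus_interior)
    show "continuous_on {0..1} (\<lambda>x::real. arcsin (2 * x - 1))"
      by (intro continuous_intros) auto
    fix x :: real assume x: "x \<in> {0<..<1}"
    have "((\<lambda>x::real. arcsin (2 * x - 1)) has_real_derivative inverse (sqrt (1 - (2 * x - 1)\<^sup>2)) * 2) (at x)"
      by (rule DERIV_chain2[OF DERIV_arcsin]) (use x in \<open>auto intro!: derivative_eq_intros\<close>)
    moreover have "sqrt (1 - (2 * x - 1)\<^sup>2) = 2 * sqrt (x * (1 - x))"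
    proof -
      have "1 - (2 * x - 1)\<^sup>2 = 2\<^sup>2 * (x * (1 - x))" by (simp add: power2_eq_square algebra_simps)
      then show ?thesis by (simp only: real_sqrt_mult real_sqrt_abs abs_numeral)
    qed
    ultimately show "((\<lambda>x::real. arcsin (2 * x - 1)) has_vector_derivative 1 / sqrt (x * (1 - x))) (at x)"
      by (simp add: has_real_derivative_iff_has_vector_derivative divide_simps)
  qed simp
  then show ?thesis using has_integral_Icc_iff_Ioo by blast
qed

lemma weight_dominated_integrable:
  fixes f :: "real \<Rightarrow> complex"
  assumes "continuous_on {0<..<1} f"
    and "\<And>x. 0 < x \<Longrightarrow> x < 1 \<Longrightarrow> norm (f x) \<le> K / sqrt (x * (1 - x))"
  shows "f absolutely_integrable_on {0<..<1}" "f integrable_on {0<..<1}"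
proof -
  have g: "(\<lambda>x. K * (1 / sqrt (x * (1 - x)))) integrable_on {0<..<1}"
    by (intro integrable_on_mult_right integrable_arcsine_weight)
  have b: "norm (f x) \<le> K * (1 / sqrt (x * (1 - x)))" if "x \<in> {0<..<1}" for x
    using assms(2)[of x] that by simp
  show "f integrable_on {0<..<1}"
    by (rule measurable_bounded_by_integrable_imp_integrable[OF _ g b])
       (auto intro!: continuous_imp_measurable_on_sets_lebesgue assms(1))
  then show "f absolutely_integrable_on {0<..<1}"
    by (intro absolutely_integrable_integrable_bound[OF b _ g])
qed

lemma weight_dominated_convergence:
  fixes f :: "nat \<Rightarrow> real \<Rightarrow> complex"
  assumes "\<And>k. continuous_on {0<..<1} (f k)"
    and "\<And>k x. 0 < x \<Longrightarrow> x < 1 \<Longrightarrow> norm (f k x) \<le> K / sqrt (x * (1 - x))"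
    and "\<And>x. 0 < x \<Longrightarrow> x < 1 \<Longrightarrow> (\<lambda>k. f k x) \<longlonglongrightarrow> g x"
  shows "(\<lambda>k. integral {0<..<1} (f k)) \<longlonglongrightarrow> integral {0<..<1} g"
proof (rule dominated_convergence(2))
  show "f k integrable_on {0<..<1}" for k
    by (rule weight_dominated_integrable(2)[of _ K]) (use assms in auto)
  show "(\<lambda>x. K * (1 / sqrt (x * (1 - x)))) integrable_on {0<..<1}"
    by (intro integrable_on_mult_right integrable_arcsine_weight)
qed (use assms in auto)

text \<open>Serves both for the primitives of \<open>has_integral_0_of_vanishing_primitive\<close>
  and for the test function in \<open>vanishes_if_moments_vanish\<close>.\<close>

lemma continuous_on_extend_by_zero:
  fixes B :: "real \<Rightarrow> 'a::real_normed_vector"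
  assumes B: "continuous_on {0<..<1} B"
    and K: "\<And>x. 0 < x \<Longrightarrow> x < 1 \<Longrightarrow> norm (B x) \<le> K * sqrt (x * (1 - x))"
  shows "continuous_on {0..1} (\<lambda>x. if x \<in> {0<..<1} then B x else 0)"
proof -
  define A where "A = (\<lambda>x. if x \<in> {0<..<1} then B x else 0)"
  have inner: "isCont A x" if "x \<in> {0<..<1}" for x
  proof -
    have "\<forall>\<^sub>F y in nhds x. A y = B y"
      using eventually_nhds_in_open[OF open_greaterThanLessThan that]
      by eventually_elim (simp add: A_def)
    moreover have "isCont B x"
      using B that by (simp add: continuous_on_eq_continuous_at)
    ultimately show ?thesis by (simp add: isCont_cong)
  qed
  have bd: "norm (A x) \<le> \<bar>K\<bar> * sqrt \<bar>x * (1 - x)\<bar>" for x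
  proof (cases "x \<in> {0<..<1}")
    case True
    then have "norm (A x) \<le> K * sqrt (x * (1 - x))" using K by (simp add: A_def)
    also have "\<dots> \<le> \<bar>K\<bar> * sqrt \<bar>x * (1 - x)\<bar>" using True by (intro mult_mono) auto
    finally show ?thesis .
  qed (auto simp: A_def)
  have edge: "isCont A x" if "x = 0 \<or> x = 1" for x
  proof -
    have "((\<lambda>y. \<bar>K\<bar> * sqrt \<bar>y * (1 - y)\<bar>) \<longlongrightarrow> \<bar>K\<bar> * sqrt \<bar>x * (1 - x)\<bar>) (at x)"
      by (intro tendsto_intros)
    then have "((\<lambda>y. \<bar>K\<bar> * sqrt \<bar>y * (1 - y)\<bar>) \<longlongrightarrow> 0) (at x)" using that by auto
    then have "(A \<longlongrightarrow> 0) (at x)"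
      by (rule Lim_null_comparison[rotated]) (use bd in auto)
    then show ?thesis using that by (auto simp: isCont_def A_def)
  qed
  have "continuous_on {0..1} A"
  proof (intro continuous_at_imp_continuous_on ballI)
    fix x :: real assume "x \<in> {0..1}"
    then consider "x \<in> {0<..<1}" | "x = 0 \<or> x = 1" by fastforce
    then show "isCont A x" using edge inner by cases blast+
  qed
  then show ?thesis by (simp add: A_def)
qed

text \<open>The growth condition makes the boundary terms vanish: \<open>B\<close> extends by 0 to a
  continuous function on the closed interval, and the fundamental theorem then supplies the
  integrability of \<open>b\<close> together with its integral.\<close>

lemma has_integral_0_of_vanishing_primitive:
  fixes B :: "real \<Rightarrow> complex"
  assumes B: "\<And>x. 0 < x \<Longrightarrow> x < 1 \<Longrightarrow> (B has_vector_derivative b x) (at x)"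
    and K: "\<And>x. 0 < x \<Longrightarrow> x < 1 \<Longrightarrow> norm (B x) \<le> K * sqrt (x * (1 - x))"
  shows "(b has_integral 0) {0<..<1}"
proof -
  define A where "A = (\<lambda>x. if x \<in> {0<..<1} then B x else 0)"
  have der: "(A has_vector_derivative b x) (at x)" if "x \<in> {0<..<1}" for x
    by (rule has_vector_derivative_transform_within_open[OF B open_greaterThanLessThan that])
       (use that in \<open>auto simp: A_def\<close>)
  have "continuous_on {0<..<1} B"
    using B by (auto intro!: continuous_at_imp_continuous_on has_vector_derivative_continuous)
  then have "continuous_on {0..1} A"
    unfolding A_def by (rule continuous_on_extend_by_zero) (use K in auto)
  then have "(b has_integral (A 1 - A 0)) {0..1}"
    by (rule fundamental_theorem_of_calculus_interior[rotated]) (use der in auto)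
  then show ?thesis by (simp add: A_def has_integral_Icc_iff_Ioo)
qed

lemma integral_flip_unit_interval:
  "integral {0<..<1} (\<lambda>x. f (1 - x)) = integral {0<..<1} (f :: real \<Rightarrow> complex)"
proof -
  have *: "((\<lambda>x. g (1 - x)) has_integral I) {0..1}" if "(g has_integral I) {0..1}"
    for g :: "real \<Rightarrow> complex" and I
  proof -
    have "((\<lambda>x. g ((-1) *\<^sub>R x + 1)) has_integral (1 / \<bar>-1::real\<bar> ^ DIM(real)) *\<^sub>R I)
          ((\<lambda>x. (1 / (-1)) *\<^sub>R x + - ((1 / (-1)) *\<^sub>R 1)) ` cbox 0 1)"
      by (rule has_integral_affinity) (use that in auto)
    moreover have "(\<lambda>x::real. (1 / (-1)) *\<^sub>R x + - ((1 / (-1)) *\<^sub>R 1)) ` cbox 0 1 = {0..1}"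
      by (auto simp: image_iff intro: bexI[of _ "1 - _"])
    ultimately show ?thesis by simp
  qed
  have "integral {0..1} (\<lambda>x. f (1 - x)) = integral {0..1} f"
  proof (cases "f integrable_on {0..1}")
    case True
    show ?thesis by (rule integral_unique[OF *[OF integrable_integral[OF True]]])
  next
    \<comment> \<open>Reflection preserves non-integrability as well, and then both integrals have
      the default value 0.\<close>
    case False
    then have "\<not> (\<lambda>x. f (1 - x)) integrable_on {0..1}"
      using *[of "\<lambda>x. f (1 - x)"] by (auto simp: integrable_on_def)
    then show ?thesis using False by (simp add: not_integrable_integral)
  qed
  then show ?thesis by (simp add: integral_open_interval_real)
qed

section \<open>Boundary behaviour of the products\<close>

lemma legendre_P_bounded:
  obtains A where "A > 0" "\<forall>x. 0 \<le> x \<longrightarrow> x \<le> 1 \<longrightarrow> \<bar>legendre_P n (2 * x - 1)\<bar> \<le> A"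
    "\<forall>x. 0 \<le> x \<longrightarrow> x \<le> 1 \<longrightarrow> \<bar>legendre_P' n (2 * x - 1)\<bar> \<le> A"
proof -
  have "bounded ((\<lambda>x. legendre_P n (2 * x - 1)) ` {0..1})" "bounded ((\<lambda>x. legendre_P' n (2 * x - 1)) ` {0..1})"
    by (intro compact_imp_bounded compact_continuous_image continuous_intros; simp)+
  then obtain a b where "a > 0" "\<forall>x\<in>{0..1}. \<bar>legendre_P n (2 * x - 1)\<bar> \<le> a"
     "\<forall>x\<in>{0..1}. \<bar>legendre_P' n (2 * x - 1)\<bar> \<le> b"
    unfolding bounded_pos by auto
  then have "max a b > 0" "\<forall>x. 0 \<le> x \<longrightarrow> x \<le> 1 \<longrightarrow> \<bar>legendre_P n (2 * x - 1)\<bar> \<le> max a b"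
     "\<forall>x. 0 \<le> x \<longrightarrow> x \<le> 1 \<longrightarrow> \<bar>legendre_P' n (2 * x - 1)\<bar> \<le> max a b"
    by (simp_all add: le_max_iff_disj)
  then show ?thesis by (rule that)
qed

text \<open>The singularities of F(x) at 1 and of F(1 - x) at 0 multiply to the weight. In mixed
  products the zero of one primitive meets the singularity of the other factor: x times
  \<open>1 / sqrt x\<close> is bounded.\<close>

lemma legF_product_bounds:
  obtains C where "C > 0"
    "\<forall>x. 0 < x \<longrightarrow> x < 1 \<longrightarrow> norm (legF \<nu> x * legF \<nu> (1 - x)) \<le> C / sqrt (x * (1 - x))"
    "\<forall>x. 0 < x \<longrightarrow> x < 1 \<longrightarrow> norm (legH \<nu> x * legF \<nu> (1 - x)) \<le> C"
    "\<forall>x. 0 < x \<longrightarrow> x < 1 \<longrightarrow> norm (legF \<nu> x * legH \<nu> (1 - x)) \<le> C"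
    "\<forall>x. 0 < x \<longrightarrow> x < 1 \<longrightarrow> norm (legH \<nu> x * legH \<nu> (1 - x)) \<le> C * (x * (1 - x))"
    "\<forall>x. 0 < x \<longrightarrow> x < 1 \<longrightarrow> norm (legF \<nu> (1 - x)) \<le> C / sqrt x"
    "\<forall>x. 0 < x \<longrightarrow> x < 1 \<longrightarrow> norm (legH \<nu> (1 - x)) \<le> C * (1 - x)"
proof -
  obtain D where D [rule_format]: "D > 0"
    "\<forall>x. 0 \<le> x \<longrightarrow> x < 1 \<longrightarrow> norm (legF \<nu> x) \<le> D / sqrt (1 - x)"
    "\<forall>x. 0 \<le> x \<longrightarrow> x < 1 \<longrightarrow> norm (legH \<nu> x) \<le> D * x"
    by (rule legFH_bounds_at[of \<nu>]) (rule that; assumption)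
  define C where "C = D + D * D"
  have CD: "D \<le> C" "D * D \<le> C" using D(1) by (auto simp: C_def)
  have le_sqrt: "D * x * (D / sqrt x) \<le> C" if "0 < x" "x < 1" for x
  proof -
    have "D * x * (D / sqrt x) = D * D * (x / sqrt x)" by simp
    also have "\<dots> = D * D * sqrt x" using that by (simp add: real_div_sqrt)
    also have "\<dots> \<le> D * D * 1" using that D(1) by (intro mult_left_mono) auto
    finally show ?thesis using CD by simp
  qed
  show ?thesis
  proof (rule that[of C]; (intro allI impI)?)
    show "C > 0" using D(1) CD by linarith
    fix x :: real assume x: "0 < x" "x < 1"
    note F1 = D(2)[of x] and F2 = D(2)[of "1 - x"] and H1 = D(3)[of x] and H2 = D(3)[of "1 - x"]
    have "norm (legF \<nu> x * legF \<nu> (1 - x)) \<le> D / sqrt (1 - x) * (D / sqrt x)"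
      unfolding norm_mult using x F1 F2 D(1) by (intro mult_mono) auto
    also have "\<dots> = D * D / sqrt (x * (1 - x))" by (simp add: real_sqrt_mult mult.commute)
    also have "\<dots> \<le> C / sqrt (x * (1 - x))" using CD x by (intro divide_right_mono) auto
    finally show "norm (legF \<nu> x * legF \<nu> (1 - x)) \<le> C / sqrt (x * (1 - x))" .
    have "norm (legH \<nu> x * legF \<nu> (1 - x)) \<le> D * x * (D / sqrt x)"
      unfolding norm_mult using x H1 F2 D(1) by (intro mult_mono) auto
    then show "norm (legH \<nu> x * legF \<nu> (1 - x)) \<le> C" using le_sqrt[OF x] by linarith
    have "norm (legF \<nu> x * legH \<nu> (1 - x)) \<le> D / sqrt (1 - x) * (D * (1 - x))"
      unfolding norm_mult using x F1 H2 D(1) by (intro mult_mono) auto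
    then show "norm (legF \<nu> x * legH \<nu> (1 - x)) \<le> C" using le_sqrt[of "1 - x"] x by (simp add: mult.commute)
    have "norm (legH \<nu> x * legH \<nu> (1 - x)) \<le> D * x * (D * (1 - x))"
      unfolding norm_mult using x H1 H2 D(1) by (intro mult_mono) auto
    also have "\<dots> = D * D * (x * (1 - x))" by simp
    also have "\<dots> \<le> C * (x * (1 - x))" using CD x by (intro mult_right_mono) auto
    finally show "norm (legH \<nu> x * legH \<nu> (1 - x)) \<le> C * (x * (1 - x))" .
    show "norm (legF \<nu> (1 - x)) \<le> C / sqrt x"
      using F2 x divide_right_mono[OF CD(1), of "sqrt x"] by simp
    show "norm (legH \<nu> (1 - x)) \<le> C * (1 - x)"
      using H2 x mult_right_mono[OF CD(1), of "1 - x"] by linarith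
  qed
qed

lemma legF_flip_has_vector_derivative:
  assumes "0 < x" "x < 1"
  shows "((\<lambda>x. legF \<nu> (1 - x)) has_vector_derivative
           \<nu> * (\<nu> + 1) * legH \<nu> (1 - x) / (of_real x * (1 - of_real x))) (at x)"
    "((\<lambda>x. legH \<nu> (1 - x)) has_vector_derivative - legF \<nu> (1 - x)) (at x)"
proof -
  have i: "((\<lambda>x. 1 - x) has_vector_derivative (-1::real)) (at x)"
    by (auto intro!: derivative_eq_intros)
  show "((\<lambda>x. legF \<nu> (1 - x)) has_vector_derivative
           \<nu> * (\<nu> + 1) * legH \<nu> (1 - x) / (of_real x * (1 - of_real x))) (at x)"
    using vector_diff_chain_at[OF i legF_has_vector_derivative[of "1 - x" \<nu>]] assms
    by (simp add: o_def mult.commute)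
  show "((\<lambda>x. legH \<nu> (1 - x)) has_vector_derivative - legF \<nu> (1 - x)) (at x)"
    using vector_diff_chain_at[OF i legH_has_vector_derivative[of "1 - x" \<nu>]] assms
    by (simp add: o_def)
qed

lemma continuous_on_legF: "continuous_on {0<..<1} (legF \<nu>)"
  and continuous_on_legF_flip: "continuous_on {0<..<1} (\<lambda>x. legF \<nu> (1 - x))"
  by (auto intro!: continuous_at_imp_continuous_on
      intro: has_vector_derivative_continuous[OF legF_has_vector_derivative]
         has_vector_derivative_continuous[OF legF_flip_has_vector_derivative(1)])

section \<open>Legendre integrals of the product and their recurrence\<close>

definition legI :: "complex \<Rightarrow> nat \<Rightarrow> complex" where
  "legI \<nu> n = integral {0<..<1}
     (\<lambda>x. legF \<nu> x * legF \<nu> (1 - x) * of_real (legendre_P n (2 * x - 1)))"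

lemma legI_integrand_absolutely_integrable:
  "(\<lambda>x. legF \<nu> x * legF \<nu> (1 - x) * of_real (legendre_P n (2 * x - 1))) absolutely_integrable_on {0<..<1}"
proof -
  obtain A where A [rule_format]: "A > 0" "\<forall>x. 0 \<le> x \<longrightarrow> x \<le> 1 \<longrightarrow> \<bar>legendre_P n (2 * x - 1)\<bar> \<le> A"
    by (rule legendre_P_bounded[of n]) (rule that; assumption)
  obtain C where C [rule_format]: "C > 0"
    "\<forall>x. 0 < x \<longrightarrow> x < 1 \<longrightarrow> norm (legF \<nu> x * legF \<nu> (1 - x)) \<le> C / sqrt (x * (1 - x))"
    by (rule legF_product_bounds[of \<nu>]) (rule that; assumption)
  show ?thesis
  proof (rule weight_dominated_integrable(1))
    show "continuous_on {0<..<1} (\<lambda>x. legF \<nu> x * legF \<nu> (1 - x) * of_real (legendre_P n (2 * x - 1)))"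
      by (intro continuous_intros continuous_on_legF continuous_on_legF_flip)
    fix x :: real assume x: "0 < x" "x < 1"
    have "norm (legF \<nu> x * legF \<nu> (1 - x) * of_real (legendre_P n (2 * x - 1)))
        \<le> C / sqrt (x * (1 - x)) * A"
      unfolding norm_mult[of _ "of_real _"] using A(2)[of x] C(1) C(2)[OF x] x by (intro mult_mono) auto
    then show "norm (legF \<nu> x * legF \<nu> (1 - x) * of_real (legendre_P n (2 * x - 1)))
        \<le> C * A / sqrt (x * (1 - x))" by simp
  qed
qed

lemma legI_has_integral:
  "((\<lambda>x. legF \<nu> x * legF \<nu> (1 - x) * of_real (legendre_P n (2 * x - 1))) has_integral legI \<nu> n) {0<..<1}"
  unfolding legI_def
  by (rule integrable_integral[OF set_lebesgue_integral_eq_integral(1)[OF legI_integrand_absolutely_integrable]])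

text \<open>The symmetric square equation for \<open>w\<close>, integrated by parts three times against \<open>P\<^sub>n\<close>; the
  primitive \<open>B\<close> in the proof collects all boundary terms.\<close>

lemma legI_primitive:
  fixes \<nu> :: complex and n :: nat
  defines "l \<equiv> \<nu> * (\<nu> + 1)" and "\<kappa> \<equiv> of_nat n * (of_nat n + 1)"
  defines "q \<equiv> \<lambda>x. complex_of_real x * (1 - of_real x)"
    and "\<phi> \<equiv> \<lambda>x. complex_of_real (legendre_P n (2 * x - 1))"
    and "\<psi> \<equiv> \<lambda>x. complex_of_real ((1 - (2 * x - 1)\<^sup>2) * legendre_P' n (2 * x - 1) / 2)"
  shows "((\<lambda>x. legF \<nu> x * legF \<nu> (1 - x) *
            (2 * l * (1 - 2 * of_real x) * \<phi> x + 4 * l * \<psi> x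
               - \<kappa> * ((1 - 2 * of_real x) * \<phi> x + \<psi> x))) has_integral 0) {0<..<1}"
proof -
  \<comment> \<open>For w = F(x) F(1 - x), Legendre's equation gives q w' = l (F(x) H(1 - x) - H(x)
    F(1 - x)) and q (q w')' + 2 l q w = - 2 l^2 H(x) H(1 - x), while \<psi> = q \<phi>'. So
    \<open>B\<close> is q (q w')' \<phi> - q w' \<psi> + (4 l - \<kappa>) q w \<phi>, written
    without derivatives of w.\<close>
  define B where "B = (\<lambda>x. - 2 * l * l * (legH \<nu> x * legH \<nu> (1 - x)) * \<phi> x
     + (2 * l - \<kappa>) * q x * (legF \<nu> x * legF \<nu> (1 - x)) * \<phi> x
     - l * (legF \<nu> x * legH \<nu> (1 - x) - legH \<nu> x * legF \<nu> (1 - x)) * \<psi> x)"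
  obtain A where A [rule_format]: "A > 0" "\<forall>x. 0 \<le> x \<longrightarrow> x \<le> 1 \<longrightarrow> \<bar>legendre_P n (2 * x - 1)\<bar> \<le> A"
     "\<forall>x. 0 \<le> x \<longrightarrow> x \<le> 1 \<longrightarrow> \<bar>legendre_P' n (2 * x - 1)\<bar> \<le> A"
    by (rule legendre_P_bounded[of n]) (rule that; assumption)
  obtain C where C [rule_format]: "C > 0"
    "\<forall>x. 0 < x \<longrightarrow> x < 1 \<longrightarrow> norm (legF \<nu> x * legF \<nu> (1 - x)) \<le> C / sqrt (x * (1 - x))"
    "\<forall>x. 0 < x \<longrightarrow> x < 1 \<longrightarrow> norm (legH \<nu> x * legF \<nu> (1 - x)) \<le> C"
    "\<forall>x. 0 < x \<longrightarrow> x < 1 \<longrightarrow> norm (legF \<nu> x * legH \<nu> (1 - x)) \<le> C"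
    "\<forall>x. 0 < x \<longrightarrow> x < 1 \<longrightarrow> norm (legH \<nu> x * legH \<nu> (1 - x)) \<le> C * (x * (1 - x))"
    "\<forall>x. 0 < x \<longrightarrow> x < 1 \<longrightarrow> norm (legF \<nu> (1 - x)) \<le> C / sqrt x"
    "\<forall>x. 0 < x \<longrightarrow> x < 1 \<longrightarrow> norm (legH \<nu> (1 - x)) \<le> C * (1 - x)"
    by (rule legF_product_bounds[of \<nu>]) (rule that; assumption)
  show ?thesis
  proof (rule has_integral_0_of_vanishing_primitive[of B])
    fix x :: real assume x: "0 < x" "x < 1"
    define r where "r = 1 / q x"
    have qr: "q x * r = 1" using x by (simp add: r_def q_def)
    have D1: "(legF \<nu> has_vector_derivative - l * legH \<nu> x * r) (at x)"
      using legF_has_vector_derivative[OF x, of \<nu>] by (simp add: l_def r_def q_def)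
    have D2: "((\<lambda>x. legF \<nu> (1 - x)) has_vector_derivative l * legH \<nu> (1 - x) * r) (at x)"
      using legF_flip_has_vector_derivative(1)[OF x, of \<nu>] by (simp add: l_def r_def q_def)
    have D3: "(legH \<nu> has_vector_derivative legF \<nu> x) (at x)"
      using x by (intro legH_has_vector_derivative) simp
    note D4 = legF_flip_has_vector_derivative(2)[OF x, of \<nu>]
    have "((\<lambda>x. legendre_P n (2 * x - 1)) has_real_derivative legendre_P' n (2 * x - 1) * 2) (at x)"
      by (auto intro!: derivative_eq_intros)
    then have "(\<phi> has_vector_derivative of_real (legendre_P' n (2 * x - 1) * 2)) (at x)"
      unfolding \<phi>_def by (intro has_vector_derivative_of_real) (simp add: has_real_derivative_iff_has_vector_derivative)
    moreover have "of_real (legendre_P' n (2 * x - 1) * 2) = \<psi> x * r"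
    proof -
      have "\<psi> x = q x * of_real (legendre_P' n (2 * x - 1) * 2)"
      proof -
        have "(1 - (2 * x - 1)\<^sup>2) * legendre_P' n (2 * x - 1) / 2 = x * (1 - x) * (legendre_P' n (2 * x - 1) * 2)"
          by (simp add: power2_eq_square field_simps)
        then show ?thesis unfolding \<psi>_def q_def by (simp only: of_real_mult of_real_diff of_real_1)
      qed
      then show ?thesis using qr by simp
    qed
    ultimately have D5: "(\<phi> has_vector_derivative \<psi> x * r) (at x)" by simp
    have "((\<lambda>x. (1 - (2 * x - 1)\<^sup>2) * legendre_P' n (2 * x - 1)) has_real_derivative
        (- (real n * (real n + 1)) * legendre_P n (2 * x - 1)) * 2) (at x)"
      by (rule legendre_ode_unit)
    from DERIV_cdivide[OF this, of 2]
    have "((\<lambda>x. (1 - (2 * x - 1)\<^sup>2) * legendre_P' n (2 * x - 1) / 2) has_real_derivative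
        - (real n * (real n + 1)) * legendre_P n (2 * x - 1)) (at x)" by simp
    then have "(\<psi> has_vector_derivative of_real (- (real n * (real n + 1)) * legendre_P n (2 * x - 1))) (at x)"
      unfolding \<psi>_def by (intro has_vector_derivative_of_real) (simp only: has_real_derivative_iff_has_vector_derivative)
    then have D6: "(\<psi> has_vector_derivative - \<kappa> * \<phi> x) (at x)"
      by (simp add: \<kappa>_def \<phi>_def)
    have D7: "(q has_vector_derivative 1 - 2 * of_real x) (at x)"
      unfolding q_def by (rule derivative_eq_intros has_vector_derivative_of_real refl)+ simp
    show "(B has_vector_derivative legF \<nu> x * legF \<nu> (1 - x) *
            (2 * l * (1 - 2 * of_real x) * \<phi> x + 4 * l * \<psi> x
               - \<kappa> * ((1 - 2 * of_real x) * \<phi> x + \<psi> x))) (at x)"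
      unfolding B_def
      by (rule derivative_eq_intros D1 D2 D3 D4 D5 D6 D7 refl)+ (use qr in algebra)
    define s where "s = sqrt (x * (1 - x))"
    have s: "0 < s" "s \<le> 1" "s * s = x * (1 - x)" 
      using x by (auto simp: s_def mult_le_one)
    have nq: "norm (q x) = s * s"
    proof -
      have "q x = of_real (x * (1 - x))" by (simp add: q_def)
      then show ?thesis using x s(3) by (simp only: norm_of_real) simp
    qed
    have n\<phi>: "norm (\<phi> x) \<le> A" using A(2)[of x] x by (simp add: \<phi>_def)
    have n\<psi>: "norm (\<psi> x) \<le> 2 * A * s"
    proof -
      have "norm (\<psi> x) = 2 * s * s * \<bar>legendre_P' n (2 * x - 1)\<bar>"
      proof -
        have "(1 - (2 * x - 1)\<^sup>2) * legendre_P' n (2 * x - 1) / 2 = 2 * (s * s) * legendre_P' n (2 * x - 1)"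
          unfolding s(3) by (simp add: power2_eq_square field_simps)
        then show ?thesis unfolding \<psi>_def norm_of_real using s x by (simp only: abs_mult) simp
      qed
      also have "\<dots> \<le> 2 * s * 1 * A" using s A(3)[of x] x by (intro mult_mono) auto
      finally show ?thesis by (simp add: mult_ac)
    qed
    have "norm (- 2 * l * l * (legH \<nu> x * legH \<nu> (1 - x)) * \<phi> x) \<le> norm (2 * l * l) * (C * s) * A"
    proof -
      have "norm (legH \<nu> x * legH \<nu> (1 - x)) \<le> C * (s * s)" using C(5)[OF x] s(3) by simp
      also have "\<dots> \<le> C * (s * 1)" using s C(1) by (intro mult_left_mono) auto
      finally have b: "norm (legH \<nu> x * legH \<nu> (1 - x)) \<le> C * s" by simp
      have "norm (- 2 * l * l * (legH \<nu> x * legH \<nu> (1 - x)) * \<phi> x)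
          = norm (2 * l * l) * norm (legH \<nu> x * legH \<nu> (1 - x)) * norm (\<phi> x)"
        by (simp add: norm_mult)
      also have "\<dots> \<le> norm (2 * l * l) * (C * s) * A"
        using n\<phi> C(1) s b by (intro mult_mono mult_left_mono) auto
      finally show ?thesis .
    qed
    moreover have "norm ((2 * l - \<kappa>) * q x * (legF \<nu> x * legF \<nu> (1 - x)) * \<phi> x) \<le> norm (2 * l - \<kappa>) * (C * s) * A"
    proof -
      have "norm (q x * (legF \<nu> x * legF \<nu> (1 - x))) \<le> s * s * (C / s)"
        unfolding norm_mult[of "q x"] nq using C(2)[OF x] s by (intro mult_left_mono) (auto simp: s_def)
      also have "\<dots> = C * s" using s(1) by (simp add: field_simps)
      finally have b: "norm (q x * (legF \<nu> x * legF \<nu> (1 - x))) \<le> C * s" .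
      have "norm ((2 * l - \<kappa>) * q x * (legF \<nu> x * legF \<nu> (1 - x)) * \<phi> x)
          = norm (2 * l - \<kappa>) * norm (q x * (legF \<nu> x * legF \<nu> (1 - x))) * norm (\<phi> x)"
        by (simp only: norm_mult mult.assoc)
      also have "\<dots> \<le> norm (2 * l - \<kappa>) * (C * s) * A"
        using n\<phi> C(1) s b by (intro mult_mono mult_left_mono) auto
      finally show ?thesis .
    qed
    moreover have "norm (l * (legF \<nu> x * legH \<nu> (1 - x) - legH \<nu> x * legF \<nu> (1 - x)) * \<psi> x)
        \<le> norm l * (C + C) * (2 * A * s)"
      unfolding norm_mult[of _ "\<psi> x"] norm_mult[of l]
      using C(1) C(3,4)[OF x] n\<psi> by (intro mult_mono order.trans[OF norm_triangle_ineq4] add_mono) auto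
    ultimately have "norm (B x) \<le> norm (2 * l * l) * (C * s) * A + norm (2 * l - \<kappa>) * (C * s) * A
        + norm l * (C + C) * (2 * A * s)"
      unfolding B_def by (intro order.trans[OF norm_triangle_ineq4] order.trans[OF norm_triangle_ineq] add_mono)
    then show "norm (B x) \<le> (norm (2 * l * l) * C * A + norm (2 * l - \<kappa>) * C * A
        + norm l * (C + C) * (2 * A)) * sqrt (x * (1 - x))"
      unfolding s_def[symmetric] by (simp add: algebra_simps)
  qed
qed

text \<open>This is \<open>legI_primitive\<close> at degree n + 1: both t P_(n+1) and (1 - t^2)
  P'_(n+1) are combinations of P_n and P_(n+2), so only two integrals remain.\<close>

lemma legI_recurrence:
  "(of_nat n + 2)\<^sup>2 * ((of_nat n + 1) * (of_nat n + 3) - 4 * (\<nu> * (\<nu> + 1))) * legI \<nu> (Suc (Suc n))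
   = (of_nat n + 1)\<^sup>2 * (of_nat n * (of_nat n + 2) - 4 * (\<nu> * (\<nu> + 1))) * legI \<nu> n"
proof -
  let ?w = "\<lambda>x. legF \<nu> x * legF \<nu> (1 - x)" and ?P = "\<lambda>n x. complex_of_real (legendre_P n (2 * x - 1))"
  let ?l = "\<nu> * (\<nu> + 1)"
  define a where "a = (of_nat n + 2)\<^sup>2 * ((of_nat n + 1) * (of_nat n + 3) - 4 * ?l)"
  define b where "b = (of_nat n + 1)\<^sup>2 * (of_nat n * (of_nat n + 2) - 4 * ?l)"
  \<comment> \<open>Clears the denominator 2 n + 3 of t P_(n+1), when expressed by its neighbours,
    and the 1/2 in the derivative term.\<close>
  define d :: complex where "d = 2 * (2 * of_nat n + 3)"
  have "((\<lambda>x. d * (?w x * (2 * ?l * (1 - 2 * of_real x) * ?P (Suc n) x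
       + 4 * ?l * of_real ((1 - (2 * x - 1)\<^sup>2) * legendre_P' (Suc n) (2 * x - 1) / 2)
       - of_nat (Suc n) * (of_nat (Suc n) + 1) * ((1 - 2 * of_real x) * ?P (Suc n) x
       + of_real ((1 - (2 * x - 1)\<^sup>2) * legendre_P' (Suc n) (2 * x - 1) / 2))))) has_integral d * 0) {0<..<1}"
    by (rule has_integral_mult_right[OF legI_primitive])
  moreover have "d * (?w x * (2 * ?l * (1 - 2 * of_real x) * ?P (Suc n) x
       + 4 * ?l * of_real ((1 - (2 * x - 1)\<^sup>2) * legendre_P' (Suc n) (2 * x - 1) / 2)
       - of_nat (Suc n) * (of_nat (Suc n) + 1) * ((1 - 2 * of_real x) * ?P (Suc n) x
       + of_real ((1 - (2 * x - 1)\<^sup>2) * legendre_P' (Suc n) (2 * x - 1) / 2))))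
      = a * (?w x * ?P (Suc (Suc n)) x) - b * (?w x * ?P n x)" for x
  proof -
    define t where "t = 2 * x - 1"
    define N T p0 p1 p2 y w :: complex where defs: "N = of_nat n" "T = of_real t" "p0 = of_real (legendre_P n t)"
      "p1 = of_real (legendre_P (Suc n) t)" "p2 = of_real (legendre_P (Suc (Suc n)) t)"
      "y = of_real ((1 - t\<^sup>2) * legendre_P' (Suc n) t / 2)" "w = ?w x"
    have 1: "(N + 2) * p2 = (2 * N + 3) * T * p1 - (N + 1) * p0"
      using arg_cong[OF legendre_P_recurrence[of n t], of complex_of_real] by (simp add: defs)
    have 2: "2 * y = (N + 1) * (p0 - T * p1)"
    proof -
      have "2 * ((1 - t\<^sup>2) * legendre_P' (Suc n) t / 2) = (real n + 1) * (legendre_P n t - t * legendre_P (Suc n) t)"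
        using one_minus_sq_legendre_P'[of t n] by simp
      from arg_cong[OF this, of complex_of_real] show ?thesis unfolding defs by simp
    qed
    have 3: "1 - 2 * complex_of_real x = - T" by (simp add: defs t_def)
    have 4: "complex_of_nat (Suc n) = N + 1" by (simp add: defs)
    have "d * (w * (2 * ?l * (- T) * p1 + 4 * ?l * y - (N + 1) * (N + 1 + 1) * (- T * p1 + y)))
        = (N + 2)\<^sup>2 * ((N + 1) * (N + 3) - 4 * ?l) * (w * p2) - (N + 1)\<^sup>2 * (N * (N + 2) - 4 * ?l) * (w * p0)"
      unfolding d_def defs(1)[symmetric] using 1 2 by algebra
    then show ?thesis
      unfolding a_def b_def t_def[symmetric] 3 4 defs(1,3-7)[symmetric] by simp
  qed
  ultimately have "((\<lambda>x. a * (?w x * ?P (Suc (Suc n)) x) - b * (?w x * ?P n x)) has_integral 0) {0<..<1}"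
    by simp
  moreover have "((\<lambda>x. a * (?w x * ?P (Suc (Suc n)) x) - b * (?w x * ?P n x)) has_integral
      (a * legI \<nu> (Suc (Suc n)) - b * legI \<nu> n)) {0<..<1}"
    by (intro has_integral_diff has_integral_mult_right legI_has_integral)
  ultimately have "a * legI \<nu> (Suc (Suc n)) - b * legI \<nu> n = 0"
    by (rule has_integral_unique[rotated])
  then show ?thesis by (simp add: a_def b_def)
qed

section \<open>The coefficients for generic parameters\<close>

text \<open>The partial sums of F are bounded by a multiple of \<open>1 / sqrt (1 - x)\<close>; the
  singularity allowed for \<open>g\<close> at 0 is just what completes this to the integrable
  weight.\<close>

lemma integral_legF_mult_sums:
  fixes g :: "real \<Rightarrow> complex"
  assumes g: "continuous_on {0<..<1} g" "\<And>x. 0 < x \<Longrightarrow> x < 1 \<Longrightarrow> norm (g x) \<le> D / sqrt x"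
  shows "(\<lambda>k. hyp_coeff \<nu> k * integral {0<..<1} (\<lambda>x. of_real x ^ k * g x))
           sums integral {0<..<1} (\<lambda>x. legF \<nu> x * g x)"
proof -
  obtain C where C [rule_format]: "C > 0"
    "\<forall>N x. 0 \<le> x \<longrightarrow> x < 1 \<longrightarrow> norm (\<Sum>k<N. hyp_coeff \<nu> k * of_real x ^ k) \<le> C / sqrt (1 - x)"
    by (rule legFH_bounds_at[of \<nu>]) (rule that; assumption)
  have int: "(\<lambda>x. of_real x ^ k * g x) integrable_on {0<..<1}" for k
  proof (rule weight_dominated_integrable(2))
    fix x :: real assume x: "0 < x" "x < 1"
    have D0: "0 \<le> D / sqrt x" using g(2)[OF x] norm_ge_zero order.trans by blast
    have "norm (of_real x ^ k * g x) \<le> 1 * norm (g x)"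
      unfolding norm_mult using x by (intro mult_right_mono) (auto simp: norm_power power_le_one)
    also have "\<dots> \<le> D / sqrt x * 1" using g(2)[OF x] by simp
    also have "\<dots> \<le> D / sqrt x * (1 / sqrt (1 - x))"
      using x D0 by (intro mult_left_mono) (auto simp: divide_simps)
    finally show "norm (of_real x ^ k * g x) \<le> D / sqrt (x * (1 - x))"
      by (simp add: real_sqrt_mult)
  qed (intro continuous_intros g)
  have "(\<lambda>N. integral {0<..<1} (\<lambda>x. (\<Sum>k<N. hyp_coeff \<nu> k * of_real x ^ k) * g x))
      \<longlonglongrightarrow> integral {0<..<1} (\<lambda>x. legF \<nu> x * g x)"
  proof (rule weight_dominated_convergence)
    fix N and x :: real assume x: "0 < x" "x < 1"
    have "norm ((\<Sum>k<N. hyp_coeff \<nu> k * of_real x ^ k) * g x) \<le> C / sqrt (1 - x) * (D / sqrt x)"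
      unfolding norm_mult using x C g(2)[OF x] by (intro mult_mono) auto
    then show "norm ((\<Sum>k<N. hyp_coeff \<nu> k * of_real x ^ k) * g x) \<le> C * D / sqrt (x * (1 - x))"
      by (simp add: real_sqrt_mult mult.commute)
  next
    fix x :: real assume x: "0 < x" "x < 1"
    then show "(\<lambda>N. (\<Sum>k<N. hyp_coeff \<nu> k * of_real x ^ k) * g x) \<longlonglongrightarrow> legF \<nu> x * g x"
      using legF_sums[of x \<nu>] unfolding sums_def by (intro tendsto_mult tendsto_const) auto
  qed (intro continuous_intros g)
  moreover have "integral {0<..<1} (\<lambda>x. (\<Sum>k<N. hyp_coeff \<nu> k * of_real x ^ k) * g x)
      = (\<Sum>k<N. hyp_coeff \<nu> k * integral {0<..<1} (\<lambda>x. of_real x ^ k * g x))" for N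
  proof -
    have "(\<lambda>x. (\<Sum>k<N. hyp_coeff \<nu> k * of_real x ^ k) * g x)
        = (\<lambda>x. \<Sum>k<N. hyp_coeff \<nu> k * (of_real x ^ k * g x))"
      by (simp add: sum_distrib_right mult.assoc)
    then show ?thesis
      by (simp add: integral_sum integrable_on_mult_right int)
  qed
  ultimately show ?thesis by (simp add: sums_def)
qed

text \<open>In the product of the two \<open>rGamma_series\<close> the powers n^(-\<nu>) and
  n^(\<nu> + 1) combine to n. The limit equals - sin (pi \<nu>) / pi; besides the integral of F it
  governs the divergence at the end points and, at \<nu> = -1/2, the size of
  \<open>cbin\<close>.\<close>

lemma hyp_coeff_limit:
  "(\<lambda>k. of_nat k * hyp_coeff \<nu> k) \<longlonglongrightarrow> rGamma (- \<nu>) * rGamma (\<nu> + 1)"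
proof -
  have "(\<lambda>n. rGamma_series (- \<nu>) n * rGamma_series (\<nu> + 1) n * (of_nat n / of_nat (Suc n)))
          \<longlonglongrightarrow> rGamma (- \<nu>) * rGamma (\<nu> + 1) * 1"
    by (intro tendsto_mult rGamma_series_LIMSEQ LIMSEQ_n_over_Suc_n)
  moreover have "\<forall>\<^sub>F n in sequentially.
      rGamma_series (- \<nu>) n * rGamma_series (\<nu> + 1) n * (of_nat n / of_nat (Suc n))
        = of_nat (Suc n) * hyp_coeff \<nu> (Suc n)"
    using eventually_gt_at_top[of 0]
  proof eventually_elim
    case (elim n)
    have e: "exp (- \<nu> * of_real (ln (real n))) * exp ((\<nu> + 1) * of_real (ln (real n))) = of_nat n"
      using elim by (simp add: exp_add[symmetric] algebra_simps exp_of_real)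
    have "rGamma_series (- \<nu>) n * rGamma_series (\<nu> + 1) n
        = pochhammer (- \<nu>) (Suc n) * pochhammer (\<nu> + 1) (Suc n) / ((fact n)\<^sup>2 *
           (exp (- \<nu> * of_real (ln (real n))) * exp ((\<nu> + 1) * of_real (ln (real n)))))"
      by (simp add: rGamma_series_def power2_eq_square)
    also have "\<dots> = pochhammer (- \<nu>) (Suc n) * pochhammer (\<nu> + 1) (Suc n) / ((fact n)\<^sup>2 * of_nat n)"
      unfolding e ..
    finally show ?case
      using elim by (simp add: hyp_coeff_pochhammer power_mult_distrib power2_eq_square del: pochhammer_Suc of_nat_Suc)
  qed
  ultimately have "(\<lambda>n. of_nat (Suc n) * hyp_coeff \<nu> (Suc n)) \<longlonglongrightarrow> rGamma (- \<nu>) * rGamma (\<nu> + 1) * 1"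
    by (rule Lim_transform_eventually)
  then show ?thesis by (subst (asm) filterlim_sequentially_Suc) simp
qed

section \<open>Moments of the reflected factor and the initial value\<close>

definition legM :: "complex \<Rightarrow> nat \<Rightarrow> complex" where
  "legM \<nu> k = integral {0<..<1} (\<lambda>x. of_real x ^ k * legF \<nu> (1 - x))"

lemma legM_has_integral:
  "((\<lambda>x. of_real x ^ k * legF \<nu> (1 - x)) has_integral legM \<nu> k) {0<..<1}"
proof -
  obtain C where C [rule_format]: "C > 0" "\<forall>x. 0 < x \<longrightarrow> x < 1 \<longrightarrow> norm (legF \<nu> (1 - x)) \<le> C / sqrt x"
    by (rule legF_product_bounds[of \<nu>]) (rule that; assumption)
  have "(\<lambda>x. of_real x ^ k * legF \<nu> (1 - x)) integrable_on {0<..<1}"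
  proof (rule weight_dominated_integrable(2))
    fix x :: real assume x: "0 < x" "x < 1"
    have "norm (of_real x ^ k * legF \<nu> (1 - x)) \<le> 1 * norm (legF \<nu> (1 - x))"
      unfolding norm_mult using x by (intro mult_right_mono) (auto simp: norm_power power_le_one)
    also have "\<dots> \<le> C / sqrt x * 1" using C(2)[OF x] by simp
    also have "\<dots> \<le> C / sqrt x * (1 / sqrt (1 - x))"
      using x C(1) by (intro mult_left_mono) (auto simp: divide_simps)
    finally show "norm (of_real x ^ k * legF \<nu> (1 - x)) \<le> C / sqrt (x * (1 - x))"
      by (simp add: real_sqrt_mult)
  qed (intro continuous_intros continuous_on_legF_flip)
  then show ?thesis unfolding legM_def by (rule integrable_integral)
qed

text \<open>Lagrange's identity for the Legendre operator, applied to F(1 - x) and x^(k+1). The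
  operator maps x^(k+1) to a combination of x^k and x^(k+1), hence two terms. As l H(1 - x) is x (1
  - x) times the derivative of F(1 - x), the primitive \<open>B\<close> is the usual boundary
  form.\<close>

lemma legM_Suc:
  "(of_nat (Suc k) - \<nu>) * (of_nat (Suc k) + \<nu> + 1) * legM \<nu> (Suc k) = (of_nat k + 1)\<^sup>2 * legM \<nu> k"
proof -
  define l where "l = \<nu> * (\<nu> + 1)"
  define N :: complex where "N = of_nat k"
  define B where "B = (\<lambda>x. l * legH \<nu> (1 - x) * of_real x ^ Suc k
     - (N + 1) * (of_real x ^ Suc k - of_real x ^ Suc (Suc k)) * legF \<nu> (1 - x))"
  obtain C where C [rule_format]: "C > 0"
    "\<forall>x. 0 < x \<longrightarrow> x < 1 \<longrightarrow> norm (legF \<nu> (1 - x)) \<le> C / sqrt x"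
    "\<forall>x. 0 < x \<longrightarrow> x < 1 \<longrightarrow> norm (legH \<nu> (1 - x)) \<le> C * (1 - x)"
    by (rule legF_product_bounds[of \<nu>]) (rule that; assumption)
  have "((\<lambda>x. ((N + 1) * (N + 2) - l) * (of_real x ^ Suc k * legF \<nu> (1 - x))
      - (N + 1)\<^sup>2 * (of_real x ^ k * legF \<nu> (1 - x))) has_integral 0) {0<..<1}"
  proof (rule has_integral_0_of_vanishing_primitive[of B])
    fix x :: real assume x: "0 < x" "x < 1"
    define r where "r = 1 / (complex_of_real x * (1 - of_real x))"
    have qr: "complex_of_real x * (1 - of_real x) * r = 1" using x by (simp add: r_def)
    have D2: "((\<lambda>x. legF \<nu> (1 - x)) has_vector_derivative l * legH \<nu> (1 - x) * r) (at x)"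
      using legF_flip_has_vector_derivative(1)[OF x, of \<nu>] by (simp add: l_def r_def)
    note D4 = legF_flip_has_vector_derivative(2)[OF x, of \<nu>]
    have D: "((\<lambda>x. complex_of_real x ^ Suc j) has_vector_derivative (of_nat j + 1) * of_real x ^ j) (at x)" for j
      using DERIV_power_Suc[OF DERIV_ident, of j "complex_of_real x"]
      by (intro has_vector_derivative_real_field) (simp add: add.commute)
    show "(B has_vector_derivative ((N + 1) * (N + 2) - l) * (of_real x ^ Suc k * legF \<nu> (1 - x))
      - (N + 1)\<^sup>2 * (of_real x ^ k * legF \<nu> (1 - x))) (at x)"
      unfolding B_def
    proof (rule derivative_eq_intros D D2 D4 refl)+
      define X H0 F0 y where "X = complex_of_real x ^ k" "H0 = legH \<nu> (1 - x)" "F0 = legF \<nu> (1 - x)" "y = complex_of_real x"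
      note abbr = this
      have "l * H0 * ((N + 1) * X) + (l * - F0 + 0 * H0) * (y * X)
         - ((N + 1) * (y * X - y * (y * X)) * (l * H0 * r)
            + ((N + 1) * ((N + 1) * X - (1 + N + 1) * (y * X)) + 0 * (y * X - y * (y * X))) * F0)
         = ((N + 1) * (N + 2) - l) * (y * X * F0) - (N + 1)\<^sup>2 * (X * F0)"
        using qr unfolding abbr(4)[symmetric] by algebra
      then show "l * legH \<nu> (1 - x) * ((of_nat k + 1) * complex_of_real x ^ k) +
          (l * - legF \<nu> (1 - x) + 0 * legH \<nu> (1 - x)) * complex_of_real x ^ Suc k -
          ((N + 1) * (complex_of_real x ^ Suc k - complex_of_real x ^ Suc (Suc k)) * (l * legH \<nu> (1 - x) * r) +
           ((N + 1) * ((of_nat k + 1) * complex_of_real x ^ k - (of_nat (Suc k) + 1) * complex_of_real x ^ Suc k)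
             + 0 * (complex_of_real x ^ Suc k - complex_of_real x ^ Suc (Suc k))) * legF \<nu> (1 - x)) =
          ((N + 1) * (N + 2) - l) * (complex_of_real x ^ Suc k * legF \<nu> (1 - x)) -
          (N + 1)\<^sup>2 * (complex_of_real x ^ k * legF \<nu> (1 - x))"
        unfolding abbr power_Suc of_nat_Suc N_def[symmetric] .
    qed
    define s where "s = sqrt (x * (1 - x))"
    have s: "0 < s" "s \<le> 1" "s * s = x * (1 - x)" 
      using x by (auto simp: s_def mult_le_one)
    have q: "x * (1 - x) \<le> s" using mult_left_le[of s s] s by linarith
    have pk: "x ^ k \<le> 1" using x by (simp add: power_le_one)
    have "norm (l * legH \<nu> (1 - x) * of_real x ^ Suc k) \<le> norm l * (C * s)"
    proof -
      have "norm (legH \<nu> (1 - x)) * x ^ Suc k \<le> C * (1 - x) * (x * 1)"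
        unfolding power_Suc using x C(1) C(3)[OF x] pk by (intro mult_mono) auto
      also have "\<dots> = C * (x * (1 - x))" by simp
      also have "\<dots> \<le> C * s" using q C(1) by simp
      finally show ?thesis using x by (simp add: norm_mult norm_power mult.assoc mult_left_mono del: power_Suc)
    qed
    moreover have "norm ((N + 1) * (of_real x ^ Suc k - of_real x ^ Suc (Suc k)) * legF \<nu> (1 - x)) \<le> norm (N + 1) * (C * s)"
    proof -
      have "complex_of_real x ^ Suc k - of_real x ^ Suc (Suc k) = of_real (x ^ k * (s * s))"
        unfolding s(3) by (simp add: algebra_simps)
      then have "norm ((complex_of_real x ^ Suc k - of_real x ^ Suc (Suc k)) * legF \<nu> (1 - x)) = x ^ k * (s * s) * norm (legF \<nu> (1 - x))"
        using x by (simp only: norm_mult norm_of_real) (simp add: abs_mult)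
      also have "\<dots> \<le> 1 * (s * s) * (C / sqrt x)"
        using x C(1) C(2)[OF x] pk s by (intro mult_mono) auto
      also have "\<dots> = s * (sqrt (1 - x) * C)" using x by (simp add: s_def real_sqrt_mult)
      also have "\<dots> \<le> s * (1 * C)" using x s C(1) by (intro mult_left_mono mult_right_mono) auto
      finally have "norm ((complex_of_real x ^ Suc k - of_real x ^ Suc (Suc k)) * legF \<nu> (1 - x)) \<le> C * s"
        by (simp only: mult_1 mult.commute[of s])
      then show ?thesis unfolding mult.assoc[of "N + 1"] norm_mult[of "N + 1"] by (intro mult_left_mono) auto
    qed
    ultimately have "norm (B x) \<le> norm l * (C * s) + norm (N + 1) * (C * s)"
      unfolding B_def by (intro order.trans[OF norm_triangle_ineq4] add_mono)
    then show "norm (B x) \<le> (norm l * C + norm (N + 1) * C) * sqrt (x * (1 - x))"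
      unfolding s_def[symmetric] by (simp add: algebra_simps)
  qed
  moreover have "((\<lambda>x. ((N + 1) * (N + 2) - l) * (of_real x ^ Suc k * legF \<nu> (1 - x))
      - (N + 1)\<^sup>2 * (of_real x ^ k * legF \<nu> (1 - x))) has_integral
      ((N + 1) * (N + 2) - l) * legM \<nu> (Suc k) - (N + 1)\<^sup>2 * legM \<nu> k) {0<..<1}"
    by (intro has_integral_diff has_integral_mult_right legM_has_integral)
  ultimately have "((N + 1) * (N + 2) - l) * legM \<nu> (Suc k) - (N + 1)\<^sup>2 * legM \<nu> k = 0"
    by (rule has_integral_unique[rotated])
  then show ?thesis by (simp add: N_def l_def algebra_simps)
qed

text \<open>After reflection this is the integral of F itself, integrated term by term; the factor -
  \<nu> (\<nu> + 1) makes the series telescope to the limit of k times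
  \<open>hyp_coeff \<nu> k\<close>.\<close>

lemma legM_0: "- (\<nu> * (\<nu> + 1)) * legM \<nu> 0 = rGamma (- \<nu>) * rGamma (\<nu> + 1)"
proof -
  have mono: "integral {0<..<1} (\<lambda>x. complex_of_real x ^ k * 1) = 1 / (of_nat k + 1)" for k
  proof -
    have "((\<lambda>x. complex_of_real x ^ k) has_integral
       (of_real 1 ^ Suc k / (of_nat k + 1) - of_real 0 ^ Suc k / (of_nat k + 1))) {0..1}"
    proof (rule fundamental_theorem_of_calculus)
      fix x :: real
      have nz: "(of_nat k + 1 :: complex) \<noteq> 0" by (metis of_nat_Suc of_nat_neq_0 add.commute)
      show "((\<lambda>x. complex_of_real x ^ Suc k / (of_nat k + 1)) has_vector_derivative of_real x ^ k) (at x within {0..1})"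
        using DERIV_cdivide[OF DERIV_power_Suc[OF DERIV_ident, of k "complex_of_real x"], of "of_nat k + 1"] nz
        by (intro has_vector_derivative_real_field) (simp add: add.commute)
    qed simp
    then show ?thesis by (simp add: has_integral_Icc_iff_Ioo integral_unique)
  qed
  have "(\<lambda>k. hyp_coeff \<nu> k * integral {0<..<1} (\<lambda>x. of_real x ^ k * 1))
           sums integral {0<..<1} (\<lambda>x. legF \<nu> x * 1)"
    by (rule integral_legF_mult_sums[of _ 1]) (auto simp: divide_simps)
  moreover have "integral {0<..<1} (\<lambda>x. legF \<nu> x * 1) = legM \<nu> 0"
    using integral_flip_unit_interval[of "legF \<nu>"] by (simp add: legM_def)
  ultimately have "(\<lambda>k. hyp_coeff \<nu> k * (1 / (of_nat k + 1))) sums legM \<nu> 0"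
    unfolding mono by simp
  from sums_mult[OF this, of "- (\<nu> * (\<nu> + 1))"]
  have "(\<lambda>k. of_nat (Suc k) * hyp_coeff \<nu> (Suc k) - of_nat k * hyp_coeff \<nu> k) sums (- (\<nu> * (\<nu> + 1)) * legM \<nu> 0)"
    unfolding hyp_coeff_telescope by simp
  moreover have "(\<lambda>k. of_nat (Suc k) * hyp_coeff \<nu> (Suc k) - of_nat k * hyp_coeff \<nu> k)
      sums (rGamma (- \<nu>) * rGamma (\<nu> + 1) - of_nat 0 * hyp_coeff \<nu> 0)"
    by (rule telescope_sums[OF hyp_coeff_limit])
  ultimately have "- (\<nu> * (\<nu> + 1)) * legM \<nu> 0 = rGamma (- \<nu>) * rGamma (\<nu> + 1) - of_nat 0 * hyp_coeff \<nu> 0"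
    by (rule sums_unique2)
  then show ?thesis by simp
qed

text \<open>The recurrences of the coefficients and of the moments have reciprocal factors up to a
  shift of the index, so this product does not depend on k.\<close>

lemma hyp_coeff_legM:
  "(of_nat k - \<nu>) * (of_nat k + \<nu> + 1) * (hyp_coeff \<nu> k * legM \<nu> k) = rGamma (- \<nu>) * rGamma (\<nu> + 1)"
proof (induction k)
  case 0
  then show ?case using legM_0[of \<nu>] by (simp add: algebra_simps)
next
  case (Suc k)
  have nz: "(of_nat k + 1 :: complex)\<^sup>2 \<noteq> 0" by (metis of_nat_Suc of_nat_neq_0 add.commute power_eq_0_iff)
  have "(of_nat k + 1)\<^sup>2 * ((of_nat (Suc k) - \<nu>) * (of_nat (Suc k) + \<nu> + 1) * (hyp_coeff \<nu> (Suc k) * legM \<nu> (Suc k)))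
     = ((of_nat k + 1)\<^sup>2 * hyp_coeff \<nu> (Suc k)) * ((of_nat (Suc k) - \<nu>) * (of_nat (Suc k) + \<nu> + 1) * legM \<nu> (Suc k))"
    by (simp only: mult_ac)
  also have "\<dots> = (of_nat k + 1)\<^sup>2 * ((of_nat k - \<nu>) * (of_nat k + \<nu> + 1) * (hyp_coeff \<nu> k * legM \<nu> k))"
    unfolding hyp_coeff_Suc legM_Suc by (simp only: mult_ac)
  finally show ?case using nz Suc.IH by simp
qed

text \<open>The derivative of the reflection formula for \<open>rGamma\<close>, read in two ways.
  Keeping the \<open>rGamma\<close> factors gives a cosine instead of a cotangent, and these factors
  are exactly the constant in \<open>hyp_coeff_legM\<close>.\<close>

lemma Digamma_reflection:
  fixes z :: complex
  assumes "z \<notin> \<int>"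
  shows "rGamma z * rGamma (1 - z) * (Digamma (1 - z) - Digamma z) = cos (of_real pi * z)"
proof -
  have z: "z \<notin> \<int>\<^sub>\<le>\<^sub>0" "1 - z \<notin> \<int>\<^sub>\<le>\<^sub>0"
    using assms by (auto dest: nonpos_Ints_Int)
  have 1: "((\<lambda>z. rGamma z * rGamma (1 - z)) has_field_derivative
      (- rGamma z * Digamma z) * rGamma (1 - z) + (- rGamma (1 - z) * Digamma (1 - z) * (- 1)) * rGamma z) (at z)"
    by (intro DERIV_mult has_field_derivative_rGamma_no_nonpos_int z
          DERIV_chain2[OF has_field_derivative_rGamma_no_nonpos_int])
       (auto intro!: derivative_eq_intros)
  have "((\<lambda>z. sin (of_real pi * z) / of_real pi) has_field_derivative cos (of_real pi * z)) (at z)"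
    by (auto intro!: derivative_eq_intros)
  then have 2: "((\<lambda>z. rGamma z * rGamma (1 - z)) has_field_derivative cos (of_real pi * z)) (at z)"
    unfolding rGamma_reflection_complex .
  from DERIV_unique[OF 1 2] show ?thesis by (simp add: algebra_simps)
qed

lemma legI_0:
  assumes "\<nu> \<notin> \<int>"
  shows "(2 * \<nu> + 1) * legI \<nu> 0 = cos (of_real pi * \<nu>)"
proof -
  obtain C where C [rule_format]: "C > 0" "\<forall>x. 0 < x \<longrightarrow> x < 1 \<longrightarrow> norm (legF \<nu> (1 - x)) \<le> C / sqrt x"
    by (rule legF_product_bounds[of \<nu>]) (rule that; assumption)
  define c where "c = rGamma (- \<nu>) * rGamma (\<nu> + 1)"
  have nz: "of_nat k - \<nu> \<noteq> 0" "of_nat k + \<nu> + 1 \<noteq> 0" for k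
  proof -
    show "of_nat k - \<nu> \<noteq> 0" using assms by auto
    have "\<nu> = of_int (- int k - 1)" if "of_nat k + \<nu> + 1 = 0"
    proof -
      have "\<nu> = - of_nat k - 1" using that by algebra
      then show ?thesis by simp
    qed
    then show "of_nat k + \<nu> + 1 \<noteq> 0" using assms by (metis Ints_of_int)
  qed
  have "(\<lambda>k. hyp_coeff \<nu> k * legM \<nu> k) sums legI \<nu> 0"
    using integral_legF_mult_sums[OF continuous_on_legF_flip C(2)] by (simp add: legM_def legI_def)
  then have "(\<lambda>k. (2 * \<nu> + 1) * (hyp_coeff \<nu> k * legM \<nu> k)) sums ((2 * \<nu> + 1) * legI \<nu> 0)"
    by (rule sums_mult)
  \<comment> \<open>Partial fractions give 1/(k - \<nu>) - 1/(k + \<nu> + 1). Inserting 1/(k + 1)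
    twice makes each half a convergent Digamma series.\<close>
  moreover have "(2 * \<nu> + 1) * (hyp_coeff \<nu> k * legM \<nu> k) =
      c * ((inverse (of_nat (Suc k)) - inverse (\<nu> + 1 + of_nat k)) - (inverse (of_nat (Suc k)) - inverse (- \<nu> + of_nat k)))" for k
  proof -
    have "hyp_coeff \<nu> k * legM \<nu> k = c / ((of_nat k - \<nu>) * (of_nat k + \<nu> + 1))"
      using hyp_coeff_legM[of k \<nu>] nz[of k]
      by (metis c_def mult_eq_0_iff nonzero_mult_div_cancel_left)
    moreover have "inverse (- \<nu> + of_nat k) - inverse (\<nu> + 1 + of_nat k) = (2 * \<nu> + 1) / ((of_nat k - \<nu>) * (of_nat k + \<nu> + 1))"
    proof -
      have e: "- \<nu> + of_nat k = of_nat k - \<nu>" "\<nu> + 1 + of_nat k = of_nat k + \<nu> + 1" by simp_all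
      show ?thesis unfolding e using nz[of k] by (simp add: divide_simps) (simp add: algebra_simps)?
    qed
    ultimately show ?thesis by (simp add: mult.commute)
  qed
  moreover have "(\<lambda>k. c * ((inverse (of_nat (Suc k)) - inverse (\<nu> + 1 + of_nat k)) - (inverse (of_nat (Suc k)) - inverse (- \<nu> + of_nat k))))
      sums (c * ((Digamma (\<nu> + 1) + euler_mascheroni) - (Digamma (- \<nu>) + euler_mascheroni)))"
    unfolding Digamma_def diff_add_cancel using nz[of 0]
    by (intro sums_mult sums_diff summable_sums summable_Digamma) auto
  ultimately have "(2 * \<nu> + 1) * legI \<nu> 0 = c * (Digamma (\<nu> + 1) - Digamma (- \<nu>))"
    using sums_unique2 by fastforce
  also have "\<dots> = cos (of_real pi * \<nu>)"
    using Digamma_reflection[of "- \<nu>"] assms by (simp add: c_def add.commute)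
  finally show ?thesis .
qed

text \<open>With the entire function \<open>rGamma\<close> the denominators turn into factors
  without poles, so continuity in \<nu> has to respect only the poles of the two numerator
  Gammas.\<close>

lemma expansion_coeff_formula_rGamma:
  "expansion_coeff_formula \<nu> m = - (sin (of_real pi * \<nu>) / 2) * (of_real (cbin m))\<^sup>2 * of_nat (4 * m + 1)
     * (Gamma (of_nat m - \<nu>) * Gamma (of_nat m + \<nu> + 1)) *
     (rGamma (of_nat m - \<nu> + 1 / 2) * rGamma (of_nat m + \<nu> + 3 / 2))"
proof -
  have "a / (b * c) = a * (inverse b * inverse c)" for a b c :: complex
    by (simp add: divide_inverse)
  moreover have "1 / 4 ^ m * complex_of_nat ((2 * m) choose m) = of_real (cbin m)"
    by (simp add: cbin_def)
  ultimately show ?thesis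
    unfolding expansion_coeff_formula_def rGamma_inverse_Gamma by (simp only: mult_ac)
qed

text \<open>Two reflections: the one at - \<nu> cancels the sine in front, the one at \<nu> + 1/2
  produces the cosine. The factor 2 \<nu> + 1 comes from shifting \<nu> + 3/2 to \<nu> +
  1/2.\<close>

lemma expansion_coeff_formula_0:
  assumes "2 * \<nu> \<notin> \<int>"
  shows "(2 * \<nu> + 1) * expansion_coeff_formula \<nu> 0 = cos (of_real pi * \<nu>)"
proof -
  have \<nu>: "\<nu> \<notin> \<int>" using assms by (metis Ints_mult Ints_numeral)
  have s: "sin (of_real pi * \<nu>) \<noteq> 0"
    using \<nu> by (auto simp: sin_eq_0 Ints_def)
  have 1: "Gamma (- \<nu>) * Gamma (\<nu> + 1) = - of_real pi / sin (of_real pi * \<nu>)"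
    using Gamma_reflection_complex[of "- \<nu>"] by (simp add: add.commute)
  have 2: "rGamma (- \<nu> + 1 / 2) * rGamma (\<nu> + 1 / 2) = cos (of_real pi * \<nu>) / of_real pi"
  proof -
    have "of_real pi * (\<nu> + 1 / 2) = of_real pi * \<nu> + of_real (pi / 2)" by (simp add: algebra_simps)
    then have "sin (of_real pi * (\<nu> + 1 / 2)) = cos (of_real pi * \<nu>)"
      by (simp only: sin_add sin_of_real cos_of_real) simp
    then show ?thesis using rGamma_reflection_complex[of "\<nu> + 1 / 2"] by (simp add: algebra_simps)
  qed
  have 3: "(\<nu> + 1 / 2) * rGamma (\<nu> + 3 / 2) = rGamma (\<nu> + 1 / 2)"
    using rGamma_plus1[of "\<nu> + 1 / 2"] by (simp add: add.assoc)
  have "expansion_coeff_formula \<nu> 0 = - (sin (of_real pi * \<nu>) / 2) * ((Gamma (- \<nu>) * Gamma (\<nu> + 1)) *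
      (rGamma (- \<nu> + 1 / 2) * rGamma (\<nu> + 3 / 2)))"
    using expansion_coeff_formula_rGamma[of \<nu> 0] by simp
  also have "\<dots> = of_real pi / 2 * (rGamma (- \<nu> + 1 / 2) * rGamma (\<nu> + 3 / 2))"
    unfolding 1 using s by simp
  finally have "(2 * \<nu> + 1) * expansion_coeff_formula \<nu> 0
      = of_real pi * (rGamma (- \<nu> + 1 / 2) * ((\<nu> + 1 / 2) * rGamma (\<nu> + 3 / 2)))"
    by (simp add: algebra_simps)
  also have "\<dots> = cos (of_real pi * \<nu>)" unfolding 3 2 by simp
  finally show ?thesis .
qed

lemma not_nonpos_Ints_of_not_Int:
  fixes \<nu> :: complex
  assumes "\<nu> \<notin> \<int>"
  shows "of_nat m - \<nu> \<notin> \<int>\<^sub>\<le>\<^sub>0" "of_nat m + \<nu> + 1 \<notin> \<int>\<^sub>\<le>\<^sub>0"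
proof -
  have "of_nat m - \<nu> \<notin> \<int>" using assms by (metis Ints_diff Ints_of_nat diff_diff_eq2 add_diff_cancel_left')
  then show "of_nat m - \<nu> \<notin> \<int>\<^sub>\<le>\<^sub>0" by (auto dest: nonpos_Ints_Int)
  have "of_nat m + \<nu> + 1 \<notin> \<int>" using assms
    by (metis Ints_1 Ints_diff Ints_of_nat add.commute add_diff_cancel_right')
  then show "of_nat m + \<nu> + 1 \<notin> \<int>\<^sub>\<le>\<^sub>0" by (auto dest: nonpos_Ints_Int)
qed

lemma expansion_coeff_formula_Suc:
  assumes "\<nu> \<notin> \<int>"
  shows "of_nat (4 * m + 1) * ((of_nat m + 1)\<^sup>2 * ((of_nat m - \<nu> + 1 / 2) * (of_nat m + \<nu> + 3 / 2))
             * expansion_coeff_formula \<nu> (Suc m))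
       = of_nat (4 * m + 5) * ((of_nat m + 1 / 2)\<^sup>2 * ((of_nat m - \<nu>) * (of_nat m + \<nu> + 1))
             * expansion_coeff_formula \<nu> m)"
proof -
  note np = not_nonpos_Ints_of_not_Int[OF assms, of m]
  define G1 G2 r1 r2 where defs: "G1 = Gamma (of_nat m - \<nu>)" "G2 = Gamma (of_nat m + \<nu> + 1)"
     "r1 = rGamma (of_nat (Suc m) - \<nu> + 1 / 2)" "r2 = rGamma (of_nat (Suc m) + \<nu> + 3 / 2)"
  have 1: "Gamma (of_nat (Suc m) - \<nu>) = (of_nat m - \<nu>) * G1"
    using Gamma_plus1[OF np(1)] by (simp add: defs algebra_simps)
  have 2: "Gamma (of_nat (Suc m) + \<nu> + 1) = (of_nat m + \<nu> + 1) * G2"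
    using Gamma_plus1[OF np(2)] by (simp add: defs algebra_simps)
  have 3: "rGamma (of_nat m - \<nu> + 1 / 2) = (of_nat m - \<nu> + 1 / 2) * r1"
    using rGamma_plus1[of "of_nat m - \<nu> + 1 / 2"] by (simp add: defs algebra_simps)
  have 4: "rGamma (of_nat m + \<nu> + 3 / 2) = (of_nat m + \<nu> + 3 / 2) * r2"
    using rGamma_plus1[of "of_nat m + \<nu> + 3 / 2"] by (simp add: defs algebra_simps)
  have 5: "(of_nat m + 1) * complex_of_real (cbin (Suc m)) = (of_nat m + 1 / 2) * of_real (cbin m)"
  proof -
    have "(real m + 1) * cbin (Suc m) = (real m + 1 / 2) * cbin m"
      unfolding cbin_Suc by (simp add: divide_simps) (simp add: algebra_simps)
    from arg_cong[OF this, of complex_of_real] show ?thesis by simp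
  qed
  have E: "(of_nat m + 1)\<^sup>2 * (complex_of_real (cbin (Suc m)))\<^sup>2 = (of_nat m + 1 / 2)\<^sup>2 * (of_real (cbin m))\<^sup>2"
    using 5 by (metis power_mult_distrib)
  have gen: "p * ((a * (d1 * d2)) * (s * c1 * p' * (x * G1 * (y * G2)) * (r1 * r2)))
      = p' * ((b * (x * y)) * (s * c0 * p * (G1 * G2) * (d1 * r1 * (d2 * r2))))"
    if "a * c1 = b * c0" for p p' a b d1 d2 s c0 c1 x y :: complex
  proof -
    have "p * ((a * (d1 * d2)) * (s * c1 * p' * (x * G1 * (y * G2)) * (r1 * r2)))
       = (a * c1) * (p * d1 * d2 * s * p' * x * G1 * y * G2 * r1 * r2)" by (simp only: mult_ac)
    also have "\<dots> = p' * ((b * (x * y)) * (s * c0 * p * (G1 * G2) * (d1 * r1 * (d2 * r2))))"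
      unfolding that by (simp only: mult_ac)
    finally show ?thesis .
  qed
  have n5: "4 * Suc m + 1 = 4 * m + 5" by simp
  show ?thesis
    unfolding expansion_coeff_formula_rGamma 1 2 3 4 n5 defs(1,2)[symmetric] defs(3,4)[symmetric]
    by (rule gen[OF E])
qed

text \<open>Both sides share the initial value and the recurrence. The hypothesis keeps 2 \<nu> + 1
  and the leading factor \<open>W\<close> away from 0 and the numerator Gammas away from their
  poles.\<close>

lemma expansion_coeff_formula_legI:
  assumes "2 * \<nu> \<notin> \<int>"
  shows "of_nat (4 * m + 1) * legI \<nu> (2 * m) = expansion_coeff_formula \<nu> m"
proof (induction m)
  case 0
  have \<nu>: "\<nu> \<notin> \<int>" using assms by (metis Ints_mult Ints_numeral)
  have "2 * \<nu> + 1 \<noteq> 0" using assms by (metis Ints_1 Ints_minus add_eq_0_iff2)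
  then show ?case using legI_0[OF \<nu>] expansion_coeff_formula_0[OF assms]
    by (metis mult_cancel_left mult_1 add_0 mult_zero_right of_nat_1)
next
  case (Suc m)
  have \<nu>: "\<nu> \<notin> \<int>" using assms by (metis Ints_mult Ints_numeral)
  define N :: complex where "N = of_nat m"
  define I0 I1 where "I0 = legI \<nu> (2 * m)" and "I1 = legI \<nu> (2 * Suc m)"
  define e0 e1 where "e0 = expansion_coeff_formula \<nu> m" and "e1 = expansion_coeff_formula \<nu> (Suc m)"
  have nz1: "(N + 1)\<^sup>2 \<noteq> 0" by (metis N_def of_nat_Suc of_nat_neq_0 add.commute power_eq_0_iff)
  have nz4: "4 * N + 1 \<noteq> 0"
    using of_nat_neq_0[of "4 * m", where ?'a = complex] by (simp add: N_def add.commute)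
  have nz2: "N - \<nu> + 1 / 2 \<noteq> 0"
  proof
    assume "N - \<nu> + 1 / 2 = 0"
    then have "2 * (N - \<nu> + 1 / 2) = 0" by simp
    then have "2 * \<nu> = 2 * N + 1" by (simp add: algebra_simps)
    then have "2 * \<nu> = of_nat (2 * m + 1)" by (simp add: N_def)
    then show False using assms by (metis Ints_of_nat)
  qed
  have nz3: "N + \<nu> + 3 / 2 \<noteq> 0"
  proof
    assume "N + \<nu> + 3 / 2 = 0"
    then have "2 * (N + \<nu> + 3 / 2) = 0" by simp
    then have "2 * N + 2 * \<nu> + 3 = 0" by (simp add: algebra_simps)
    then have "2 * \<nu> = - (2 * N + 3)" by algebra
    then have "2 * \<nu> = - of_nat (2 * m + 3)" by (simp add: N_def)
    then show False using assms by (metis Ints_of_nat Ints_minus)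
  qed
  define W Z where "W = (N + 1)\<^sup>2 * ((N - \<nu> + 1 / 2) * (N + \<nu> + 3 / 2))"
    and "Z = (N + 1 / 2)\<^sup>2 * ((N - \<nu>) * (N + \<nu> + 1))"
  have 1: "W * I1 = Z * I0"
  proof -
    \<comment> \<open>At even degree n = 2 m each side of \<open>legI_recurrence\<close> contributes
      4 from the square and 4 from the quadratic factor.\<close>
    have A: "(2 * N + 2)\<^sup>2 * ((2 * N + 1) * (2 * N + 3) - 4 * (\<nu> * (\<nu> + 1))) = 16 * W"
      unfolding W_def by (simp add: field_simps power2_eq_square)
    have B: "(2 * N + 1)\<^sup>2 * (2 * N * (2 * N + 2) - 4 * (\<nu> * (\<nu> + 1))) = 16 * Z"
      unfolding Z_def by (simp add: field_simps power2_eq_square)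
    have "(2 * N + 2)\<^sup>2 * ((2 * N + 1) * (2 * N + 3) - 4 * (\<nu> * (\<nu> + 1))) * I1
       = (2 * N + 1)\<^sup>2 * (2 * N * (2 * N + 2) - 4 * (\<nu> * (\<nu> + 1))) * I0"
      using legI_recurrence[of "2 * m" \<nu>] by (simp add: I0_def I1_def N_def)
    then show ?thesis unfolding A B mult.assoc[of 16] by simp
  qed
  have 2: "(4 * N + 1) * (W * e1) = (4 * N + 5) * (Z * e0)"
    using expansion_coeff_formula_Suc[OF \<nu>, of m]
    by (simp add: W_def Z_def N_def e0_def e1_def add.commute)
  have 3: "(4 * N + 1) * I0 = e0" using Suc.IH by (simp add: I0_def e0_def N_def add.commute)
  have "(4 * N + 1) * (W * e1) = (4 * N + 1) * ((4 * N + 5) * (Z * I0))"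
    unfolding 2 3[symmetric] by (simp only: mult_ac)
  also have "\<dots> = (4 * N + 1) * (W * ((4 * N + 5) * I1))"
    unfolding 1[symmetric] by (simp only: mult_ac)
  finally have "e1 = (4 * N + 5) * I1"
    using nz1 nz2 nz3 nz4 by (simp only: W_def mult_cancel_left mult_eq_0_iff simp_thms)
  then show ?case by (simp add: e1_def I1_def N_def add.commute)
qed

section \<open>Continuity and asymptotics of the coefficients\<close>

lemma hyp_coeff_tendsto:
  assumes "(f \<longlongrightarrow> \<nu>) F"
  shows "((\<lambda>j. hyp_coeff (f j) k) \<longlongrightarrow> hyp_coeff \<nu> k) F"
  unfolding hyp_coeff_pochhammer pochhammer_prod by (intro tendsto_intros assms) simp

lemma legF_tendsto:
  assumes X: "X \<longlonglongrightarrow> \<nu>" and \<Lambda>: "\<And>j. norm (X j * (X j + 1)) \<le> \<Lambda>" and x: "0 < x" "x < 1"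
  shows "(\<lambda>j. legF (X j) x) \<longlonglongrightarrow> legF \<nu> x"
proof -
  obtain C where C: "C > 0" "\<And>\<nu> k. norm (\<nu> * (\<nu> + 1)) \<le> \<Lambda> \<Longrightarrow> norm (hyp_coeff \<nu> k) \<le> C * cbin k"
    using hyp_coeff_bound by blast
  have sm: "summable (\<lambda>k. C * (cbin k * x ^ k))"
    using cbin_power_series[of x] x by (intro summable_mult sums_summable) auto
  have "norm (hyp_coeff (X j) k * of_real x ^ k) \<le> C * (cbin k * x ^ k)" for j k
    using C(2)[OF \<Lambda>[of j], of k] x by (simp add: norm_mult norm_power mult.assoc[symmetric] mult_right_mono)
  then have ev: "\<forall>\<^sub>F (k, j) in at_top \<times>\<^sub>F sequentially. norm (hyp_coeff (X j) k * of_real x ^ k) \<le> C * (cbin k * x ^ k)"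
    by (intro always_eventually) auto
  have "(\<lambda>j. \<Sum>k. hyp_coeff (X j) k * of_real x ^ k) \<longlonglongrightarrow> (\<Sum>k. hyp_coeff \<nu> k * of_real x ^ k)"
    by (rule tannerys_theorem[OF _ ev sm, THEN conjunct2, THEN conjunct2])
       (auto intro!: tendsto_mult hyp_coeff_tendsto X)
  then show ?thesis by (simp add: legF_eq_suminf)
qed

text \<open>Along a convergent sequence of parameters \<nu> (\<nu> + 1) stays bounded, so the bounds
  of \<open>legFH_bounds\<close> hold with a single constant and dominated convergence
  applies.\<close>

lemma isCont_legI: "isCont (\<lambda>\<nu>. legI \<nu> n) \<nu>"
  unfolding continuous_at_sequentially
proof (intro allI impI)
  fix X assume X: "X \<longlonglongrightarrow> \<nu>"
  have "(\<lambda>j. X j * (X j + 1)) \<longlonglongrightarrow> \<nu> * (\<nu> + 1)"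
    by (intro tendsto_intros X)
  then have "Bseq (\<lambda>j. X j * (X j + 1))"
    by (intro convergent_imp_Bseq convergentI)
  then obtain \<Lambda> where \<Lambda>: "\<And>j. norm (X j * (X j + 1)) \<le> \<Lambda>"
    by (auto simp: Bseq_def)
  obtain C where C [rule_format]: "C > 0" 
    "\<forall>\<nu> k. norm (\<nu> * (\<nu> + 1)) \<le> \<Lambda> \<longrightarrow> norm (hyp_coeff \<nu> k) \<le> C * cbin k"
    "\<forall>\<nu> N x. norm (\<nu> * (\<nu> + 1)) \<le> \<Lambda> \<longrightarrow> 0 \<le> x \<longrightarrow> x < 1 \<longrightarrow>
        norm (\<Sum>k<N. hyp_coeff \<nu> k * of_real x ^ k) \<le> C / sqrt (1 - x)"
    "\<forall>\<nu> x. norm (\<nu> * (\<nu> + 1)) \<le> \<Lambda> \<longrightarrow> 0 \<le> x \<longrightarrow> x < 1 \<longrightarrow> norm (legF \<nu> x) \<le> C / sqrt (1 - x)"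
    by (rule legFH_bounds[of \<Lambda>]) (rule that; assumption)
  obtain A where A [rule_format]: "A > 0" "\<forall>x. 0 \<le> x \<longrightarrow> x \<le> 1 \<longrightarrow> \<bar>legendre_P n (2 * x - 1)\<bar> \<le> A"
    by (rule legendre_P_bounded[of n]) (rule that; assumption)
  have "(\<lambda>j. legI (X j) n) \<longlonglongrightarrow> legI \<nu> n"
    unfolding legI_def
  proof (rule weight_dominated_convergence)
    fix j and x :: real assume x: "0 < x" "x < 1"
    have "norm (legF (X j) x * legF (X j) (1 - x) * of_real (legendre_P n (2 * x - 1)))
        \<le> C / sqrt (1 - x) * (C / sqrt x) * A"
      unfolding norm_mult using x C(1) C(4)[OF \<Lambda>, of x j] C(4)[OF \<Lambda>, of "1 - x" j] A(2)[of x]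
      by (intro mult_mono) auto
    then show "norm (legF (X j) x * legF (X j) (1 - x) * of_real (legendre_P n (2 * x - 1)))
        \<le> C * C * A / sqrt (x * (1 - x))" by (simp add: real_sqrt_mult mult_ac)
  next
    fix x :: real assume x: "0 < x" "x < 1"
    show "(\<lambda>j. legF (X j) x * legF (X j) (1 - x) * of_real (legendre_P n (2 * x - 1)))
       \<longlonglongrightarrow> legF \<nu> x * legF \<nu> (1 - x) * of_real (legendre_P n (2 * x - 1))"
      using x by (intro tendsto_mult tendsto_const legF_tendsto[OF X \<Lambda>]) auto
  qed (intro continuous_intros continuous_on_legF continuous_on_legF_flip)
  then show "((\<lambda>\<nu>. legI \<nu> n) \<circ> X) \<longlonglongrightarrow> legI \<nu> n" by (simp add: o_def)
qed

lemma eventually_double_not_Int: "\<forall>\<^sub>F \<mu> in at \<nu>. 2 * \<mu> \<notin> (\<int> :: complex set)"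
proof -
  have "((\<lambda>\<mu>. 2 * \<mu>) \<longlongrightarrow> 2 * \<nu>) (at \<nu>)" by (intro tendsto_intros)
  moreover have "open (- (\<int> - {2 * \<nu>}))" using closed_subset_Ints[of "\<int> - {2 * \<nu>}"] by (intro open_Compl) auto
  ultimately have "\<forall>\<^sub>F \<mu> in at \<nu>. 2 * \<mu> \<in> - (\<int> - {2 * \<nu>})"
    by (rule topological_tendstoD) simp
  then show ?thesis
    using eventually_neq_at_within[of \<nu> \<nu> UNIV] by eventually_elim auto
qed

text \<open>Parameters with 2 \<mu> not an integer fill a punctured neighbourhood of every \<nu>, so
  continuity of \<open>legI\<close> gives the limit of the formula at \<nu>. In the indeterminate
  case that limit is the coefficient by definition.\<close>

lemma expansion_coeff_legI: "of_nat (4 * m + 1) * legI \<nu> (2 * m) = expansion_coeff \<nu> m"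
proof -
  have "((\<lambda>\<mu>. of_nat (4 * m + 1) * legI \<mu> (2 * m)) \<longlongrightarrow> of_nat (4 * m + 1) * legI \<nu> (2 * m)) (at \<nu>)"
    using isCont_legI[where n = "2 * m" and \<nu> = \<nu>] by (intro tendsto_intros) (simp add: isCont_def)
  moreover have "\<forall>\<^sub>F \<mu> in at \<nu>. of_nat (4 * m + 1) * legI \<mu> (2 * m) = expansion_coeff_formula \<mu> m"
    using eventually_double_not_Int[of \<nu>] by eventually_elim (rule expansion_coeff_formula_legI)
  ultimately have lim: "((\<lambda>\<mu>. expansion_coeff_formula \<mu> m) \<longlongrightarrow> of_nat (4 * m + 1) * legI \<nu> (2 * m)) (at \<nu>)"
    by (rule Lim_transform_eventually)
  show ?thesis
  proof (cases "of_nat m - \<nu> \<in> \<int>\<^sub>\<le>\<^sub>0 \<or> of_nat m + \<nu> + 1 \<in> \<int>\<^sub>\<le>\<^sub>0")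
    case True
    then show ?thesis using tendsto_Lim[OF _ lim] by (simp add: expansion_coeff_def)
  next
    \<comment> \<open>This covers the half-integers, which the generic identity leaves out: the
      formula is continuous there and so equals its own limit.\<close>
    case False
    have "((\<lambda>\<mu>. expansion_coeff_formula \<mu> m) \<longlongrightarrow> expansion_coeff_formula \<nu> m) (at \<nu>)"
      unfolding expansion_coeff_formula_rGamma
      using False by (intro tendsto_intros isCont_tendsto_compose[of _ rGamma] DERIV_isCont[OF has_field_derivative_rGamma]) auto
    then show ?thesis
      using tendsto_unique[OF _ lim] False by (auto simp: expansion_coeff_def)
  qed
qed

text \<open>That is, Gamma (z + m) is asymptotic to m^z Gamma (m), also when z is a pole. Away from
  the poles this is Euler's limit for \<open>rGamma\<close>; otherwise z is shifted by 1 often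
  enough, each shift costing a factor m / (z + m) that tends to 1. The induction variable
  \<open>M\<close> counts the shifts.\<close>

lemma Gamma_ratio_tendsto_1:
  fixes z :: complex
  shows "(\<lambda>m. Gamma (z + of_nat m) / (exp (z * of_real (ln (real m))) * Gamma (of_nat m))) \<longlonglongrightarrow> 1"
proof -
  define R where "R = (\<lambda>z m. Gamma (z + of_nat m) / (exp (z * of_real (ln (real m))) * Gamma (of_nat m :: complex)))"
  have ratio: "(\<lambda>m. of_nat m / (z + of_nat m)) \<longlonglongrightarrow> 1" for z :: complex
  proof -
    have "(\<lambda>m. 1 / (z * inverse (of_nat m) + 1)) \<longlonglongrightarrow> 1 / (z * 0 + 1)"
      by (intro tendsto_intros lim_inverse_n) auto
    moreover have "\<forall>\<^sub>F m in sequentially. 1 / (z * inverse (of_nat m) + 1) = of_nat m / (z + of_nat m)"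
      using eventually_gt_at_top[of 0] by eventually_elim (auto simp: divide_simps)
    ultimately show ?thesis using Lim_transform_eventually by fastforce
  qed
  have "R z \<longlonglongrightarrow> 1" if "z + of_nat M \<notin> \<int>\<^sub>\<le>\<^sub>0" for M z
    using that
  proof (induction M arbitrary: z)
    case 0
    then have z: "z \<notin> \<int>\<^sub>\<le>\<^sub>0" by simp
    have "(\<lambda>m. Gamma z * rGamma_series z m * (of_nat m / (z + of_nat m))) \<longlonglongrightarrow> Gamma z * rGamma z * 1"
      by (intro tendsto_mult tendsto_const rGamma_series_LIMSEQ ratio)
    moreover have "Gamma z * rGamma z * 1 = 1"
      using z by (simp add: rGamma_inverse_Gamma Gamma_eq_zero_iff)
    moreover have "\<forall>\<^sub>F m in sequentially. Gamma z * rGamma_series z m * (of_nat m / (z + of_nat m)) = R z m"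
      using eventually_gt_at_top[of 0]
    proof eventually_elim
      case (elim m)
      have "z + of_nat m \<noteq> 0" using z by (auto simp: add_eq_0_iff2)
      moreover have "Gamma (z + of_nat m) = Gamma z * pochhammer z m"
        using pochhammer_Gamma[OF z, of m] z by (simp add: Gamma_eq_zero_iff)
      moreover have "fact m = of_nat m * Gamma (of_nat m :: complex)"
        using elim Gamma_fact[of "m - 1", where ?'a = complex] by (cases m) (auto simp: algebra_simps)
      ultimately show ?case
        using elim by (simp add: R_def rGamma_series_def pochhammer_Suc divide_simps)
    qed
    ultimately show ?case using Lim_transform_eventually by fastforce
  next
    case (Suc M)
    then have IH: "R (z + 1) \<longlonglongrightarrow> 1" by (simp add: add_ac)
    have "(\<lambda>m. R (z + 1) m * (of_nat m / (z + of_nat m))) \<longlonglongrightarrow> 1 * 1"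
      by (intro tendsto_mult IH ratio)
    moreover obtain K :: nat where K: "norm z < real K" using reals_Archimedean2 by blast
    have "\<forall>\<^sub>F m in sequentially. R (z + 1) m * (of_nat m / (z + of_nat m)) = R z m"
      using eventually_gt_at_top[of K]
    proof eventually_elim
      case (elim m)
      have np: "z + of_nat m \<notin> \<int>\<^sub>\<le>\<^sub>0"
      proof
        assume "z + of_nat m \<in> \<int>\<^sub>\<le>\<^sub>0"
        then obtain n where "z + of_nat m = - of_nat n" by (auto elim!: nonpos_Ints_cases')
        then have "Re (z + of_nat m) = - real n" by (simp only: uminus_complex.sel) simp
        then show False using abs_Re_le_cmod[of z] K elim by simp
      qed
      then have nz: "z + of_nat m \<noteq> 0" by auto
      have e: "exp ((z + 1) * of_real (ln (real m))) = exp (z * of_real (ln (real m))) * of_nat m"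
        using elim K by (simp add: ring_distribs exp_add exp_of_real)
      have "Gamma (z + 1 + of_nat m) = (z + of_nat m) * Gamma (z + of_nat m)"
        using Gamma_plus1[OF np] by (simp add: add_ac)
      then show ?case using nz elim unfolding R_def e by simp
    qed
    ultimately show ?case using Lim_transform_eventually by fastforce
  qed
  moreover obtain M :: nat where M: "norm z < real M" using reals_Archimedean2 by blast
  have "z + of_nat M \<notin> \<int>\<^sub>\<le>\<^sub>0"
  proof
    assume "z + of_nat M \<in> \<int>\<^sub>\<le>\<^sub>0"
    then obtain n where "z + of_nat M = - of_nat n" by (auto elim!: nonpos_Ints_cases')
    then have "Re (z + of_nat M) = - real n" by (simp only: uminus_complex.sel) simp
    then show False using abs_Re_le_cmod[of z] M by simp
  qed
  ultimately show ?thesis unfolding R_def by blast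
qed

text \<open>The squared binomial factor of the expansion is itself a hypergeometric coefficient, so
  \<open>hyp_coeff_limit\<close> shows that m times its value tends to 1/pi, without Stirling's
  formula.\<close>

lemma hyp_coeff_minus_half: "hyp_coeff (- 1 / 2) k = (of_real (cbin k))\<^sup>2"
proof (induction k)
  case (Suc k)
  have nz: "(of_nat k + 1 :: complex)\<^sup>2 \<noteq> 0" by (metis of_nat_Suc of_nat_neq_0 add.commute power_eq_0_iff)
  have "(real k + 1) * cbin (Suc k) = (real k + 1 / 2) * cbin k"
    unfolding cbin_Suc by (simp add: divide_simps) (simp add: algebra_simps)
  from arg_cong[OF this, of "\<lambda>r. (complex_of_real r)\<^sup>2"]
  have "(of_nat k + 1)\<^sup>2 * (of_real (cbin (Suc k)))\<^sup>2 = (of_nat k + 1 / 2)\<^sup>2 * (complex_of_real (cbin k))\<^sup>2"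
    by (simp add: power_mult_distrib)
  also have "\<dots> = (of_nat k + 1)\<^sup>2 * hyp_coeff (- 1 / 2) (Suc k)"
    unfolding hyp_coeff_Suc Suc.IH by (simp add: power2_eq_square)
  finally show ?case using nz by simp
qed simp

text \<open>The exponents of m in the Gamma quotient add up to -1, the squared binomial is of order
  1/m and 4 m + 1 of order m, which leaves order 1/m. The existence of the limit bounds the
  coefficients; that it is not 0 forces divergence at the end points.\<close>

lemma expansion_coeff_limit:
  assumes "\<nu> \<notin> \<int>"
  obtains L where "L \<noteq> 0" "(\<lambda>m. of_nat m * expansion_coeff \<nu> m) \<longlonglongrightarrow> L"
proof
  define R where "R = (\<lambda>z m. Gamma (z + of_nat m) / (exp (z * of_real (ln (real m))) * Gamma (of_nat m :: complex)))"
  have R: "R z \<longlonglongrightarrow> 1" for z unfolding R_def by (rule Gamma_ratio_tendsto_1)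
  \<comment> \<open>The value is - 2 sin (pi \<nu>) / pi, left in the shape in which the limit rules
    deliver it.\<close>
  let ?L = "- (sin (of_real pi * \<nu>) / 2) * (rGamma (- (- 1 / 2)) * rGamma (- 1 / 2 + 1)) * (4 + 0) *
        (1 * 1 / (1 * 1))"
  have "sin (of_real pi * \<nu>) \<noteq> 0"
    using assms by (auto simp: sin_eq_0 Ints_def)
  moreover have "(1 / 2 :: complex) \<notin> \<int>\<^sub>\<le>\<^sub>0"
    by (auto elim!: nonpos_Ints_cases' simp: complex_eq_iff)
  ultimately show "?L \<noteq> 0" by (simp add: rGamma_eq_zero_iff)
  have "(\<lambda>m. - (sin (of_real pi * \<nu>) / 2) * (of_nat m * hyp_coeff (- 1 / 2) m) * (4 + inverse (of_nat m)) *
        (R (- \<nu>) m * R (\<nu> + 1) m / (R (1 / 2 - \<nu>) m * R (\<nu> + 3 / 2) m))) \<longlonglongrightarrow> ?L"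
    by (intro tendsto_intros R hyp_coeff_limit lim_inverse_n) auto
  moreover have "\<forall>\<^sub>F m in sequentially.
     - (sin (of_real pi * \<nu>) / 2) * (of_nat m * hyp_coeff (- 1 / 2) m) * (4 + inverse (of_nat m)) *
        (R (- \<nu>) m * R (\<nu> + 1) m / (R (1 / 2 - \<nu>) m * R (\<nu> + 3 / 2) m))
      = of_nat m * expansion_coeff \<nu> m"
    using eventually_gt_at_top[of 0]
  proof eventually_elim
    case (elim m)
    define E where "E = (\<lambda>z. exp (z * complex_of_real (ln (real m))))"
    define g where "g = Gamma (of_nat m :: complex)"
    have g: "g \<noteq> 0" using elim by (simp add: g_def Gamma_eq_zero_iff of_nat_in_nonpos_Ints_iff)
    have E0: "E z \<noteq> 0" for z by (simp add: E_def)
    have E1: "E (1 / 2 - \<nu>) * E (\<nu> + 3 / 2) = of_nat m * (E (- \<nu>) * E (\<nu> + 1))"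
    proof -
      have "E (1 / 2 - \<nu>) * E (\<nu> + 3 / 2) = E 2" by (simp add: E_def exp_add[symmetric] ring_distribs[symmetric])
      moreover have "E (- \<nu>) * E (\<nu> + 1) = E 1" by (simp add: E_def exp_add[symmetric] ring_distribs[symmetric])
      moreover have "E 2 = E 1 * E 1" by (simp add: E_def exp_add[symmetric])
      moreover have "E 1 = of_nat m" using elim by (simp add: E_def exp_of_real)
      ultimately show ?thesis by simp
    qed
    have "R (- \<nu>) m * R (\<nu> + 1) m / (R (1 / 2 - \<nu>) m * R (\<nu> + 3 / 2) m)
        = (Gamma (- \<nu> + of_nat m) * Gamma (\<nu> + 1 + of_nat m)) *
          (rGamma (1 / 2 - \<nu> + of_nat m) * rGamma (\<nu> + 3 / 2 + of_nat m)) *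
          ((E (1 / 2 - \<nu>) * E (\<nu> + 3 / 2)) / (E (- \<nu>) * E (\<nu> + 1)))"
    proof -
      \<comment> \<open>\<open>X\<close> or \<open>Y\<close> is 0 when a denominator Gamma is at a
        pole; division by zero then makes both sides 0.\<close>
      have gen: "A / (a * g) * (B / (b * g)) / (X / (x * g) * (Y / (y * g)))
          = (A * B) * (inverse X * inverse Y) * ((x * y) / (a * b))"
        if "a \<noteq> 0" "b \<noteq> 0" "x \<noteq> 0" "y \<noteq> 0" for A B X Y a b x y
        using g that by (cases "X = 0 \<or> Y = 0") (auto simp: field_simps)
      have R': "R z m = Gamma (z + of_nat m) / (E z * g)" for z
        by (simp add: R_def E_def g_def)
      show ?thesis unfolding R' rGamma_inverse_Gamma by (rule gen) (rule E0)+
    qed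
    moreover have "(E (1 / 2 - \<nu>) * E (\<nu> + 3 / 2)) / (E (- \<nu>) * E (\<nu> + 1)) = of_nat m"
      unfolding E1 using E0 by simp
    moreover have args: "- \<nu> + of_nat m = of_nat m - \<nu>" "\<nu> + 1 + of_nat m = of_nat m + \<nu> + 1"
      "1 / 2 - \<nu> + of_nat m = of_nat m - \<nu> + 1 / 2" "\<nu> + 3 / 2 + of_nat m = of_nat m + \<nu> + 3 / 2"
      by simp_all
    ultimately have 1: "R (- \<nu>) m * R (\<nu> + 1) m / (R (1 / 2 - \<nu>) m * R (\<nu> + 3 / 2) m)
        = (Gamma (of_nat m - \<nu>) * Gamma (of_nat m + \<nu> + 1)) *
          (rGamma (of_nat m - \<nu> + 1 / 2) * rGamma (of_nat m + \<nu> + 3 / 2)) * of_nat m"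
      by (simp only:)
    have 2: "of_nat m * (4 + inverse (of_nat m)) = (of_nat (4 * m + 1) :: complex)"
      using elim by (simp add: field_simps)
    have 3: "expansion_coeff \<nu> m = expansion_coeff_formula \<nu> m"
      using not_nonpos_Ints_of_not_Int[OF assms, of m] by (simp add: expansion_coeff_def)
    show ?case
      unfolding 1 3 hyp_coeff_minus_half expansion_coeff_formula_rGamma 2[symmetric] by (simp only: mult_ac)
  qed
  ultimately show "(\<lambda>m. of_nat m * expansion_coeff \<nu> m) \<longlonglongrightarrow> ?L"
    by (rule Lim_transform_eventually)
qed

text \<open>For m greater than the absolute value of \<nu> the numerator has no pole, so the
  vanishing sine makes the coefficient 0. Only indeterminate coefficients can survive.\<close>

lemma expansion_coeff_Int_eventually_0:
  assumes "\<nu> \<in> \<int>"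
  obtains M where "\<forall>m\<ge>M. expansion_coeff \<nu> m = 0"
proof -
  obtain k where k: "\<nu> = of_int k" using assms by (auto elim: Ints_cases)
  show ?thesis
  proof (rule that[of "nat \<bar>k\<bar> + 1"], intro allI impI)
    fix m assume m: "m \<ge> nat \<bar>k\<bar> + 1"
    have "of_nat m - \<nu> = of_int (int m - k)" "of_nat m + \<nu> + 1 = of_int (int m + k + 1)"
      by (simp_all add: k)
    then have "of_nat m - \<nu> \<notin> \<int>\<^sub>\<le>\<^sub>0" "of_nat m + \<nu> + 1 \<notin> \<int>\<^sub>\<le>\<^sub>0"
      using m by (auto simp only: of_int_in_nonpos_Ints_iff)
    moreover have "sin (of_real pi * \<nu>) = 0" using assms by (auto simp: sin_eq_0 Ints_def)
    ultimately show "expansion_coeff \<nu> m = 0"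
      by (simp add: expansion_coeff_def expansion_coeff_formula_def)
  qed
qed

lemma expansion_coeff_bound:
  obtains C where "C > 0" "\<And>m. norm (expansion_coeff \<nu> m) \<le> C / (real m + 1)"
proof -
  have "Bseq (\<lambda>m. of_nat m * expansion_coeff \<nu> m)"
  proof (cases "\<nu> \<in> \<int>")
    case True
    then obtain M where "\<forall>m\<ge>M. expansion_coeff \<nu> m = 0"
      by (rule expansion_coeff_Int_eventually_0)
    then have "\<forall>\<^sub>F m in sequentially. of_nat m * expansion_coeff \<nu> m = 0"
      by (auto simp: eventually_sequentially)
    then have "(\<lambda>m. of_nat m * expansion_coeff \<nu> m) \<longlonglongrightarrow> 0" by (rule tendsto_eventually)
    then show ?thesis by (intro convergent_imp_Bseq convergentI)
  next
    case False
    then show ?thesis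
      by (rule expansion_coeff_limit) (auto intro: convergent_imp_Bseq convergentI)
  qed
  then obtain K where K: "K > 0" "\<And>m. norm (of_nat m * expansion_coeff \<nu> m) \<le> K"
    by (auto simp: Bseq_def)
  have "norm (expansion_coeff \<nu> m) \<le> (2 * K + norm (expansion_coeff \<nu> 0)) / (real m + 1)" for m
  proof (cases "m = 0")
    case False
    then have "(real m + 1) * norm (expansion_coeff \<nu> m) \<le> 2 * real m * norm (expansion_coeff \<nu> m)"
      by (intro mult_right_mono) auto
    also have "\<dots> \<le> 2 * K" using K(2)[of m] by (simp add: norm_mult)
    finally have "(real m + 1) * norm (expansion_coeff \<nu> m) \<le> 2 * K + norm (expansion_coeff \<nu> 0)"
      by (smt (verit) norm_ge_zero)
    then show ?thesis by (simp add: pos_le_divide_eq mult.commute)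
  qed (use K in simp)
  moreover have "2 * K + norm (expansion_coeff \<nu> 0) > 0" using K(1) by (simp add: add_pos_nonneg)
  ultimately show ?thesis using that by blast
qed

text \<open>After division by \<open>c\<close> the real parts eventually exceed 1/(2 k), so they
  cannot cancel, and their sum diverges with the harmonic series. The norm of the sum is at least
  norm c times this real part.\<close>

lemma sum_at_infinity_of_harmonic_decay:
  fixes a :: "nat \<Rightarrow> complex"
  assumes "(\<lambda>k. of_nat k * a k) \<longlonglongrightarrow> c" "c \<noteq> 0"
  shows "filterlim (\<lambda>N. \<Sum>k<N. a k) at_infinity sequentially"
proof -
  have "(\<lambda>k. Re (of_nat k * a k / c)) \<longlonglongrightarrow> Re (c / c)"
    by (intro tendsto_intros assms)
  moreover have "Re (c / c) > 1 / 2" using assms(2) by simp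
  ultimately have "\<forall>\<^sub>F k in sequentially. Re (of_nat k * a k / c) > 1 / 2"
    by (rule order_tendstoD)
  then obtain K where K: "\<And>k. k \<ge> K \<Longrightarrow> Re (of_nat k * a k / c) > 1 / 2"
    by (auto simp: eventually_sequentially)
  have step: "inverse (real k) / 2 \<le> Re (a k / c)" if "k \<ge> K" for k
  proof (cases "k = 0")
    case True
    then show ?thesis using K[OF that] by simp
  next
    case False
    have "Re (of_nat k * a k / c) = real k * Re (a k / c)"
      by (metis Re_complex_of_real complex_scaleR scaleR_complex.simps(1) of_real_of_nat_eq times_divide_eq_right scaleR_conv_of_real)
    then show ?thesis using K[OF that] False by (simp add: field_simps)
  qed
  define D where "D = (\<Sum>k<K. Re (a k / c)) - (\<Sum>k<K. inverse (real k) / 2)"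
  have low: "D + (\<Sum>k<N. inverse (real k) / 2) \<le> (\<Sum>k<N. Re (a k / c))" if "N \<ge> K" for N
    using that
  proof (induction N rule: dec_induct)
    case (step n)
    then show ?case using \<open>\<And>k. K \<le> k \<Longrightarrow> inverse (real k) / 2 \<le> Re (a k / c)\<close>[of n] by simp
  qed (simp add: D_def)
  \<comment> \<open>The term k = 0 is \<open>inverse 0 = 0\<close>, so the range up to N gives
    \<open>harm N\<close> exactly.\<close>
  have harm: "(\<Sum>k<Suc N. inverse (real k) / 2) = harm N / 2" for N
    by (induction N) (auto simp: harm_Suc harm_expand add_divide_distrib)
  have "filterlim (\<lambda>N. D + harm N / 2) at_top sequentially"
    using filterlim_tendsto_add_at_top[OF tendsto_const[of D]
            filterlim_tendsto_pos_mult_at_top[OF tendsto_const[of "1 / 2"] _ harm_at_top]] by simp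
  then have "filterlim (\<lambda>N. \<Sum>k<Suc N. Re (a k / c)) at_top sequentially"
  proof (rule filterlim_at_top_mono)
    show "\<forall>\<^sub>F N in sequentially. D + harm N / 2 \<le> (\<Sum>k<Suc N. Re (a k / c))"
      using eventually_ge_at_top[of K]
    proof eventually_elim
      case (elim N)
      then show ?case using low[of "Suc N"] unfolding harm by simp
    qed
  qed
  then have 1: "filterlim (\<lambda>N. \<Sum>k<N. Re (a k / c)) at_top sequentially"
    by (rule filterlim_sequentially_Suc[THEN iffD1])
  have "filterlim (\<lambda>N. norm c * (\<Sum>k<N. Re (a k / c))) at_top sequentially"
    by (rule filterlim_tendsto_pos_mult_at_top[OF tendsto_const _ 1]) (use assms(2) in simp)
  then have "filterlim (\<lambda>N. norm (\<Sum>k<N. a k)) at_top sequentially"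
  proof (rule filterlim_at_top_mono, intro always_eventually allI)
    fix N
    have "(\<Sum>k<N. Re (a k / c)) = Re ((\<Sum>k<N. a k) / c)" by (simp add: sum_divide_distrib)
    also have "\<dots> \<le> norm ((\<Sum>k<N. a k) / c)" by (rule complex_Re_le_cmod)
    finally show "norm c * (\<Sum>k<N. Re (a k / c)) \<le> norm (\<Sum>k<N. a k)"
      using assms(2) by (simp add: norm_divide field_simps)
  qed
  then show ?thesis by (rule filterlim_norm_at_top_imp_at_infinity)
qed

section \<open>Orthogonality and completeness\<close>

lemma integrable_legendre_mult:
  assumes "continuous_on {0..1} g"
  shows "(\<lambda>x. g x * (legendre_P n (2 * x - 1) * legendre_P m (2 * x - 1)) :: real) integrable_on {0..1}"
  by (intro integrable_continuous_real continuous_intros assms)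

text \<open>Lagrange's identity for two eigenfunctions; the boundary form \<open>B\<close> vanishes
  because 1 - t^2 does at both ends.\<close>

lemma legendre_orthogonal:
  assumes "n \<noteq> m"
  shows "integral {0..1} (\<lambda>x. legendre_P n (2 * x - 1) * legendre_P m (2 * x - 1)) = 0"
proof -
  let ?P = "\<lambda>n x. legendre_P n (2 * x - 1)"
  define \<kappa> where "\<kappa> n = real n * (real n + 1)" for n
  define B where "B = (\<lambda>x. ((1 - (2 * x - 1)\<^sup>2) * legendre_P' n (2 * x - 1)) * ?P m x
       - ?P n x * ((1 - (2 * x - 1)\<^sup>2) * legendre_P' m (2 * x - 1)))"
  have "((\<lambda>x. 2 * (\<kappa> m - \<kappa> n) * (?P n x * ?P m x)) has_integral (B 1 - B 0)) {0..1}"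
  proof (rule fundamental_theorem_of_calculus)
    fix x :: real
    have "(B has_real_derivative 2 * (\<kappa> m - \<kappa> n) * (?P n x * ?P m x)) (at x within {0..1})"
      unfolding B_def
      by (rule derivative_eq_intros legendre_ode_unit refl)+ (simp add: \<kappa>_def algebra_simps)
    then show "(B has_vector_derivative 2 * (\<kappa> m - \<kappa> n) * (?P n x * ?P m x)) (at x within {0..1})"
      by (simp add: has_real_derivative_iff_has_vector_derivative)
  qed simp
  then have "integral {0..1} (\<lambda>x. 2 * (\<kappa> m - \<kappa> n) * (?P n x * ?P m x)) = B 1 - B 0"
    by (rule integral_unique)
  moreover have "B 1 - B 0 = 0" by (simp add: B_def)
  moreover have "\<kappa> m - \<kappa> n \<noteq> 0"
  proof -
    have "\<kappa> m - \<kappa> n = (real m - real n) * (real m + real n + 1)" by (simp add: \<kappa>_def algebra_simps)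
    then show ?thesis using assms by (simp add: add_nonneg_eq_0_iff)
  qed
  ultimately show ?thesis by simp
qed

text \<open>The integral of t P_n P_(n+1) is evaluated by expanding either t P_n or t P_(n+1).
  Orthogonality leaves one norm in each case, which links consecutive norms.\<close>

lemma legendre_norm:
  "integral {0..1} (\<lambda>x. legendre_P n (2 * x - 1) * legendre_P n (2 * x - 1)) = 1 / (2 * real n + 1)"
proof -
  let ?P = "\<lambda>n x. legendre_P n (2 * x - 1)"
  define J where "J = (\<lambda>n m. integral {0..1} (\<lambda>x. ?P n x * ?P m x))"
  define A where "A = (\<lambda>n m. integral {0..1} (\<lambda>x. (2 * x - 1) * (?P n x * ?P m x)))"
  have i: "(\<lambda>x. ?P n x * ?P m x) integrable_on {0..1}" for n m
    using integrable_legendre_mult[of "\<lambda>_. 1"] by simp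
  have rec: "(2 * real n + 3) * A (Suc n) k = (real n + 2) * J (Suc (Suc n)) k + (real n + 1) * J n k" for n k
  proof -
    have "(2 * real n + 3) * A (Suc n) k = integral {0..1} (\<lambda>x. (2 * real n + 3) * ((2 * x - 1) * (?P (Suc n) x * ?P k x)))"
      by (simp add: A_def)
    also have "(\<lambda>x. (2 * real n + 3) * ((2 * x - 1) * (?P (Suc n) x * ?P k x)))
        = (\<lambda>x. (real n + 2) * (?P (Suc (Suc n)) x * ?P k x) + (real n + 1) * (?P n x * ?P k x))"
    proof
      fix x
      have e: "(2 * real n + 3) * (2 * x - 1) * ?P (Suc n) x = (real n + 2) * ?P (Suc (Suc n)) x + (real n + 1) * ?P n x"
        using legendre_P_recurrence[of n "2 * x - 1"] by simp
      have "(2 * real n + 3) * ((2 * x - 1) * (?P (Suc n) x * ?P k x)) = ((2 * real n + 3) * (2 * x - 1) * ?P (Suc n) x) * ?P k x"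
        by (simp only: mult.assoc)
      then show "(2 * real n + 3) * ((2 * x - 1) * (?P (Suc n) x * ?P k x))
        = (real n + 2) * (?P (Suc (Suc n)) x * ?P k x) + (real n + 1) * (?P n x * ?P k x)"
        unfolding e by (simp only: ring_distribs mult.assoc)
    qed
    also have "integral {0..1} \<dots> = (real n + 2) * J (Suc (Suc n)) k + (real n + 1) * J n k"
      unfolding J_def by (subst integral_add) (intro integrable_on_mult_right i, intro integrable_on_mult_right i, simp)
    finally show ?thesis .
  qed
  have A_sym: "A n m = A m n" for n m unfolding A_def by (simp add: mult.commute)
  have orth: "J n m = 0" if "n \<noteq> m" for n m unfolding J_def by (rule legendre_orthogonal[OF that])
  have "J n n = 1 / (2 * real n + 1)" for n
  proof (induction n)
    case 0
    then show ?case by (simp add: J_def)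
  next
    case (Suc n)
    have a: "(2 * real n + 3) * A (Suc n) n = (real n + 1) * J n n"
      using rec[of n n] orth[of "Suc (Suc n)" n] by simp
    have b: "(2 * real n + 1) * A n (Suc n) = (real n + 1) * J (Suc n) (Suc n)"
    proof (cases n)
      case 0
      then show ?thesis by (simp add: A_def J_def legendre_P_1)
    next
      case (Suc j)
      then show ?thesis using rec[of j "Suc (Suc j)"] orth[of j "Suc (Suc j)"] by (simp add: algebra_simps)
    qed
    have "A n (Suc n) = (real n + 1) * J n n / (2 * real n + 3)"
      using a A_sym[of n "Suc n"] by (simp add: field_simps)
    then have "(real n + 1) * J (Suc n) (Suc n)
        = (2 * real n + 1) * ((real n + 1) * (1 / (2 * real n + 1)) / (2 * real n + 3))"
      unfolding b[symmetric] Suc.IH by simp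
    also have "\<dots> = (real n + 1) * (1 / (2 * real n + 3))"
      by (simp add: divide_simps)
    finally have "(real n + 1) * J (Suc n) (Suc n) = (real n + 1) * (1 / (2 * real n + 3))" .
    then have "J (Suc n) (Suc n) = 1 / (2 * real n + 3)"
      unfolding mult_cancel_left by linarith
    then show ?case by (simp add: algebra_simps)
  qed
  then show ?thesis by (simp add: J_def)
qed

lemma complex_integral_legendre_mult:
  "integral {0<..<1} (\<lambda>x. complex_of_real (legendre_P n (2 * x - 1)) * of_real (legendre_P m (2 * x - 1)))
     = (if n = m then 1 / (2 * of_nat n + 1) else 0)"
proof -
  let ?f = "\<lambda>x. legendre_P n (2 * x - 1) * legendre_P m (2 * x - 1)"
  have "?f integrable_on {0..1}" using integrable_legendre_mult[of "\<lambda>_. 1"] by simp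
  from has_integral_of_real[OF integrable_integral[OF this]]
  have "integral {0..1} (\<lambda>x. complex_of_real (?f x)) = of_real (integral {0..1} ?f)"
    by (rule integral_unique)
  also have "integral {0..1} ?f = (if n = m then 1 / (2 * real n + 1) else 0)"
    using legendre_norm legendre_orthogonal by simp
  finally show ?thesis by (simp add: integral_open_interval_real)
qed

text \<open>Uniform approximation of \<open>h\<close> by polynomials suffices although
  \<open>d\<close> may be unbounded: an error e costs at most e times the integral of the dominating
  weight.\<close>

lemma weight_dominated_zero_integral_continuous:
  fixes d :: "real \<Rightarrow> complex" and h :: "real \<Rightarrow> real"
  assumes d: "continuous_on {0<..<1} d"
    and K: "\<And>x. 0 < x \<Longrightarrow> x < 1 \<Longrightarrow> norm (d x) \<le> K / sqrt (x * (1 - x))"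
    and mom: "\<And>k. integral {0<..<1} (\<lambda>x. d x * of_real x ^ k) = 0"
    and h: "continuous_on {0..1} h"
  shows "integral {0<..<1} (\<lambda>x. d x * of_real (h x)) = 0"
proof -
  have int: "(\<lambda>x. d x * of_real (g x)) integrable_on {0<..<1}" if g: "continuous_on {0..1} g" for g
  proof -
    have "bounded (g ` {0..1})" by (intro compact_imp_bounded compact_continuous_image g) simp
    then obtain M where M: "M > 0" "\<And>x. x \<in> {0..1} \<Longrightarrow> \<bar>g x\<bar> \<le> M" by (auto simp: bounded_pos)
    show ?thesis
    proof (rule weight_dominated_integrable(2))
      show "continuous_on {0<..<1} (\<lambda>x. d x * of_real (g x))"
        by (intro continuous_intros d continuous_on_subset[OF g]) auto
      fix x :: real assume x: "0 < x" "x < 1"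
      have "norm (d x * of_real (g x)) \<le> K / sqrt (x * (1 - x)) * M"
        unfolding norm_mult using M(2)[of x] K[OF x] x order.trans[OF norm_ge_zero K[OF x]]
        by (intro mult_mono) auto
      then show "norm (d x * of_real (g x)) \<le> K * M / sqrt (x * (1 - x))" by simp
    qed
  qed
  define W where "W = integral {0<..<1} (\<lambda>x. K * (1 / sqrt (x * (1 - x))))"
  have small: "norm (integral {0<..<1} (\<lambda>x. d x * of_real (h x))) \<le> e * W" if e: "e > 0" for e
  proof -
    obtain p where p: "real_polynomial_function p" "\<And>x. x \<in> {0..1} \<Longrightarrow> \<bar>h x - p x\<bar> < e"
      using Stone_Weierstrass_real_polynomial_function[OF _ h e] by auto
    obtain a n where pn: "p = (\<lambda>x. \<Sum>i\<le>n. a i * x ^ i)"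
      using real_polynomial_function_imp_sum[OF p(1)] by blast
    have cp: "continuous_on {0..1} p" unfolding pn by (intro continuous_intros)
    have ip: "integral {0<..<1} (\<lambda>x. d x * of_real (p x)) = 0"
    proof -
      have ii: "(\<lambda>x. d x * of_real x ^ i) integrable_on {0<..<1}" for i
        using int[of "\<lambda>x. x ^ i"] by (simp add: continuous_intros)
      have "(\<lambda>x. d x * of_real (p x)) = (\<lambda>x. \<Sum>i\<le>n. of_real (a i) * (d x * of_real x ^ i))"
        by (simp add: pn sum_distrib_left mult_ac)
      then show ?thesis by (simp add: integral_sum integrable_on_mult_right ii mom)
    qed
    have "integral {0<..<1} (\<lambda>x. d x * of_real (h x))
        = integral {0<..<1} (\<lambda>x. d x * of_real (h x)) - integral {0<..<1} (\<lambda>x. d x * of_real (p x))"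
      by (simp add: ip)
    also have "\<dots> = integral {0<..<1} (\<lambda>x. d x * of_real (h x) - d x * of_real (p x))"
      by (rule integral_diff[symmetric]) (intro int h cp)+
    also have "norm \<dots> \<le> integral {0<..<1} (\<lambda>x. e * (K * (1 / sqrt (x * (1 - x)))))"
    proof (rule integral_norm_bound_integral)
      show "(\<lambda>x. d x * of_real (h x) - d x * of_real (p x)) integrable_on {0<..<1}"
        by (intro integrable_diff int h cp)
      show "(\<lambda>x. e * (K * (1 / sqrt (x * (1 - x))))) integrable_on {0<..<1}"
        by (intro integrable_on_mult_right integrable_arcsine_weight)
      fix x :: real assume x: "x \<in> {0<..<1}"
      have "norm (d x * of_real (h x) - d x * of_real (p x)) = norm (d x) * \<bar>h x - p x\<bar>"
        by (simp add: norm_mult flip: right_diff_distrib of_real_diff)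
      also have "\<dots> \<le> K / sqrt (x * (1 - x)) * e"
        using x p(2)[of x] K[of x] order.trans[OF norm_ge_zero K[of x]] by (intro mult_mono) auto
      finally show "norm (d x * of_real (h x) - d x * of_real (p x)) \<le> e * (K * (1 / sqrt (x * (1 - x))))"
        by (simp add: mult_ac)
    qed
    also have "\<dots> = e * W" unfolding W_def by (rule integral_mult_right)
    finally show ?thesis .
  qed
  have "((\<lambda>e. e * W) \<longlongrightarrow> 0 * W) (at_right 0)" by (intro tendsto_intros)
  then have "norm (integral {0<..<1} (\<lambda>x. d x * of_real (h x))) \<le> 0 * W"
    by (rule tendsto_lowerbound) (use small in \<open>auto simp: eventually_at_right_less intro!: eventually_mono[OF eventually_at_right_less]\<close>)
  then show ?thesis by simp
qed

lemma zero_if_weighted_square_integral_0: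
  fixes f :: "real \<Rightarrow> real"
  assumes f: "continuous_on {0<..<1} f"
    and int: "((\<lambda>x. x * (1 - x) * f x * f x) has_integral 0) {0<..<1}"
    and x: "0 < x" "x < 1"
  shows "f x = 0"
proof -
  let ?g = "\<lambda>x. x * (1 - x) * f x * f x"
  define a where "a = x / 2"
  define b where "b = (1 + x) / 2"
  have ab: "0 < a" "a < x" "x < b" "b < 1" using x by (auto simp: a_def b_def)
  have sub: "{a..b} \<subseteq> {0<..<1}" using ab by auto
  have nn: "0 \<le> ?g y" if "y \<in> {0<..<1}" for y
  proof -
    have "0 \<le> y * (1 - y) * (f y)\<^sup>2" using that by simp
    then show ?thesis by (simp add: power2_eq_square mult.assoc)
  qed
  have cont: "continuous_on {a..b} ?g"
    by (intro continuous_intros continuous_on_subset[OF f sub])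
  then have ig: "?g integrable_on {a..b}" by (rule integrable_continuous_real)
  have "integral {a..b} ?g \<le> integral {0<..<1} ?g"
    by (rule integral_subset_le[OF sub ig]) (use int nn in \<open>auto simp: integrable_on_def\<close>)
  also have "\<dots> = 0" using int by (rule integral_unique)
  finally have "integral {a..b} ?g = 0"
    using integral_nonneg[OF ig] nn sub by (meson order.antisym subsetD)
  then have "?g x = 0"
    using integral_eq_0_iff[OF cont] nn sub ab by auto
  then show ?thesis using x by simp
qed

text \<open>The function \<open>d\<close> may be singular at the ends, so it is tested against x (1
  - x) L(d x), with L the real or imaginary part. The factor x (1 - x) makes this continuous on the
  closed interval, and applying L leaves the integral of x (1 - x) L(d x)^2.\<close>

lemma vanishes_if_moments_vanish:
  fixes d :: "real \<Rightarrow> complex"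
  assumes d: "continuous_on {0<..<1} d"
    and K: "\<And>x. 0 < x \<Longrightarrow> x < 1 \<Longrightarrow> norm (d x) \<le> K / sqrt (x * (1 - x))"
    and mom: "\<And>k. integral {0<..<1} (\<lambda>x. d x * of_real x ^ k) = 0"
    and x: "0 < x" "x < 1"
  shows "d x = 0"
proof -
  have part: "L (d x) = 0" if L: "bounded_linear L" and nL: "\<And>z. \<bar>L z\<bar> \<le> norm z"
      and Lr: "\<And>z r. L (z * of_real r) = L z * r" for L :: "complex \<Rightarrow> real"
  proof -
    define B where "B = (\<lambda>x. x * (1 - x) * L (d x))"
    define h where "h = (\<lambda>x. if x \<in> {0<..<1} then B x else 0)"
    have cL: "continuous_on {0<..<1} (\<lambda>x. L (d x))"
      by (rule bounded_linear.continuous_on[OF L d])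
    have Kq: "norm (B x) \<le> K * sqrt (x * (1 - x))" if "0 < x" "x < 1" for x
    proof -
      have q: "0 < x * (1 - x)" using that by simp
      have "norm (B x) \<le> x * (1 - x) * (K / sqrt (x * (1 - x)))"
      proof -
        have "norm (B x) = x * (1 - x) * \<bar>L (d x)\<bar>" using that by (simp add: B_def abs_mult)
        also have "\<dots> \<le> x * (1 - x) * (K / sqrt (x * (1 - x)))"
          using q order.trans[OF nL[of "d x"] K[OF that]] by (intro mult_left_mono) auto
        finally show ?thesis .
      qed
      also have "\<dots> = K * (x * (1 - x) / sqrt (x * (1 - x)))" by simp
      also have "\<dots> = K * sqrt (x * (1 - x))" using q by (simp only: real_div_sqrt less_imp_le)
      finally show ?thesis .
    qed
    have h: "continuous_on {0..1} h"
      unfolding h_def by (rule continuous_on_extend_by_zero[OF _ Kq]) (auto simp: B_def intro!: continuous_intros cL)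
    have "bounded (h ` {0..1})" by (intro compact_imp_bounded compact_continuous_image h) simp
    then obtain M where M: "M > 0" "\<And>x. x \<in> {0..1} \<Longrightarrow> \<bar>h x\<bar> \<le> M" by (auto simp: bounded_pos)
    have "(\<lambda>x. d x * of_real (h x)) integrable_on {0<..<1}"
    proof (rule weight_dominated_integrable(2))
      show "continuous_on {0<..<1} (\<lambda>x. d x * of_real (h x))"
        by (intro continuous_intros d continuous_on_subset[OF h]) auto
      fix x :: real assume x: "0 < x" "x < 1"
      have "norm (d x * of_real (h x)) \<le> K / sqrt (x * (1 - x)) * M"
        unfolding norm_mult using M(2)[of x] K[OF x] x order.trans[OF norm_ge_zero K[OF x]]
        by (intro mult_mono) auto
      then show "norm (d x * of_real (h x)) \<le> K * M / sqrt (x * (1 - x))" by simp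
    qed
    then have "((\<lambda>x. d x * of_real (h x)) has_integral 0) {0<..<1}"
      using weight_dominated_zero_integral_continuous[OF d K mom h] by (metis integrable_integral)
    from has_integral_linear[OF this L]
    have "((\<lambda>x. L (d x) * h x) has_integral 0) {0<..<1}"
      by (simp add: o_def Lr bounded_linear.linear[OF L] linear_0)
    then have "((\<lambda>x. x * (1 - x) * L (d x) * L (d x)) has_integral 0) {0<..<1}"
      by (rule has_integral_eq[rotated]) (auto simp: h_def B_def mult_ac)
    from zero_if_weighted_square_integral_0[OF cL this x] show ?thesis .
  qed
  have "Re (d x) = 0" by (rule part[OF bounded_linear_Re]) (auto simp: abs_Re_le_cmod)
  moreover have "Im (d x) = 0" by (rule part[OF bounded_linear_Im]) (auto simp: abs_Im_le_cmod)
  ultimately show ?thesis by (simp add: complex_eq_iff)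
qed

section \<open>The expansion\<close>

lemma legI_odd: "legI \<nu> (2 * m + 1) = 0"
proof -
  let ?f = "\<lambda>x. legF \<nu> x * legF \<nu> (1 - x) * of_real (legendre_P (2 * m + 1) (2 * x - 1))"
  have "?f (1 - x) = - ?f x" for x
  proof -
    have "2 * (1 - x) - 1 = - (2 * x - 1)" by simp
    then show ?thesis by (simp only: legendre_P_minus) simp
  qed
  then have "legI \<nu> (2 * m + 1) = - legI \<nu> (2 * m + 1)"
    using integral_flip_unit_interval[of ?f] by (simp add: legI_def)
  then show ?thesis by simp
qed

lemma fourier_legendre_coeff_legI:
  "fourier_legendre_coeff (hyp2F1_product \<nu>) n = of_nat (2 * n + 1) * legI \<nu> n"
  by (simp add: fourier_legendre_coeff_def hyp2F1_product_legF legI_def integral_open_interval_real)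

lemma legendre_P_even_unit_bound:
  assumes "0 < x" "x < 1"
  shows "\<bar>legendre_P (2 * m) (2 * x - 1)\<bar> \<le> cbin m / (2 * sqrt (x * (1 - x)))"
proof -
  have "1 - (2 * x - 1)\<^sup>2 = 2\<^sup>2 * (x * (1 - x))" by (simp add: power2_eq_square algebra_simps)
  then have "sqrt (1 - (2 * x - 1)\<^sup>2) = 2 * sqrt (x * (1 - x))"
    by (simp only: real_sqrt_mult real_sqrt_abs abs_numeral)
  then show ?thesis using legendre_P_even_bound[of "2 * x - 1" m] assms by simp
qed

text \<open>The claim is strengthened to the products x^k P_n for all n, which permits induction on
  k: multiplication by x = (1 + t) / 2 turns P_n into a combination of P_(n+1), P_n and
  P_(n-1).\<close>

lemma moments_vanish_if_legendre_coeffs_vanish: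
  fixes d :: "real \<Rightarrow> complex"
  assumes d: "continuous_on {0<..<1} d"
    and K: "\<And>x. 0 < x \<Longrightarrow> x < 1 \<Longrightarrow> norm (d x) \<le> K / sqrt (x * (1 - x))"
    and leg: "\<And>n. integral {0<..<1} (\<lambda>x. d x * of_real (legendre_P n (2 * x - 1))) = 0"
  shows "integral {0<..<1} (\<lambda>x. d x * of_real x ^ k) = 0"
proof -
  let ?P = "\<lambda>n x. complex_of_real (legendre_P n (2 * x - 1))"
  have int: "(\<lambda>x. d x * (of_real x ^ k * ?P n x)) integrable_on {0<..<1}" for k n
  proof -
    obtain A where A [rule_format]: "A > 0" "\<forall>x. 0 \<le> x \<longrightarrow> x \<le> 1 \<longrightarrow> \<bar>legendre_P n (2 * x - 1)\<bar> \<le> A"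
      by (rule legendre_P_bounded[of n]) (rule that; assumption)
    show ?thesis
    proof (rule weight_dominated_integrable(2))
      show "continuous_on {0<..<1} (\<lambda>x. d x * (of_real x ^ k * ?P n x))"
        by (intro continuous_intros d)
      fix x :: real assume x: "0 < x" "x < 1"
      have "norm (d x * (of_real x ^ k * ?P n x)) \<le> K / sqrt (x * (1 - x)) * (1 * A)"
        unfolding norm_mult using A(2)[of x] K[OF x] x order.trans[OF norm_ge_zero K[OF x]]
        by (intro mult_mono) (auto simp: norm_power power_le_one)
      then show "norm (d x * (of_real x ^ k * ?P n x)) \<le> K * A / sqrt (x * (1 - x))" by simp
    qed
  qed
  define Q where "Q = (\<lambda>k n. integral {0<..<1} (\<lambda>x. d x * (of_real x ^ k * ?P n x)))"
  have "\<forall>n. Q k n = 0"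
  proof (induction k)
    case 0
    then show ?case using leg by (simp add: Q_def)
  next
    case (Suc k)
    \<comment> \<open>The index \<open>m\<close> stands for n - 1; for n = 0 it is a dummy with
      coefficient 0.\<close>
    have lin: "Q (Suc k) n = a * Q k (Suc n) + b * Q k n + c * Q k m"
      if "\<And>x. of_real x * ?P n x = a * ?P (Suc n) x + b * ?P n x + c * ?P m x" for a b c n m
    proof -
      have "(\<lambda>x. d x * (of_real x ^ Suc k * ?P n x)) =
         (\<lambda>x. a * (d x * (of_real x ^ k * ?P (Suc n) x)) + b * (d x * (of_real x ^ k * ?P n x))
            + c * (d x * (of_real x ^ k * ?P m x)))"
      proof
        fix x
        have "d x * (of_real x ^ Suc k * ?P n x) = d x * of_real x ^ k * (of_real x * ?P n x)"
          by (simp only: power_Suc mult_ac)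
        then show "d x * (of_real x ^ Suc k * ?P n x) = a * (d x * (of_real x ^ k * ?P (Suc n) x))
            + b * (d x * (of_real x ^ k * ?P n x)) + c * (d x * (of_real x ^ k * ?P m x))"
          unfolding that by (simp only: ring_distribs mult_ac)
      qed
      then show ?thesis
        unfolding Q_def
        by (simp only:) (simp add: integral_add integrable_add integrable_on_mult_right int)
    qed
    show ?case
    proof
      fix n
      show "Q (Suc k) n = 0"
      proof (cases n)
        case 0
        have "of_real x * ?P n x = (1/2) * ?P (Suc n) x + (1/2) * ?P n x + 0 * ?P 0 x" for x
          using 0 by (simp add: legendre_P_1 algebra_simps)
        from lin[OF this] Suc show ?thesis by simp
      next
        case (Suc j)
        define N :: complex where "N = of_nat j"
        have nz: "2 * N + 3 \<noteq> 0"
          using of_nat_neq_0[of "2 * j + 2", where ?'a = complex] by (simp add: N_def algebra_simps)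
        have "of_real x * ?P n x = ((N + 2) / (2 * (2 * N + 3))) * ?P (Suc n) x + (1/2) * ?P n x
              + ((N + 1) / (2 * (2 * N + 3))) * ?P j x" for x
        proof -
          have "(N + 2) * ?P (Suc n) x = (2 * N + 3) * (2 * of_real x - 1) * ?P n x - (N + 1) * ?P j x"
            using arg_cong[OF legendre_P_recurrence[of j "2 * x - 1"], of complex_of_real] Suc by (simp add: N_def)
          then have "((N + 2) * ?P (Suc n) x + (N + 1) * ?P j x) / (2 * (2 * N + 3))
              = (2 * N + 3) * ((2 * of_real x - 1) * ?P n x) / (2 * (2 * N + 3))"
            by (simp add: algebra_simps)
          also have "\<dots> = (2 * of_real x - 1) * ?P n x / 2"
            using nonzero_mult_divide_mult_cancel_left[OF nz, of "(2 * of_real x - 1) * ?P n x" 2]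
            by (simp only: mult.commute[of 2])
          also have "\<dots> = (of_real x - 1/2) * ?P n x" by (simp add: field_simps)
          finally show ?thesis by (simp add: add_divide_distrib algebra_simps)
        qed
        from lin[OF this] Suc.IH show ?thesis by simp
      qed
    qed
  qed
  then have "Q k 0 = 0" ..
  then show ?thesis by (simp add: Q_def)
qed

lemma expansion_sums_interior:
  assumes x: "0 < x" "x < 1"
  shows "(\<lambda>m. expansion_coeff \<nu> m * of_real (legendre_P (2 * m) (2 * x - 1))) sums (legF \<nu> x * legF \<nu> (1 - x))"
proof -
  let ?P = "\<lambda>n x. complex_of_real (legendre_P n (2 * x - 1))"
  obtain C where C: "C > 0" "\<And>m. norm (expansion_coeff \<nu> m) \<le> C / (real m + 1)"
    using expansion_coeff_bound[of \<nu>] by blast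
  \<comment> \<open>The coefficient bound C / (m + 1) times the numerator cbin m / 2 of
    \<open>legendre_P_even_unit_bound\<close>; the weight is kept separate.\<close>
  define M where "M = (\<lambda>m. C / 2 * (cbin m / (real m + 1)))"
  have M: "summable M" unfolding M_def by (intro summable_mult summable_cbin_over_Suc)
  have M0: "0 \<le> M m" for m using C(1) by (simp add: M_def)
  have term_bound: "norm (expansion_coeff \<nu> m * ?P (2 * m) x) \<le> M m / sqrt (x * (1 - x))"
    if x: "0 < x" "x < 1" for m x
  proof -
    have "norm (expansion_coeff \<nu> m * ?P (2 * m) x) \<le> C / (real m + 1) * (cbin m / (2 * sqrt (x * (1 - x))))"
      unfolding norm_mult using C legendre_P_even_unit_bound[OF x, of m] by (intro mult_mono) auto
    also have "\<dots> = M m / sqrt (x * (1 - x))"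
      unfolding M_def by (simp only: times_divide_times_eq divide_divide_eq_left mult_ac)
    finally show ?thesis .
  qed
  define T where "T = (\<lambda>N x. \<Sum>m<N. expansion_coeff \<nu> m * ?P (2 * m) x)"
  define S where "S = (\<lambda>x. \<Sum>m. expansion_coeff \<nu> m * ?P (2 * m) x)"
  have sm: "summable (\<lambda>m. expansion_coeff \<nu> m * ?P (2 * m) x)" if x: "0 < x" "x < 1" for x
  proof (rule summable_comparison_test')
    show "summable (\<lambda>m. M m / sqrt (x * (1 - x)))" using M by (rule summable_divide)
  qed (use term_bound[OF x] in blast)
  have TS: "(\<lambda>N. T N x) \<longlonglongrightarrow> S x" if "0 < x" "x < 1" for x
    using summable_sums[OF sm[OF that]] by (simp add: sums_def T_def S_def)
  have T_bound: "norm (T N x) \<le> suminf M / sqrt (x * (1 - x))" if x: "0 < x" "x < 1" for N x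
  proof -
    have "norm (T N x) \<le> (\<Sum>m<N. M m / sqrt (x * (1 - x)))"
      unfolding T_def by (intro order.trans[OF norm_sum] sum_mono term_bound x)
    also have "\<dots> = (\<Sum>m<N. M m) / sqrt (x * (1 - x))" by (simp add: sum_divide_distrib)
    also have "\<dots> \<le> suminf M / sqrt (x * (1 - x))"
      using x M0 by (intro divide_right_mono sum_le_suminf M) auto
    finally show ?thesis .
  qed
  have S_bound: "norm (S x) \<le> suminf M / sqrt (x * (1 - x))" if x: "0 < x" "x < 1" for x
    by (rule tendsto_le[OF sequentially_bot tendsto_const tendsto_norm[OF TS[OF x]]])
       (use T_bound[OF x] in auto)
  \<comment> \<open>Multiplying by sqrt (x (1 - x)) removes the weight, so a single M-test works on
    the whole open interval; dividing it out afterwards preserves continuity.\<close>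
  have "uniform_limit {0<..<1} (\<lambda>N x. \<Sum>m<N. of_real (sqrt (x * (1 - x))) * (expansion_coeff \<nu> m * ?P (2 * m) x))
     (\<lambda>x. \<Sum>m. of_real (sqrt (x * (1 - x))) * (expansion_coeff \<nu> m * ?P (2 * m) x)) sequentially"
  proof (rule Weierstrass_m_test[OF _ M])
    fix m and x :: real assume "x \<in> {0<..<1}"
    then have x: "0 < x" "x < 1" by auto
    have "norm (of_real (sqrt (x * (1 - x))) * (expansion_coeff \<nu> m * ?P (2 * m) x))
        = sqrt (x * (1 - x)) * norm (expansion_coeff \<nu> m * ?P (2 * m) x)"
      using x by (simp only: norm_mult norm_of_real) simp
    also have "\<dots> \<le> sqrt (x * (1 - x)) * (M m / sqrt (x * (1 - x)))"
      using x by (intro mult_left_mono term_bound) auto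
    also have "\<dots> = M m" using x by simp
    finally show "norm (of_real (sqrt (x * (1 - x))) * (expansion_coeff \<nu> m * ?P (2 * m) x)) \<le> M m" .
  qed
  then have "continuous_on {0<..<1} (\<lambda>x. \<Sum>m. of_real (sqrt (x * (1 - x))) * (expansion_coeff \<nu> m * ?P (2 * m) x))"
    by (rule uniform_limit_theorem[rotated]) (simp, intro always_eventually allI continuous_intros)
  then have "continuous_on {0<..<1} (\<lambda>x. (\<Sum>m. of_real (sqrt (x * (1 - x))) * (expansion_coeff \<nu> m * ?P (2 * m) x))
      / of_real (sqrt (x * (1 - x))))"
    by (intro continuous_intros) auto
  moreover have "(\<Sum>m. of_real (sqrt (x * (1 - x))) * (expansion_coeff \<nu> m * ?P (2 * m) x))
      / of_real (sqrt (x * (1 - x))) = S x" if "x \<in> {0<..<1}" for x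
    using that suminf_mult[OF sm[of x], of "of_real (sqrt (x * (1 - x)))"] by (simp add: S_def)
  ultimately have S_cont: "continuous_on {0<..<1} S" by (rule continuous_on_eq)
  obtain D where D [rule_format]: "D > 0"
    "\<forall>x. 0 < x \<longrightarrow> x < 1 \<longrightarrow> norm (legF \<nu> x * legF \<nu> (1 - x)) \<le> D / sqrt (x * (1 - x))"
    by (rule legF_product_bounds[of \<nu>]) (rule that; assumption)
  define d where "d = (\<lambda>x. legF \<nu> x * legF \<nu> (1 - x) - S x)"
  have d_cont: "continuous_on {0<..<1} d"
    unfolding d_def by (intro continuous_intros continuous_on_legF continuous_on_legF_flip S_cont)
  have d_bound: "norm (d x) \<le> (D + suminf M) / sqrt (x * (1 - x))" if x: "0 < x" "x < 1" for x
    using order.trans[OF norm_triangle_ineq4 add_mono[OF D(2)[OF x] S_bound[OF x]]]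
    by (simp add: d_def add_divide_distrib)
  have leg: "integral {0<..<1} (\<lambda>x. d x * ?P n x) = 0" for n
  proof -
    obtain A where A [rule_format]: "A > 0" "\<forall>x. 0 \<le> x \<longrightarrow> x \<le> 1 \<longrightarrow> \<bar>legendre_P n (2 * x - 1)\<bar> \<le> A"
      by (rule legendre_P_bounded[of n]) (rule that; assumption)
    have bd: "norm (f x * ?P n x) \<le> suminf M * A / sqrt (x * (1 - x))"
      if "norm (f x) \<le> suminf M / sqrt (x * (1 - x))" "0 < x" "x < 1" for f :: "real \<Rightarrow> complex" and x
    proof -
      have "norm (f x * ?P n x) \<le> suminf M / sqrt (x * (1 - x)) * A"
        unfolding norm_mult using that A(2)[of x] order.trans[OF norm_ge_zero that(1)]
        by (intro mult_mono) auto
      then show ?thesis by simp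
    qed
    have SP: "(\<lambda>x. S x * ?P n x) integrable_on {0<..<1}"
    proof (rule weight_dominated_integrable(2))
      show "continuous_on {0<..<1} (\<lambda>x. S x * ?P n x)" by (intro continuous_intros S_cont)
      show "norm (S x * ?P n x) \<le> suminf M * A / sqrt (x * (1 - x))" if "0 < x" "x < 1" for x
        by (rule bd[of S, OF S_bound[OF that] that])
    qed
    have "(\<lambda>N. integral {0<..<1} (\<lambda>x. T N x * ?P n x)) \<longlonglongrightarrow> integral {0<..<1} (\<lambda>x. S x * ?P n x)"
    proof (rule weight_dominated_convergence)
      show "continuous_on {0<..<1} (\<lambda>x. T N x * ?P n x)" for N
        unfolding T_def by (intro continuous_intros)
      show "(\<lambda>N. T N x * ?P n x) \<longlonglongrightarrow> S x * ?P n x" if "0 < x" "x < 1" for x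
        by (intro tendsto_mult tendsto_const TS that)
      show "norm (T N x * ?P n x) \<le> suminf M * A / sqrt (x * (1 - x))" if "0 < x" "x < 1" for N x
        by (rule bd[of "T N", OF T_bound[OF that] that])
    qed
    \<comment> \<open>Orthogonality leaves at most the term with 2 m = n, where the factor 4 m + 1
      cancels the norm of P_(2m). The sequence is eventually constant in N, equal to
      \<open>legI \<nu> n\<close>, which is 0 for odd n.\<close>
    moreover have "integral {0<..<1} (\<lambda>x. T N x * ?P n x)
        = (\<Sum>m<N. if 2 * m = n then legI \<nu> n else 0)" for N
    proof -
      have ii: "(\<lambda>x. ?P k x * ?P n x) integrable_on {0<..<1}" for k
        unfolding integrable_on_Icc_iff_Ioo[symmetric] by (intro integrable_continuous_real continuous_intros)
      have "(\<lambda>x. T N x * ?P n x) = (\<lambda>x. \<Sum>m<N. expansion_coeff \<nu> m * (?P (2 * m) x * ?P n x))"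
        by (simp add: T_def sum_distrib_right mult.assoc)
      then have "integral {0<..<1} (\<lambda>x. T N x * ?P n x)
          = (\<Sum>m<N. expansion_coeff \<nu> m * integral {0<..<1} (\<lambda>x. ?P (2 * m) x * ?P n x))"
        by (simp add: integral_sum integrable_on_mult_right ii)
      also have "\<dots> = (\<Sum>m<N. if 2 * m = n then legI \<nu> n else 0)"
      proof (rule sum.cong[OF refl])
        fix m
        have "(4 * of_nat m + 1 :: complex) \<noteq> 0"
          using of_nat_neq_0[of "4 * m", where ?'a = complex] by (simp add: add.commute)
        then show "expansion_coeff \<nu> m * integral {0<..<1} (\<lambda>x. ?P (2 * m) x * ?P n x)
            = (if 2 * m = n then legI \<nu> n else 0)"
          unfolding complex_integral_legendre_mult expansion_coeff_legI[symmetric] by (auto simp: add.commute)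
      qed
      finally show ?thesis .
    qed
    ultimately have lim: "(\<lambda>N. \<Sum>m<N. if 2 * m = n then legI \<nu> n else 0) \<longlonglongrightarrow> integral {0<..<1} (\<lambda>x. S x * ?P n x)"
      by simp
    have "(\<lambda>N. \<Sum>m<N. if 2 * m = n then legI \<nu> n else 0) \<longlonglongrightarrow> legI \<nu> n"
    proof (cases "even n")
      case True
      then obtain j where j: "n = 2 * j" by blast
      have "(\<lambda>m. if m = j then legI \<nu> n else 0) sums legI \<nu> n" by (rule sums_single)
      then show ?thesis by (simp add: sums_def j)
    next
      case False
      then obtain j where "n = 2 * j + 1" by (blast elim: oddE)
      then have "legI \<nu> n = 0" by (simp only: legI_odd)
      then show ?thesis by (simp cong: if_cong)
    qed
    then have eq: "integral {0<..<1} (\<lambda>x. S x * ?P n x) = legI \<nu> n"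
      using lim LIMSEQ_unique by blast
    have "((\<lambda>x. legF \<nu> x * legF \<nu> (1 - x) * ?P n x - S x * ?P n x) has_integral (legI \<nu> n - legI \<nu> n)) {0<..<1}"
      using integrable_integral[OF SP] unfolding eq by (intro has_integral_diff legI_has_integral)
    then show ?thesis by (simp add: d_def left_diff_distrib integral_unique)
  qed
  have "d x = 0"
    by (rule vanishes_if_moments_vanish[OF d_cont d_bound
          moments_vanish_if_legendre_coeffs_vanish[OF d_cont d_bound leg] x])
  then show ?thesis
    using summable_sums[OF sm[OF x]] by (simp add: d_def S_def)
qed

lemma hyp_coeff_Int_eventually_0:
  assumes "\<nu> \<in> \<int>"
  obtains K where "\<forall>k\<ge>K. hyp_coeff \<nu> k = 0"
proof -
  obtain j where j: "\<nu> = of_int j" using assms by (auto elim: Ints_cases)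
  show ?thesis
  proof (rule that[of "nat \<bar>j\<bar> + 1"], intro allI impI)
    fix k assume k: "nat \<bar>j\<bar> + 1 \<le> k"
    show "hyp_coeff \<nu> k = 0"
    proof (cases "j \<ge> 0")
      case True
      then have "- \<nu> = - of_nat (nat j)" by (simp add: j)
      then have "pochhammer (- \<nu>) k = 0" using k by (simp only: pochhammer_of_nat_eq_0_iff)
      then show ?thesis by (simp add: hyp_coeff_pochhammer)
    next
      case False
      then have "\<nu> + 1 = - of_nat (nat (- j - 1))" by (simp add: j)
      then have "pochhammer (\<nu> + 1) k = 0" using k False by (simp only: pochhammer_of_nat_eq_0_iff)
      then show ?thesis by (simp add: hyp_coeff_pochhammer)
    qed
  qed
qed

text \<open>Both sides are finite sums and hence continuous, so the equality on the open interval
  extends to its closure.\<close>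

lemma expansion_sums_Int:
  assumes \<nu>: "\<nu> \<in> \<int>" and x: "x \<in> {0..1}"
  shows "(\<lambda>m. expansion_coeff \<nu> m * of_real (legendre_P (2 * m) (2 * x - 1))) sums (legF \<nu> x * legF \<nu> (1 - x))"
proof -
  obtain K where K: "\<forall>k\<ge>K. hyp_coeff \<nu> k = 0" using \<nu> by (rule hyp_coeff_Int_eventually_0)
  obtain M where M: "\<forall>m\<ge>M. expansion_coeff \<nu> m = 0" using \<nu> by (rule expansion_coeff_Int_eventually_0)
  have legF_sum: "legF \<nu> x = (\<Sum>k<K. hyp_coeff \<nu> k * of_real x ^ k)" for x
    unfolding legF_eq_suminf by (rule suminf_finite) (use K in auto)
  define s where "s = (\<lambda>x. \<Sum>m<M. expansion_coeff \<nu> m * complex_of_real (legendre_P (2 * m) (2 * x - 1)))"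
  have sums: "(\<lambda>m. expansion_coeff \<nu> m * of_real (legendre_P (2 * m) (2 * x - 1))) sums s x" for x
    unfolding s_def by (rule sums_finite) (use M in auto)
  have "closed {x. s x = legF \<nu> x * legF \<nu> (1 - x)}"
    unfolding s_def legF_sum by (intro closed_Collect_eq continuous_intros)
  moreover have "{0<..<1} \<subseteq> {x. s x = legF \<nu> x * legF \<nu> (1 - x)}"
    using sums_unique2[OF sums expansion_sums_interior] by auto
  ultimately have "closure {0<..<1} \<subseteq> {x. s x = legF \<nu> x * legF \<nu> (1 - x)}"
    by (rule closure_minimal[rotated])
  then have "s x = legF \<nu> x * legF \<nu> (1 - x)" using x by auto
  then show ?thesis using sums[of x] by simp
qed

text \<open>At x = 0 or 1 one hypergeometric factor is 1, the other is the sum of the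
  \<open>hyp_coeff \<nu> k\<close>, and every P_(2m) equals 1. For \<nu> not an integer both series
  have terms asymptotic to a nonzero multiple of 1/k; \<open>hyp2F1_product\<close> is then an
  unspecified value, and the end points are described by partial products and partial sums that tend
  to infinity. The last conjuncts identify the series as the Fourier-Legendre expansion, which
  pointwise convergence alone does not say.\<close>

theorem theorem2p1:
  fixes \<nu> :: complex and x :: real
  assumes "x \<in> {0..1}"
  shows "(x \<in> {0<..<1} \<or> \<nu> \<in> \<int> \<longrightarrow>
            (\<lambda>m. expansion_coeff \<nu> m * of_real (legendre_P (2 * m) (2 * x - 1)))
              sums hyp2F1_product \<nu> x)
       \<and> (x \<in> {0, 1} \<and> \<nu> \<notin> \<int> \<longrightarrow>
            filterlim (\<lambda>N. hyp2F1_partial (- \<nu>) (\<nu> + 1) 1 N (of_real x)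
                         * hyp2F1_partial (- \<nu>) (\<nu> + 1) 1 N (of_real (1 - x)))
              at_infinity sequentially
          \<and> filterlim (\<lambda>N. \<Sum>m<N. expansion_coeff \<nu> m * of_real (legendre_P (2 * m) (2 * x - 1)))
              at_infinity sequentially)
       \<and> hyp2F1_product \<nu> absolutely_integrable_on {0..1}
       \<and> (\<forall>m. fourier_legendre_coeff (hyp2F1_product \<nu>) (2 * m) = expansion_coeff \<nu> m)
       \<and> (\<forall>m. fourier_legendre_coeff (hyp2F1_product \<nu>) (2 * m + 1) = 0)"
proof (intro conjI impI allI)
  assume "x \<in> {0<..<1} \<or> \<nu> \<in> \<int>"
  then show "(\<lambda>m. expansion_coeff \<nu> m * of_real (legendre_P (2 * m) (2 * x - 1))) sums hyp2F1_product \<nu> x"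
    unfolding hyp2F1_product_legF
    using expansion_sums_interior[of x \<nu>] expansion_sums_Int[OF _ assms] by auto
next
  assume x: "x \<in> {0, 1} \<and> \<nu> \<notin> \<int>"
  have partial0: "hyp2F1_partial (- \<nu>) (\<nu> + 1) 1 N 0 = 1" if "N > 0" for N
  proof -
    have "hyp2F1_partial (- \<nu>) (\<nu> + 1) 1 N 0 = (\<Sum>k<N. if k = 0 then hyp_coeff \<nu> 0 else 0)"
      unfolding hyp2F1_partial_def hyp_coeff_def[symmetric] by (rule sum.cong) auto
    then show ?thesis using that by simp
  qed
  have partial1: "hyp2F1_partial (- \<nu>) (\<nu> + 1) 1 N 1 = (\<Sum>k<N. hyp_coeff \<nu> k)" for N
    by (simp add: hyp2F1_partial_def hyp_coeff_def)
  have "- \<nu> \<notin> \<int>\<^sub>\<le>\<^sub>0" "\<nu> + 1 \<notin> \<int>\<^sub>\<le>\<^sub>0"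
    using not_nonpos_Ints_of_not_Int[of \<nu> 0] x by auto
  then have "rGamma (- \<nu>) * rGamma (\<nu> + 1) \<noteq> 0" by (simp add: rGamma_eq_zero_iff)
  then have "filterlim (\<lambda>N. \<Sum>k<N. hyp_coeff \<nu> k) at_infinity sequentially"
    by (rule sum_at_infinity_of_harmonic_decay[OF hyp_coeff_limit])
  moreover have "\<forall>\<^sub>F N in sequentially. (\<Sum>k<N. hyp_coeff \<nu> k) =
      hyp2F1_partial (- \<nu>) (\<nu> + 1) 1 N (of_real x) * hyp2F1_partial (- \<nu>) (\<nu> + 1) 1 N (of_real (1 - x))"
    using eventually_gt_at_top[of 0] by eventually_elim (use x in \<open>auto simp: partial0 partial1\<close>)
  ultimately show "filterlim (\<lambda>N. hyp2F1_partial (- \<nu>) (\<nu> + 1) 1 N (of_real x)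
        * hyp2F1_partial (- \<nu>) (\<nu> + 1) 1 N (of_real (1 - x))) at_infinity sequentially"
    using filterlim_cong[OF refl refl] by fast
  obtain L where L: "L \<noteq> 0" "(\<lambda>m. of_nat m * expansion_coeff \<nu> m) \<longlonglongrightarrow> L"
    using x expansion_coeff_limit by blast
  have "legendre_P (2 * m) (2 * x - 1) = 1" for m
    using x legendre_P_at_1[of "2 * m"] legendre_P_minus[of "2 * m" 1] by auto
  then show "filterlim (\<lambda>N. \<Sum>m<N. expansion_coeff \<nu> m * of_real (legendre_P (2 * m) (2 * x - 1)))
      at_infinity sequentially"
    using sum_at_infinity_of_harmonic_decay[OF L(2,1)] by simp
next
  show "hyp2F1_product \<nu> absolutely_integrable_on {0..1}"
    using legI_integrand_absolutely_integrable[of \<nu> 0]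
    by (simp add: absolutely_integrable_on_Icc_iff_Ioo hyp2F1_product_legF[abs_def])
next
  show "fourier_legendre_coeff (hyp2F1_product \<nu>) (2 * m) = expansion_coeff \<nu> m" for m
    unfolding fourier_legendre_coeff_legI expansion_coeff_legI[symmetric] by simp
next
  show "fourier_legendre_coeff (hyp2F1_product \<nu>) (2 * m + 1) = 0" for m
    unfolding fourier_legendre_coeff_legI legI_odd by simp
qed

end
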